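(* Let $\varepsilon>0$ be fixed, let $p>2$ be a fixed prime, and let $\alpha_1,\alpha_2,\alpha_3$ be fixed integers coprime to $p$ such that $p>s_p(\alpha_1,\alpha_2,\alpha_3)$. Let $\Phi:\mathbb{R}\rightarrow\mathbb{R}_{\ge 0}$ be a Schwartz class function. For $n\in\mathbb{N}$ set $q:=p^n$. Then, as $n\rightarrow\infty$, uniformly for $N\ge q^{1/2+\varepsilon}$, $$ \sum_{\substack{(x_1,x_2,x_3)\in\mathbb{Z}^3\\ (x_1x_2x_3,p)=1\\ \alpha_1x_1^2+\alpha_2x_2^2+\alpha_3x_3^2\equiv 0 \bmod q}}\Phi\left(\frac{x_1}{N}\right)\Phi\left(\frac{x_2}{N}\right)\Phi\left(\frac{x_3}{N}\right)\sim \hat{\Phi}(0)^3\cdot C_p(\alpha_1,\alpha_2,\alpha_3)\cdot\frac{N^3}{q}. $$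
   Context: For integers $\alpha_1,\alpha_2,\alpha_3$ coprime to $p$, define $$s_p(\alpha_1,\alpha_2,\alpha_3):=2+\left(\frac{-\alpha_1\alpha_2}{p}\right)+\left(\frac{-\alpha_1\alpha_3}{p}\right)+\left(\frac{-\alpha_2\alpha_3}{p}\right),$$ where $\left(\frac{\cdot}{p}\right)$ is the Legendre symbol, and $$C_p(\alpha_1,\alpha_2,\alpha_3):=\frac{(p-s_p(\alpha_1,\alpha_2,\alpha_3))(p-1)}{p^2}.$$ $\hat{\Phi}$ denotes the Fourier transform $\hat\Phi(y)=\int_{\mathbb{R}}\Phi(x)e^{-2\pi i xy}\,dx$, so $\hat\Phi(0)=\int_{\mathbb{R}}\Phi(x)\,dx$. The asymptotic "$\sim$" means the ratio of the two sides tends to $1$ as $n\to\infty$ (with $N=N(n)\ge q^{1/2+\varepsilon}$ arbitrary). *)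

theory Defs
  imports "HOL-Analysis.Analysis" "HOL-Number_Theory.Number_Theory"
begin

definition schwartz :: "(real \<Rightarrow> real) \<Rightarrow> bool" where
  "schwartz f \<longleftrightarrow>
     (\<forall>k x. ((deriv ^^ k) f) differentiable (at x)) \<and>
     (\<forall>k m. \<exists>C. \<forall>x. \<bar>x\<bar> ^ m * \<bar>(deriv ^^ k) f x\<bar> \<le> C)"

definition s_p :: "int \<Rightarrow> int \<Rightarrow> int \<Rightarrow> int \<Rightarrow> int" where
  "s_p p a1 a2 a3 = 2 + Legendre (- a1 * a2) p + Legendre (- a1 * a3) p + Legendre (- a2 * a3) p"

definition C_p :: "int \<Rightarrow> int \<Rightarrow> int \<Rightarrow> int \<Rightarrow> real" where
  "C_p p a1 a2 a3 = real_of_int ((p - s_p p a1 a2 a3) * (p - 1)) / real_of_int (p ^ 2)"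

definition fourier_at_0 :: "(real \<Rightarrow> real) \<Rightarrow> real" where
  "fourier_at_0 f = integral UNIV f"

end

theory Submission
  imports Defs "HOL-Real_Asymp.Real_Asymp"
begin

text \<open>Finite Fourier inversion modulo \<open>q = p ^ n\<close> writes the weighted count as a sum over
  frequencies \<open>k\<close> in \<open>(\<int>/q)\<^sup>3\<close> of the exponential sum of the solution set at \<open>k\<close> times
  three transforms of \<open>\<Phi>(x/N)\<close>. The frequency \<open>0\<close> gives the main term: square roots of units lift
  uniquely from \<open>p\<close> to \<open>p ^ n\<close>, and modulo \<open>p\<close> the conic is counted with Legendre symbols.
  Repeated summation by parts makes all frequencies beyond \<open>L = q powr (1/2 - \<epsilon>/2)\<close> negligible.
  For the remaining \<open>k \<noteq> 0\<close>, averaging over infinitesimal isometries and scalings shows that only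
  solutions nearly proportional to \<open>k\<close> contribute, which forces the dual form to vanish at \<open>k\<close>
  modulo \<open>p ^ (n - 1)\<close>, hence exactly, since \<open>L\<^sup>2\<close> is small against \<open>q\<close>. Primitive isotropic
  vectors of size at most \<open>X\<close> number \<open>O(X)\<close>, because two of them that are proportional modulo a
  power of \<open>p\<close> exceeding a multiple of \<open>X\<close> agree up to sign.\<close>

section \<open>Exponential sums\<close>

text \<open>The obstacle is that N may barely exceed q^(1/2), so that the frequencies to be
  controlled fill a box of radius \<open>L\<close> just below q^(1/2). The solution set has order
  q^2 elements, hence the exponential sums at the nonzero frequencies of the box must total o(q^2).
  The box holds nearly q^(3/2) frequencies, while the bound for one sum is of order q^(3/2) times a
  gcd, so bounding every frequency separately is hopeless. The gain comes from sparsity: a sum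
  vanishes unless its frequency is isotropic, only about L frequencies are, and q^(3/2) * L = q^(2 -
  \<epsilon>/2). The gcd and the imprimitive frequencies cost a polynomial factor in n = log q / log
  p, which the saving q^(-\<epsilon>/2) absorbs. Averaging takes the place of an evaluation by Gauss
  sums. The assumption p > \<open>s_p\<close> makes the main term positive, so that an absolute
  error can be turned into a relative one.\<close>

definition ee :: "int \<Rightarrow> int \<Rightarrow> complex" where
  "ee q x = cis (2 * pi * (real_of_int x / real_of_int q))"

lemma ee_0 [simp]: "ee q 0 = 1"
  by (simp add: ee_def)

lemma ee_add: "ee q (x + y) = ee q x * ee q y"
  by (simp add: ee_def cis_mult add_divide_distrib distrib_left)

lemma norm_ee [simp]: "norm (ee q x) = 1"
  by (simp add: ee_def)

lemma ee_power: "ee q x ^ k = ee q (int k * x)"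
  by (induction k) (simp_all add: ee_add distrib_right)

lemma ee_eq_1_iff: "q > 0 \<Longrightarrow> ee q x = 1 \<longleftrightarrow> q dvd x"
proof -
  assume q: "q > 0"
  have "ee q x = 1 \<longleftrightarrow> cos (2 * pi * (real_of_int x / real_of_int q)) = 1"
    by (auto simp: ee_def complex_eq_iff cos_one_sin_zero)
  also have "\<dots> \<longleftrightarrow> (\<exists>k::int. 2 * pi * (real_of_int x / real_of_int q) = real_of_int k * 2 * pi)"
    unfolding cos_one_2pi_int by (simp add: mult_ac)
  also have "\<dots> \<longleftrightarrow> (\<exists>k::int. real_of_int x = real_of_int (k * q))"
    using q by (simp add: field_simps)
  also have "\<dots> \<longleftrightarrow> q dvd x"
    unfolding of_int_eq_iff by (auto simp: dvd_def mult.commute)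
  finally show ?thesis .
qed

lemma ee_cong: "q > 0 \<Longrightarrow> [x = y] (mod q) \<Longrightarrow> ee q x = ee q y"
proof -
  assume "q > 0" "[x = y] (mod q)"
  then have "ee q (x - y) = 1"
    by (simp add: ee_eq_1_iff cong_iff_dvd_diff)
  then show ?thesis
    using ee_add[of q "x - y" y] by simp
qed

text \<open>Orthogonality of characters by the geometric series. The starting point \<open>a\<close>
  is kept free because the averaging argument uses residues from 0 on, whereas the inversion formula
  uses residues symmetric about 0.\<close>

lemma sum_ee:
  assumes "q > 0"
  shows "(\<Sum>t\<in>{a..<a+q}. ee q (t * c)) = (if q dvd c then of_int q else 0)"
proof (cases "q dvd c")
  case True
  then have "ee q (t * c) = 1" for t
    using assms by (simp add: ee_eq_1_iff)
  then show ?thesis using True assms by simp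
next
  case False
  define z where "z = ee q c"
  have z1: "z \<noteq> 1" using False assms by (simp add: z_def ee_eq_1_iff)
  have zq: "z ^ nat q = 1" using assms by (simp add: z_def ee_power ee_eq_1_iff)
  have "(\<Sum>t\<in>{a..<a+q}. ee q (t * c)) = (\<Sum>i<nat q. ee q (a * c) * z ^ i)"
    by (rule sum.reindex_bij_witness[of _ "\<lambda>i. a + int i" "\<lambda>t. nat (t - a)"])
       (auto simp: z_def ee_power ee_add[symmetric] algebra_simps)
  also have "\<dots> = ee q (a * c) * (\<Sum>i<nat q. z ^ i)"
    by (simp add: sum_distrib_left)
  also have "(\<Sum>i<nat q. z ^ i) = 0"
    using z1 zq by (simp add: sum_gp_strict)
  finally show ?thesis using False by simp
qed

text \<open>Averaging over a group action that shifts the phase linearly kills all points with a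
  nontrivial phase increment.\<close>

lemma sum_ee_average:
  assumes "finite S" "q > 0"
    and maps: "\<And>t x. x \<in> S \<Longrightarrow> f t x \<in> S"
    and inj: "\<And>t. inj_on (f t) S"
    and phase: "\<And>t x. x \<in> S \<Longrightarrow> [\<psi> (f t x) = \<psi> x + t * c x] (mod q)"
  shows "(\<Sum>x\<in>S. ee q (\<psi> x)) = (\<Sum>x\<in>{x\<in>S. q dvd c x}. ee q (\<psi> x))"
proof -
  have bij: "(\<Sum>x\<in>S. ee q (\<psi> (f t x))) = (\<Sum>x\<in>S. ee q (\<psi> x))" for t
  proof -
    have "f t ` S = S"
      using endo_inj_surj[OF assms(1) _ inj] maps by blast
    then show ?thesis
      using sum.reindex[OF inj, of "\<lambda>x. ee q (\<psi> x)" t] by simp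
  qed
  \<comment> \<open>The set \<open>{0..<0+q}\<close> is the case \<open>a = 0\<close> of
    \<open>sum_ee\<close>, written so that the rule matches syntactically.\<close>
  have "of_int q * (\<Sum>x\<in>S. ee q (\<psi> x)) = (\<Sum>t\<in>{0..<0+q}. \<Sum>x\<in>S. ee q (\<psi> (f t x)))"
    using assms(2) by (simp add: bij)
  also have "\<dots> = (\<Sum>t\<in>{0..<0+q}. \<Sum>x\<in>S. ee q (\<psi> x) * ee q (t * c x))"
    by (intro sum.cong refl) (simp add: ee_cong[OF assms(2) phase] ee_add)
  also have "\<dots> = (\<Sum>x\<in>S. ee q (\<psi> x) * (\<Sum>t\<in>{0..<0+q}. ee q (t * c x)))"
    by (subst sum.swap) (simp add: sum_distrib_left)
  also have "\<dots> = (\<Sum>x\<in>S. if q dvd c x then of_int q * ee q (\<psi> x) else 0)"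
    unfolding sum_ee[OF assms(2)] by (intro sum.cong) auto
  also have "\<dots> = (\<Sum>x\<in>{x\<in>S. q dvd c x}. of_int q * ee q (\<psi> x))"
    using assms(1) by (simp add: sum.inter_filter)
  also have "\<dots> = of_int q * (\<Sum>x\<in>{x\<in>S. q dvd c x}. ee q (\<psi> x))"
    by (simp add: sum_distrib_left)
  finally show ?thesis using assms(2) by simp
qed

text \<open>The norm equals 2 sin \<open>th\<close> with \<open>th\<close> = pi |x| / q at most
  pi/2. There \<open>th\<close>^2 \<le> 3, so the cubic Taylor bound gives sin \<open>th\<close>
  \<ge> \<open>th\<close>/2. The constant is far from optimal but makes every summation by parts
  gain a full factor |x|/q.\<close>

lemma norm_ee_minus_1_ge:
  assumes "q > 0" "2 * \<bar>x\<bar> \<le> q"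
  shows "norm (ee q x - 1) \<ge> real_of_int \<bar>x\<bar> / real_of_int q"
proof -
  define th where "th = pi * (real_of_int \<bar>x\<bar> / real_of_int q)"
  have th0: "0 \<le> th" using assms by (simp add: th_def)
  have le: "real_of_int \<bar>x\<bar> / real_of_int q \<le> 1 / 2"
    using assms by (simp add: field_simps flip: of_int_abs)
  then have th1: "th \<le> pi / 2"
    using mult_left_mono[OF le, of pi] by (simp add: th_def)
  have sin0: "sin th \<ge> 0" using th0 th1 by (intro sin_ge_zero) auto
  have eq: "norm (ee q x - 1) = 2 * sin th"
  proof -
    have "2 * pi * (real_of_int x / real_of_int q) = 2 * th \<or> 2 * pi * (real_of_int x / real_of_int q) = - (2 * th)"
      by (auto simp: th_def abs_if)
    then have "(norm (ee q x - 1))\<^sup>2 = (cos (2 * th) - 1)\<^sup>2 + (sin (2 * th))\<^sup>2"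
      unfolding cmod_power2 ee_def by (auto simp: power2_eq_square)
    also have "\<dots> = 2 - 2 * cos (2 * th)"
      using sin_cos_squared_add[of "2 * th"] by (simp add: power2_eq_square algebra_simps)
    also have "\<dots> = (2 * sin th)\<^sup>2"
      by (simp add: cos_double_sin power2_eq_square)
    finally show ?thesis
      using sin0 by (metis norm_ge_zero mult_nonneg_nonneg power2_eq_imp_eq zero_le_numeral)
  qed
  have "th - th ^ 3 / 6 \<le> sin th"
    using Maclaurin_sin_bound[of th 3] th0
    by (simp add: eval_nat_numeral sin_coeff_def field_simps abs_if split: if_splits)
  moreover have "th ^ 3 \<le> 3 * th"
  proof -
    have "th \<le> 1.6" using th1 pi_less_4 pi_approx by simp
    then have "th * th \<le> 1.6 * 1.6" using th0 by (intro mult_mono) auto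
    then have "(th * th) * th \<le> 3 * th" using th0 by (intro mult_right_mono) auto
    then show ?thesis by (simp add: power3_eq_cube)
  qed
  ultimately have "th \<le> 2 * sin th" by simp
  moreover have "real_of_int \<bar>x\<bar> / real_of_int q \<le> th"
    using mult_right_mono[of 1 pi "real_of_int \<bar>x\<bar> / real_of_int q"] assms pi_gt3
    by (simp add: th_def)
  ultimately show ?thesis unfolding eq by linarith
qed

section \<open>Quadratic congruences modulo prime powers\<close>

lemma residue_eqI:
  fixes x y q :: int
  assumes "0 \<le> x" "x < q" "0 \<le> y" "y < q" "q dvd x - y"
  shows "x = y"
  using assms by (metis cong_iff_dvd_diff cong_less_imp_eq_int)

text \<open>Certificates for congruences: many steps below give the coefficients \<open>u\<close>,
  \<open>v\<close> explicitly, so that only a polynomial identity is left to the simplifier.\<close>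

lemma dvd_linear2:
  fixes d x y :: int
  assumes "d dvd x" "d dvd y" "z = u * x + v * y"
  shows "d dvd z"
  unfolding assms(3) by (intro dvd_add dvd_mult assms(1,2))

lemma dvd_linear3:
  fixes d x y w :: int
  assumes "d dvd x" "d dvd y" "d dvd w" "z = u * x + v * y + r * w"
  shows "d dvd z"
  unfolding assms(4) by (intro dvd_add dvd_mult assms(1-3))

locale odd_prime =
  fixes p :: int
  assumes p: "prime p" "p > 2"
begin

lemma not_p_dvd_2: "\<not> p dvd 2"
  using p by (auto dest: zdvd_imp_le)

lemma odd_p: "odd p"
  using p primes_dvd_imp_eq[of 2 p] by auto

lemma coprime_p_iff: "coprime x p \<longleftrightarrow> \<not> p dvd x"
  using p(1) by (metis coprime_commute coprime_def dvd_refl not_prime_unit prime_imp_coprime)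

text \<open>For \<open>n = 0\<close> the modulus is 1 and the congruence says nothing about
  \<open>b\<close>, hence the guard on the second conclusion.\<close>

lemma unit_inverse_mod:
  assumes "\<not> p dvd a"
  obtains b where "p ^ n dvd a * b - 1" "n > 0 \<longrightarrow> \<not> p dvd b"
proof -
  have "coprime a (p ^ n)" using assms coprime_p_iff by simp
  then obtain b where b: "[a * b = 1] (mod p ^ n)"
    using coprime_iff_invertible_int by blast
  have "\<not> p dvd b" if "n > 0"
  proof
    assume "p dvd b"
    moreover have "p dvd a * b - 1"
      using b that by (metis cong_iff_dvd_diff dvd_power dvd_trans)
    ultimately have "p dvd a * b - (a * b - 1)" by (metis dvd_diff dvd_mult)
    then have "p dvd 1" by simp
    then show False using p by (simp add: not_prime_unit)
  qed
  then show ?thesis using b that by (auto simp: cong_iff_dvd_diff)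
qed

text \<open>Since the two factors add up to twice a unit, at most one is divisible.\<close>

lemma prime_power_dvd_square_diff:
  assumes "p ^ n dvd a * (c - d) * (c + d)" "\<not> p dvd a" "\<not> p dvd c"
  shows "p ^ n dvd c - d \<or> p ^ n dvd c + d"
proof -
  have "coprime (p ^ n) a" using assms(2) coprime_p_iff by (simp add: coprime_commute)
  then have dvd: "p ^ n dvd (c - d) * (c + d)"
    using assms(1) by (simp add: coprime_dvd_mult_right_iff mult.assoc)
  have "\<not> (p dvd c - d \<and> p dvd c + d)"
  proof
    assume "p dvd c - d \<and> p dvd c + d"
    then have "p dvd (c - d) + (c + d)" using dvd_add by blast
    then have "p dvd 2 * c" by simp
    then show False using assms(3) not_p_dvd_2 p(1) by (auto simp only: prime_dvd_mult_iff)
  qed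
  then consider "coprime (c - d) (p ^ n)" | "coprime (c + d) (p ^ n)"
    using coprime_p_iff by auto
  then show ?thesis
    by cases (use dvd in \<open>auto simp: coprime_commute coprime_dvd_mult_right_iff coprime_dvd_mult_left_iff\<close>)
qed

text \<open>The admissible values of one coordinate of a solution once the other terms of the form
  add up to \<open>s\<close>.\<close>

definition roots :: "nat \<Rightarrow> int \<Rightarrow> int \<Rightarrow> int set" where
  "roots n a s = {c \<in> {0..<p ^ n}. \<not> p dvd c \<and> p ^ n dvd a * c\<^sup>2 + s}"

lemma finite_roots [simp]: "finite (roots n a s)"
  by (rule finite_subset[of _ "{0..<p ^ n}"]) (auto simp: roots_def)

text \<open>One step of Hensel lifting: reduction modulo p^n is a bijection between the root sets,
  because the derivative 2ac is a unit. Two lifts of the same root satisfy p | c - d, so p cannot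
  divide c + d as well, and the whole power must divide c - d.\<close>

lemma card_roots_Suc:
  assumes "\<not> p dvd a" "n > 0"
  shows "card (roots (Suc n) a s) = card (roots n a s)"
proof (rule bij_betw_same_card[of "\<lambda>c. c mod p ^ n"], rule bij_betw_imageI, goal_cases)
  case 1
  have p0: "p > 0" using p by simp
  show "inj_on (\<lambda>c. c mod p ^ n) (roots (Suc n) a s)"
  proof (rule inj_onI)
    fix c d assume c: "c \<in> roots (Suc n) a s" and d: "d \<in> roots (Suc n) a s"
      and eq: "c mod p ^ n = d mod p ^ n"
    from eq have n_dvd: "p ^ n dvd c - d" by (simp add: mod_eq_dvd_iff)
    then have p_dvd: "p dvd c - d" using assms(2) by (meson dvd_power dvd_trans)
    have "p ^ Suc n dvd (a * c\<^sup>2 + s) - (a * d\<^sup>2 + s)"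
      using c d by (intro dvd_diff) (auto simp: roots_def)
    also have "(a * c\<^sup>2 + s) - (a * d\<^sup>2 + s) = a * (c - d) * (c + d)"
      by (simp add: power2_eq_square algebra_simps)
    finally have "p ^ Suc n dvd c - d \<or> p ^ Suc n dvd c + d"
      using prime_power_dvd_square_diff[of "Suc n"] assms(1) c by (simp add: roots_def)
    moreover have "\<not> p ^ Suc n dvd c + d"
    proof
      assume "p ^ Suc n dvd c + d"
      then have "p dvd c + d" by (metis dvd_power dvd_trans zero_less_Suc)
      then have "p dvd (c - d) + (c + d)" using p_dvd by (rule dvd_add[rotated])
      then have "p dvd 2 * c" by simp
      then show False using c not_p_dvd_2 p(1) by (auto simp: prime_dvd_mult_iff roots_def)
    qed
    ultimately show "c = d" using c d by (intro residue_eqI[of c "p ^ Suc n"]) (auto simp: roots_def)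
  qed
next
  case 2
  show ?case
  proof (intro equalityI subsetI)
    fix c assume "c \<in> (\<lambda>c. c mod p ^ n) ` roots (Suc n) a s"
    then obtain d where d: "d \<in> roots (Suc n) a s" "c = d mod p ^ n" by auto
    have pd: "p ^ n dvd d - c" using d(2) by (metis dvd_minus_mod)
    then have "p dvd d - c" using assms(2) by (meson dvd_power dvd_trans)
    then have "\<not> p dvd c" using d(1) dvd_add[of p "d - c" c] by (auto simp: roots_def)
    moreover have "p ^ n dvd a * c\<^sup>2 + s"
    proof -
      have "p ^ n dvd a * d\<^sup>2 + s" using d(1) by (auto simp: roots_def intro: dvd_trans[OF le_imp_power_dvd[of n "Suc n"]])
      moreover have "a * c\<^sup>2 + s = a * d\<^sup>2 + s - a * (d + c) * (d - c)"
        by (simp add: power2_eq_square algebra_simps)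
      ultimately show ?thesis using pd by (metis dvd_diff dvd_mult)
    qed
    ultimately show "c \<in> roots n a s" using d(2) p by (auto simp: roots_def)
  next
    fix c assume c: "c \<in> roots n a s"
    have p0: "p > 0" using p by simp
    obtain e where e: "a * c\<^sup>2 + s = p ^ n * e" using c by (auto simp: roots_def)
    \<comment> \<open>Newton step: \<open>y\<close> solves 2acy + e \<equiv> 0 modulo p, so that c +
      p^n y cancels the next digit. The quadratic remainder carries p^(2n), which is divisible by
      p^(n+1) because n > 0.\<close>
    have "\<not> p dvd 2 * a * c" using c assms not_p_dvd_2 p(1) by (auto simp: roots_def prime_dvd_mult_iff)
    then obtain b where b: "p dvd 2 * a * c * b - 1"
      using unit_inverse_mod[of "2 * a * c" 1] by auto
    define y where "y = (- b * e) mod p"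
    have y: "0 \<le> y" "y < p" using p0 by (auto simp: y_def)
    have ye: "p dvd 2 * a * c * y + e"
    proof -
      have "p dvd y + b * e" unfolding y_def by (metis add.commute diff_minus_eq_add dvd_minus_mod minus_mult_left minus_minus dvd_diff_commute)
      then have "p dvd 2 * a * c * (y + b * e) - (2 * a * c * b - 1) * e" using b by (intro dvd_diff) auto
      then show ?thesis by (simp add: algebra_simps)
    qed
    define d where "d = c + p ^ n * y"
    have d_mod: "d mod p ^ n = c" using c by (auto simp: d_def roots_def)
    have "0 \<le> d" using c y p0 by (auto simp: d_def roots_def)
    moreover have "d < p ^ Suc n"
    proof -
      have "d < p ^ n + p ^ n * y" using c by (auto simp: d_def roots_def)
      also have "\<dots> = p ^ n * (y + 1)" by (simp add: algebra_simps)
      also have "\<dots> \<le> p ^ n * p" using y p0 by (intro mult_left_mono) auto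
      finally show ?thesis by (simp add: mult.commute)
    qed
    moreover have "\<not> p dvd d"
    proof
      assume "p dvd d"
      moreover have "p dvd p ^ n * y" using assms(2) by (simp add: dvd_power)
      ultimately have "p dvd d - p ^ n * y" by (rule dvd_diff)
      then show False using c by (simp add: d_def roots_def)
    qed
    moreover have "p ^ Suc n dvd a * d\<^sup>2 + s"
    proof -
      have "a * d\<^sup>2 + s = p ^ n * (2 * a * c * y + e) + p ^ n * p ^ n * (a * y\<^sup>2)"
        using e by (simp add: d_def power2_eq_square algebra_simps)
      moreover have "p ^ Suc n dvd p ^ n * (2 * a * c * y + e)"
        using ye by (simp add: mult.commute mult_dvd_mono)
      moreover have "p ^ Suc n dvd p ^ n * p ^ n * (a * y\<^sup>2)"
      proof -
        have "p ^ Suc n dvd p ^ (n + n)" using assms(2) by (intro le_imp_power_dvd) simp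
        then show ?thesis by (simp add: power_add)
      qed
      ultimately show ?thesis by (metis dvd_add)
    qed
    ultimately have "d \<in> roots (Suc n) a s" by (auto simp: roots_def)
    then show "c \<in> (\<lambda>c. c mod p ^ n) ` roots (Suc n) a s" using d_mod by force
  qed
qed

lemma card_roots: "n > 0 \<Longrightarrow> \<not> p dvd a \<Longrightarrow> card (roots n a s) = card (roots 1 a s)"
proof (induction n rule: nat_induct_non_zero[consumes 1, case_names 1 Suc])
  case (Suc n)
  then show ?case using card_roots_Suc[of a n s] by simp
qed simp


section \<open>Legendre symbols and conics modulo p\<close>

lemma p_dvd_cong_diff: "p dvd x - y \<Longrightarrow> p dvd x \<longleftrightarrow> p dvd y"
  by (metis diff_add_cancel dvd_add_right_iff)

lemma Legendre_cong: "p dvd x - y \<Longrightarrow> Legendre x p = Legendre y p"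
proof -
  assume "p dvd x - y"
  then have "[x = y] (mod p)" by (simp add: cong_iff_dvd_diff)
  then have "[z = x] (mod p) \<longleftrightarrow> [z = y] (mod p)" "[x = z] (mod p) \<longleftrightarrow> [y = z] (mod p)" for z
    by (simp_all add: cong_def)
  then show ?thesis by (simp add: Legendre_def QuadRes_def)
qed

lemma Legendre_cases: "Legendre x p \<in> {-1, 0, 1}"
  by (auto simp: Legendre_def)

text \<open>The two values differ by at most 2 < p. This upgrades the congruence of Euler's
  criterion to an equality and so yields multiplicativity of the Legendre symbol.\<close>

lemma cong_small_imp_eq:
  assumes "p dvd x - y" "x \<in> {-1, 0, 1}" "y \<in> {-1, 0, 1}"
  shows "x = y"
proof (rule ccontr)
  assume "x \<noteq> y"
  then have "p \<le> \<bar>x - y\<bar>"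
    using assms(1) by (intro zdvd_imp_le) auto
  then show False using assms p by auto
qed

lemma Legendre_mult: "Legendre (x * y) p = Legendre x p * Legendre y p"
proof -
  have euler: "[Legendre z p = z ^ ((nat p - 1) div 2)] (mod p)" for z
  proof -
    have "prime (nat p)" "2 < nat p" using p(2) iffD1[OF prime_int_nat_transfer p(1)] by auto
    from euler_criterion[OF this, of z] show ?thesis using p by simp
  qed
  have "[Legendre (x * y) p = Legendre x p * Legendre y p] (mod p)"
    using cong_trans[OF euler[of "x * y", unfolded power_mult_distrib]
        cong_sym[OF cong_mult[OF euler[of x] euler[of y]]]] .
  then show ?thesis
    using cong_small_imp_eq[of "Legendre (x * y) p" "Legendre x p * Legendre y p"]
      Legendre_cases[of x] Legendre_cases[of y] Legendre_cases[of "x * y"]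
    by (auto simp: cong_iff_dvd_diff)
qed

lemma Legendre_square: "\<not> p dvd x \<Longrightarrow> Legendre (x\<^sup>2) p = 1"
proof -
  assume x: "\<not> p dvd x"
  then have "\<not> p dvd x\<^sup>2" using p(1) prime_dvd_power by blast
  moreover have "QuadRes p (x\<^sup>2)" unfolding QuadRes_def using cong_refl by blast
  ultimately show ?thesis by (simp add: Legendre_def cong_0_iff)
qed

lemma Legendre_square_mult: "\<not> p dvd x \<Longrightarrow> Legendre (x\<^sup>2 * y) p = Legendre y p"
  by (simp add: Legendre_mult Legendre_square)

lemma card_square_roots:
  "int (card {c \<in> {0..<p}. p dvd c\<^sup>2 - t}) = 1 + Legendre t p"
proof -
  let ?R = "{c \<in> {0..<p}. p dvd c\<^sup>2 - t}"
  have p0: "p > 0" using p by simp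
  consider "p dvd t" | "\<not> p dvd t" "QuadRes p t" | "\<not> p dvd t" "\<not> QuadRes p t" by blast
  then show ?thesis
  proof cases
    case 1
    then have "p dvd c\<^sup>2 - t \<longleftrightarrow> p dvd c" for c
      using p_dvd_cong_diff[of "c\<^sup>2 - t" "c\<^sup>2"] p(1) by (simp add: prime_dvd_power_iff)
    then have "?R = {0}" using p0 by (auto dest: zdvd_imp_le simp: order_le_less)
    then show ?thesis using 1 by (simp add: Legendre_def cong_0_iff)
  next
    case 2
    then obtain y where "[y\<^sup>2 = t] (mod p)" by (auto simp: QuadRes_def)
    then have y: "p dvd y\<^sup>2 - t" by (simp add: cong_iff_dvd_diff)
    have ny: "\<not> p dvd y"
    proof
      assume "p dvd y"
      then have "p dvd y\<^sup>2" by (simp add: power2_eq_square)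
      then show False using p_dvd_cong_diff[OF y] 2 by blast
    qed
    have "?R = {y mod p, (- y) mod p}"
    proof (intro equalityI subsetI)
      fix c assume c: "c \<in> ?R"
      then have "p dvd (c\<^sup>2 - t) - (y\<^sup>2 - t)" using dvd_diff[OF _ y, of "c\<^sup>2 - t"] by auto
      also have "(c\<^sup>2 - t) - (y\<^sup>2 - t) = (c - y) * (c - (- y))" by (simp add: power2_eq_square algebra_simps)
      finally have "p dvd c - y \<or> p dvd c - (- y)" using p(1) by (simp only: prime_dvd_mult_iff)
      then have "c mod p = y mod p \<or> c mod p = (- y) mod p" by (simp only: mod_eq_dvd_iff)
      then show "c \<in> {y mod p, (- y) mod p}" using c by auto
    next
      fix c assume "c \<in> {y mod p, (- y) mod p}"
      moreover have "p dvd (z mod p)\<^sup>2 - t" if "z = y \<or> z = - y" for z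
      proof -
        have "[(z mod p)\<^sup>2 = z\<^sup>2] (mod p)" by (intro cong_pow) simp
        moreover have "[z\<^sup>2 = t] (mod p)" using that y by (auto simp: cong_iff_dvd_diff)
        ultimately have "[(z mod p)\<^sup>2 = t] (mod p)" by (rule cong_trans)
        then show ?thesis by (simp add: cong_iff_dvd_diff)
      qed
      ultimately show "c \<in> ?R" using p0 by auto
    qed
    moreover have "y mod p \<noteq> (- y) mod p"
    proof
      assume "y mod p = (- y) mod p"
      then have "p dvd y - (- y)" by (simp only: mod_eq_dvd_iff)
      then have "p dvd 2 * y" by simp
      then show False using ny not_p_dvd_2 p(1) by (auto simp only: prime_dvd_mult_iff)
    qed
    ultimately have "card ?R = 2" by simp
    then show ?thesis using 2 by (simp add: Legendre_def cong_0_iff)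
  next
    case 3
    then have "?R = {}" by (auto simp: QuadRes_def cong_iff_dvd_diff)
    then show ?thesis using 3 by (simp only: Legendre_def cong_0_iff) simp
  qed
qed

text \<open>The equation factors as (z - y)(z + y) = C with C a unit, so the points are parametrised
  by the unit u = z - y.\<close>

lemma card_square_hyperbola:
  assumes "\<not> p dvd C"
  shows "card (SIGMA y:{0..<p}. {z \<in> {0..<p}. p dvd z\<^sup>2 - (y\<^sup>2 + C)}) = nat (p - 1)"
proof -
  let ?H = "SIGMA y:{0..<p}. {z \<in> {0..<p}. p dvd z\<^sup>2 - (y\<^sup>2 + C)}"
  define g where "g = (\<lambda>(y, z). (z - y) mod p)"
  have p0: "p > 0" using p by simp
  obtain h where h: "p dvd 2 * h - 1" using unit_inverse_mod[OF not_p_dvd_2, of 1] by auto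
  have cancel2: "p dvd x" if "p dvd 2 * x" for x
    using that not_p_dvd_2 p(1) by (auto simp only: prime_dvd_mult_iff)
  have "inj_on g ?H"
  proof (rule inj_onI, clarify)
    fix y z y' z' assume *: "y \<in> {0..<p}" "z \<in> {0..<p}" "p dvd z\<^sup>2 - (y\<^sup>2 + C)"
      "y' \<in> {0..<p}" "z' \<in> {0..<p}" "p dvd z'\<^sup>2 - (y'\<^sup>2 + C)" "g (y, z) = g (y', z')"
    have d: "p dvd (z - y) - (z' - y')" using *(7) by (simp add: g_def mod_eq_dvd_iff)
    have nu: "\<not> p dvd z - y"
    proof
      assume "p dvd z - y"
      then have "p dvd C"
        by (rule dvd_linear2[OF _ *(3), of _ _ "z + y" "-1"]) (simp add: power2_eq_square algebra_simps)
      then show False using assms by simp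
    qed
    have "p dvd (z - y) * ((z + y) - (z' + y'))"
      by (rule dvd_linear3[OF *(3,6) d, of _ 1 "-1" "- (z' + y')"]) (simp add: power2_eq_square algebra_simps)
    then have e: "p dvd (z + y) - (z' + y')" using nu p(1) by (simp add: prime_dvd_mult_iff)
    have "p dvd 2 * (z - z')" using dvd_add[OF d e] by (simp add: algebra_simps)
    moreover have "p dvd 2 * (y - y')" using dvd_diff[OF e d] by (simp add: algebra_simps)
    ultimately show "y = y' \<and> z = z'"
      using * residue_eqI[OF _ _ _ _ cancel2[of "z - z'"]] residue_eqI[OF _ _ _ _ cancel2[of "y - y'"]]
      by simp
  qed
  moreover have "g ` ?H = {1..<p}"
  proof (intro equalityI subsetI)
    fix u assume "u \<in> g ` ?H"
    then obtain y z where *: "p dvd z\<^sup>2 - (y\<^sup>2 + C)" "u = (z - y) mod p" by (auto simp: g_def)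
    have "\<not> p dvd z - y"
    proof
      assume "p dvd z - y"
      then have "p dvd C"
        by (rule dvd_linear2[OF _ *(1), of _ _ "z + y" "-1"]) (simp add: power2_eq_square algebra_simps)
      then show False using assms by simp
    qed
    then have "u \<noteq> 0" using *(2) by (simp add: dvd_eq_mod_eq_0)
    then show "u \<in> {1..<p}" using *(2) p0 pos_mod_sign[of p "z - y"] by (auto simp: order_le_less)
  next
    fix u assume u: "u \<in> {1..<p}"
    then have nu: "\<not> p dvd u" by (auto dest: zdvd_imp_le)
    obtain w where w: "p dvd u * w - 1" using unit_inverse_mod[OF nu, of 1] by auto
    \<comment> \<open>The solution of z - y = u and z + y = C/u, with \<open>h\<close> inverting 2
      and \<open>w\<close> inverting \<open>u\<close> modulo p.\<close>
    define z y where "z = (h * (w * C + u)) mod p" and "y = (h * (w * C - u)) mod p"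
    have z: "p dvd h * (w * C + u) - z" and y: "p dvd h * (w * C - u) - y"
      by (auto simp: z_def y_def dvd_minus_mod)
    have d1: "p dvd (z - y) - u"
    proof -
      show ?thesis
        by (rule dvd_linear3[OF z y h, of _ "-1" 1 u]) (simp add: algebra_simps)
    qed
    have d2: "p dvd (z + y) - w * C"
    proof -
      show ?thesis
        by (rule dvd_linear3[OF z y h, of _ "-1" "-1" "w * C"]) (simp add: algebra_simps)
    qed
    have "p dvd z\<^sup>2 - (y\<^sup>2 + C)"
      by (rule dvd_linear3[OF d1 d2 w, of _ "z + y" u C]) (simp add: power2_eq_square algebra_simps)
    then have "(y, z) \<in> ?H" using p0 by (auto simp: z_def y_def)
    moreover have "g (y, z) = u"
      using d1 u by (simp add: g_def flip: mod_eq_dvd_iff)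
    ultimately show "u \<in> g ` ?H" by force
  qed
  ultimately have "card ?H = card {1..<p}" using card_image by fastforce
  then show ?thesis by simp
qed

text \<open>Double count of the hyperbola: fibring over y gives p plus the character sum, while the
  parametrisation gives p - 1.\<close>

lemma sum_Legendre_quadratic_monic:
  assumes "\<not> p dvd C"
  shows "(\<Sum>y\<in>{0..<p}. Legendre (y\<^sup>2 + C) p) = -1"
proof -
  have "int (card (SIGMA y:{0..<p}. {z \<in> {0..<p}. p dvd z\<^sup>2 - (y\<^sup>2 + C)}))
      = (\<Sum>y\<in>{0..<p}. 1 + Legendre (y\<^sup>2 + C) p)"
    unfolding card_square_roots[symmetric] by (subst card_SigmaI) (auto intro: finite_subset[of _ "{0..<p}"])
  also have "\<dots> = p + (\<Sum>y\<in>{0..<p}. Legendre (y\<^sup>2 + C) p)"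
    using p by (simp add: sum.distrib)
  finally show ?thesis using card_square_hyperbola[OF assms] p by simp
qed

text \<open>Factoring out A reduces to the monic case, with constant term B/A, by
  multiplicativity.\<close>

lemma sum_Legendre_quadratic:
  assumes "\<not> p dvd A" "\<not> p dvd B"
  shows "(\<Sum>y\<in>{0..<p}. Legendre (A * y\<^sup>2 + B) p) = - Legendre A p"
proof -
  obtain a where a: "p dvd A * a - 1" "\<not> p dvd a" using unit_inverse_mod[OF assms(1), of 1] by auto
  have "Legendre (A * y\<^sup>2 + B) p = Legendre A p * Legendre (y\<^sup>2 + a * B) p" for y
  proof -
    have "p dvd (A * y\<^sup>2 + B) - A * (y\<^sup>2 + a * B)"
      by (rule dvd_linear2[OF a(1) a(1), of _ "- B" 0]) (simp add: algebra_simps)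
    from Legendre_cong[OF this] show ?thesis by (simp only: Legendre_mult)
  qed
  moreover have "\<not> p dvd a * B" using a assms p(1) by (simp add: prime_dvd_mult_iff)
  ultimately show ?thesis
    by (simp add: sum_Legendre_quadratic_monic flip: sum_distrib_left)
qed

text \<open>The subtracted indicator accounts for the non-unit root c = 0, which occurs exactly when
  p | s. Otherwise every root is a unit square root of -s/a, and multiplying by a^2 turns -s/a into
  -as without changing the Legendre symbol.\<close>

lemma card_roots_1:
  assumes "\<not> p dvd a"
  shows "int (card (roots 1 a s)) = 1 + Legendre (- a * s) p - (if p dvd s then 1 else 0)"
proof -
  have dvd_iff: "p dvd a * c\<^sup>2 + s \<longleftrightarrow> p dvd (a * c)\<^sup>2 - (- a * s)" for c
  proof -
    have "(a * c)\<^sup>2 - (- a * s) = a * (a * c\<^sup>2 + s)" by (simp add: power2_eq_square algebra_simps)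
    then show ?thesis using assms p(1) by (simp only: prime_dvd_mult_iff) simp
  qed
  show ?thesis
  proof (cases "p dvd s")
    case True
    then have "p dvd a * c\<^sup>2 + s \<longleftrightarrow> p dvd c" for c
      using assms p(1) by (simp only: dvd_add_left_iff prime_dvd_mult_iff prime_dvd_power_iff) simp
    then have "roots 1 a s = {}" by (auto simp: roots_def)
    moreover have "Legendre (- a * s) p = 0" using True by (simp add: Legendre_def cong_0_iff)
    ultimately show ?thesis using True by simp
  next
    case False
    obtain b where b: "p dvd a * b - 1" "\<not> p dvd b" using unit_inverse_mod[OF assms, of 1] by auto
    have unit: "\<not> p dvd c" if "p dvd a * c\<^sup>2 + s" for c
    proof
      assume "p dvd c"
      then have "p dvd s" by (rule dvd_linear2[OF that, of _ _ 1 "- a * c"]) (simp add: power2_eq_square)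
      then show False using False by simp
    qed
    have "roots 1 a s = {c\<in>{0..<p}. p dvd c\<^sup>2 - (- b * s)}"
    proof -
      have "p dvd a * c\<^sup>2 + s \<longleftrightarrow> p dvd c\<^sup>2 - (- b * s)" for c
      proof -
        have "p dvd (a * c\<^sup>2 + s) - a * (c\<^sup>2 - (- b * s))"
          by (rule dvd_linear2[OF b(1) b(1), of _ "- s" 0]) (simp add: algebra_simps)
        then have "p dvd a * c\<^sup>2 + s \<longleftrightarrow> p dvd a * (c\<^sup>2 - (- b * s))"
          by (rule p_dvd_cong_diff)
        then show ?thesis using assms p(1) by (simp only: prime_dvd_mult_iff) simp
      qed
      with unit show ?thesis unfolding roots_def power_one_right by blast
    qed
    then have "int (card (roots 1 a s)) = 1 + Legendre (- b * s) p"
      using card_square_roots[of "- b * s"] by (simp only:)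
    also have "Legendre (- b * s) p = Legendre (a\<^sup>2 * (- b * s)) p"
      by (rule Legendre_square_mult[OF assms, symmetric])
    also have "\<dots> = Legendre (- a * s) p"
    proof (rule Legendre_cong)
      show "p dvd a\<^sup>2 * (- b * s) - - a * s"
        by (rule dvd_linear2[OF b(1) b(1), of _ "- (a * s)" 0]) (simp add: power2_eq_square algebra_simps)
    qed
    finally show ?thesis using False by simp
  qed
qed

lemma card_roots_le:
  assumes "\<not> p dvd a" "n > 0"
  shows "card (roots n a s) \<le> 2"
proof -
  have "int (card (roots n a s)) \<le> 2"
    unfolding card_roots[OF assms(2,1)] card_roots_1[OF assms(1)]
    using Legendre_cases[of "- a * s"] by auto
  then show ?thesis by simp
qed

lemma sum_periodic:
  fixes f :: "int \<Rightarrow> int"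
  assumes "\<And>x y. p dvd x - y \<Longrightarrow> f x = f y"
  shows "(\<Sum>x\<in>{0..<p ^ Suc k}. f x) = p ^ k * (\<Sum>x\<in>{0..<p}. f x)"
proof -
  have p0: "p > 0" using p by simp
  have "(\<Sum>x\<in>{0..<p ^ Suc k}. f x) = (\<Sum>(x, t)\<in>{0..<p} \<times> {0..<p ^ k}. f x)"
  proof (rule sum.reindex_bij_witness[of _ "\<lambda>(x, t). x + p * t" "\<lambda>x. (x mod p, x div p)"])
    fix x assume x: "x \<in> {0..<p ^ Suc k}"
    show "(case (x mod p, x div p) of (x, t) \<Rightarrow> x + p * t) = x" by simp
    have "p * (x div p) < p * p ^ k"
      using x mult_div_mod_eq[of p x] pos_mod_sign[OF p0, of x] by (simp only: atLeastLessThan_iff power_Suc) linarith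
    then have "x div p < p ^ k" using p0 by (simp only: mult_less_cancel_left_pos)
    then show "(x mod p, x div p) \<in> {0..<p} \<times> {0..<p ^ k}"
      using x p0 by (auto simp: pos_imp_zdiv_nonneg_iff)
    show "(case (x mod p, x div p) of (x, t) \<Rightarrow> f x) = f x"
      by (simp, rule assms) (metis dvd_minus_mod dvd_diff_commute)
  next
    fix z assume "z \<in> {0..<p} \<times> {0..<p ^ k}"
    then obtain x t where z: "z = (x, t)" "0 \<le> x" "x < p" "0 \<le> t" "t < p ^ k" by auto
    show "(case case z of (x, t) \<Rightarrow> x + p * t of x \<Rightarrow> (x mod p, x div p)) = z"
      using z by simp
    have "x + p * t < p * (t + 1)" using z by (simp add: algebra_simps)
    also have "\<dots> \<le> p * p ^ k" using z p0 by (intro mult_left_mono) auto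
    finally show "(case z of (x, t) \<Rightarrow> x + p * t) \<in> {0..<p ^ Suc k}"
      using z p0 by auto
  qed
  also have "\<dots> = (\<Sum>x\<in>{0..<p}. \<Sum>t\<in>{0..<p ^ k}. f x)"
    by (simp only: sum.cartesian_product)
  also have "\<dots> = p ^ k * (\<Sum>x\<in>{0..<p}. f x)"
    using p0 by (simp add: sum_distrib_left)
  finally show ?thesis .
qed

end

section \<open>Counting the solutions\<close>

lemma gcd_prime_power_le_sum:
  assumes "prime (p::int)" "g > 0"
  shows "real_of_int (gcd g (p ^ m)) \<le> (\<Sum>j\<le>m. if p ^ j dvd g then real_of_int (p ^ j) else 0)"
proof -
  have p0: "p > 0" using assms(1) by (simp add: prime_gt_0_int)
  have "gcd g (p ^ m) dvd p ^ m" by simp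
  then obtain j where j: "j \<le> m" "normalize (gcd g (p ^ m)) = p ^ j"
    by (rule divides_primepow[OF assms(1)])
  from j(2) have eq: "gcd g (p ^ m) = p ^ j" by (simp only: normalize_gcd)
  then have "p ^ j dvd g" by (metis gcd_dvd1)
  then have "real_of_int (p ^ j) = (if p ^ j dvd g then real_of_int (p ^ j) else 0)" by simp
  also have "\<dots> \<le> (\<Sum>j\<le>m. if p ^ j dvd g then real_of_int (p ^ j) else 0)"
    using j(1) p0 by (intro member_le_sum[of j "{..m}" "\<lambda>j. if p ^ j dvd g then real_of_int (p ^ j) else 0"]) auto
  finally show ?thesis using eq by simp
qed

text \<open>Expanding the gcd over the powers p^j dividing g and writing g = p^j h cancels p^j
  against the denominator, so each of the m + 1 exponents contributes at most one harmonic sum. Thus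
  the gcd in the bound for a single exponential sum costs only a factor of order n on
  average.\<close>

lemma sum_gcd_prime_power_div_le:
  assumes p: "prime (p::int)"
  shows "(\<Sum>g\<in>{1..L}. real_of_int (gcd g (p ^ m)) / real_of_int g)
    \<le> (real m + 1) * (\<Sum>h\<in>{1..L}. 1 / real_of_int h)"
proof -
  have p0: "p > 0" using p by (simp add: prime_gt_0_int)
  have "(\<Sum>g\<in>{1..L}. real_of_int (gcd g (p ^ m)) / real_of_int g)
      \<le> (\<Sum>g\<in>{1..L}. \<Sum>j\<le>m. if p ^ j dvd g then 1 / real_of_int (g div p ^ j) else 0)"
  proof (rule sum_mono)
    fix g assume g: "g \<in> {1..L}"
    have "real_of_int (gcd g (p ^ m)) / real_of_int g
        \<le> (\<Sum>j\<le>m. if p ^ j dvd g then real_of_int (p ^ j) else 0) / real_of_int g"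
      using g gcd_prime_power_le_sum[OF p, of g m] by (intro divide_right_mono) auto
    also have "\<dots> = (\<Sum>j\<le>m. if p ^ j dvd g then 1 / real_of_int (g div p ^ j) else 0)"
      unfolding sum_divide_distrib using g p0 by (intro sum.cong) (auto simp: real_of_int_div)
    finally show "real_of_int (gcd g (p ^ m)) / real_of_int g
        \<le> (\<Sum>j\<le>m. if p ^ j dvd g then 1 / real_of_int (g div p ^ j) else 0)" .
  qed
  also have "\<dots> = (\<Sum>j\<le>m. \<Sum>g\<in>{g\<in>{1..L}. p ^ j dvd g}. 1 / real_of_int (g div p ^ j))"
    by (subst sum.swap) (simp only: sum.inter_filter finite_atLeastAtMost_int)
  also have "\<dots> \<le> (\<Sum>j\<le>m. \<Sum>h\<in>{1..L}. 1 / real_of_int h)"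
  proof (rule sum_mono)
    fix j
    have inj: "inj_on (\<lambda>g. g div p ^ j) {g\<in>{1..L}. p ^ j dvd g}"
      using p0 by (auto intro!: inj_onI dest!: dvd_div_eq_iff[THEN iffD1, rotated -1])
    have img: "(\<lambda>g. g div p ^ j) ` {g\<in>{1..L}. p ^ j dvd g} \<subseteq> {1..L}"
    proof clarify
      fix g assume g: "g \<in> {1..L}" "p ^ j dvd g"
      then obtain h where h: "g = p ^ j * h" by (auto simp: dvd_def)
      have pj: "p ^ j \<ge> 1" using p0 by simp
      have "h \<ge> 1" using g(1) pj h by (smt (verit) atLeastAtMost_iff mult_nonneg_nonpos)
      moreover have "1 * h \<le> p ^ j * h" using pj calculation by (intro mult_right_mono) auto
      then have "h \<le> L" using g(1) unfolding h atLeastAtMost_iff by linarith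
      ultimately show "g div p ^ j \<in> {1..L}" using h p0 by simp
    qed
    have "(\<Sum>g\<in>{g\<in>{1..L}. p ^ j dvd g}. 1 / real_of_int (g div p ^ j))
       = (\<Sum>h\<in>(\<lambda>g. g div p ^ j) ` {g\<in>{1..L}. p ^ j dvd g}. 1 / real_of_int h)"
      by (simp only: sum.reindex[OF inj] o_def)
    also have "\<dots> \<le> (\<Sum>h\<in>{1..L}. 1 / real_of_int h)"
      using img by (intro sum_mono2) auto
    finally show "(\<Sum>g\<in>{g\<in>{1..L}. p ^ j dvd g}. 1 / real_of_int (g div p ^ j))
      \<le> (\<Sum>h\<in>{1..L}. 1 / real_of_int h)" .
  qed
  finally show ?thesis by (simp add: add.commute)
qed

section \<open>The number of solutions modulo p^n\<close>

locale ternary_form = odd_prime +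
  fixes a1 a2 a3 :: int
  assumes units: "\<not> p dvd a1" "\<not> p dvd a2" "\<not> p dvd a3"
begin

definition quad_form :: "int \<Rightarrow> int \<Rightarrow> int \<Rightarrow> int" where
  "quad_form x1 x2 x3 = a1 * x1\<^sup>2 + a2 * x2\<^sup>2 + a3 * x3\<^sup>2"

definition sols :: "nat \<Rightarrow> (int \<times> int \<times> int) set" where
  "sols n = {(x1, x2, x3). x1 \<in> {0..<p ^ n} \<and> x2 \<in> {0..<p ^ n} \<and> x3 \<in> {0..<p ^ n} \<and>
     \<not> p dvd x1 \<and> \<not> p dvd x2 \<and> \<not> p dvd x3 \<and> p ^ n dvd quad_form x1 x2 x3}"

lemma p_pos: "p > 0"
  using p by simp

lemma finite_sols [simp]: "finite (sols n)"
  by (rule finite_subset[of _ "{0..<p ^ n} \<times> {0..<p ^ n} \<times> {0..<p ^ n}"]) (auto simp: sols_def)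

lemma sols_eq_Sigma:
  "sols n = (\<lambda>((x1, x2), x3). (x1, x2, x3)) `
     (SIGMA x:{x1\<in>{0..<p ^ n}. \<not> p dvd x1} \<times> {x2\<in>{0..<p ^ n}. \<not> p dvd x2}.
        roots n a3 (a1 * (fst x)\<^sup>2 + a2 * (snd x)\<^sup>2))"
  (is "_ = ?g ` ?S")
proof (intro equalityI subsetI)
  fix x assume x: "x \<in> sols n"
  obtain x1 x2 x3 where x_eq: "x = (x1, x2, x3)" by (cases x)
  have "((x1, x2), x3) \<in> ?S"
    using x unfolding x_eq by (simp add: sols_def roots_def quad_form_def add.commute)
  moreover have "x = ?g ((x1, x2), x3)" unfolding x_eq by simp
  ultimately show "x \<in> ?g ` ?S" by (rule rev_image_eqI)
next
  fix x assume "x \<in> ?g ` ?S"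
  then show "x \<in> sols n" by (auto simp: sols_def roots_def quad_form_def add.commute)
qed

lemma finite_units [simp]: "finite {x\<in>{0..<p ^ n}. \<not> p dvd x}"
  by (rule finite_subset[of _ "{0..<p ^ n}"]) auto

lemma card_sols_eq_sum:
  "card (sols n) = (\<Sum>x1\<in>{x1\<in>{0..<p ^ n}. \<not> p dvd x1}. \<Sum>x2\<in>{x2\<in>{0..<p ^ n}. \<not> p dvd x2}.
     card (roots n a3 (a1 * x1\<^sup>2 + a2 * x2\<^sup>2)))"
proof -
  have "inj_on (\<lambda>((x1, x2), x3). (x1, x2, x3)) S" for S :: "((int \<times> int) \<times> int) set"
    by (auto simp: inj_on_def)
  then show ?thesis
    unfolding sols_eq_Sigma
    by (subst card_image, blast, subst card_SigmaI)
      (auto simp only: sum.cartesian_product case_prod_unfold finite_units finite_roots finite_cartesian_product ball_simps simp_thms)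
qed

lemma card_roots_cong:
  assumes "p dvd s - t" "\<not> p dvd a"
  shows "card (roots 1 a s) = card (roots 1 a t)"
proof -
  have "p dvd - a * s - - a * t"
    by (rule dvd_linear2[OF assms(1) assms(1), of _ "- a" 0]) (simp add: algebra_simps)
  then have "int (card (roots 1 a s)) = int (card (roots 1 a t))"
    unfolding card_roots_1[OF assms(2)] using p_dvd_cong_diff[OF assms(1)] Legendre_cong by simp
  then show ?thesis by simp
qed

lemma units_p_eq: "{y\<in>{0..<p}. \<not> p dvd y} = {0..<p} - {0}"
proof -
  have "y = 0" if "y \<in> {0..<p}" "p dvd y" for y
    using residue_eqI[of y p 0] that p_pos by simp
  then show ?thesis by auto
qed

text \<open>This is where \<open>s_p\<close> originates. The root count is 1 plus a Legendre symbol
  minus an indicator. Over the p - 1 units, the symbol gives minus the symbols of -a2 a3 and -a1 a3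
  (a complete sum less its term at x2 = 0), and the indicator counts the roots of a binary form,
  giving 1 plus the symbol of -a1 a2.\<close>

lemma inner_sum_units:
  assumes "\<not> p dvd x1"
  shows "(\<Sum>x2\<in>{x2\<in>{0..<p}. \<not> p dvd x2}. int (card (roots 1 a3 (a1 * x1\<^sup>2 + a2 * x2\<^sup>2)))) = p - s_p p a1 a2 a3"
proof -
  let ?U = "{x2\<in>{0..<p}. \<not> p dvd x2}"
  have U: "?U = {0..<p} - {0}" by (rule units_p_eq)
  have cardU: "int (card ?U) = p - 1" unfolding U using p_pos by (subst card_Diff_subset) auto
  have finU: "finite ?U" unfolding U by simp
  have "(\<Sum>x2\<in>?U. Legendre (- a3 * (a1 * x1\<^sup>2 + a2 * x2\<^sup>2)) p)
      = (\<Sum>x2\<in>{0..<p}. Legendre ((- a2 * a3) * x2\<^sup>2 + - a1 * a3 * x1\<^sup>2) p) - Legendre (- a1 * a3 * x1\<^sup>2) p"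
    unfolding U using p_pos by (subst sum_diff1) (auto simp: algebra_simps)
  also have "\<dots> = - Legendre (- a2 * a3) p - Legendre (- a1 * a3) p"
  proof -
    have "\<not> p dvd - a2 * a3" "\<not> p dvd - a1 * a3 * x1\<^sup>2"
      using units assms p(1) by (auto simp: prime_dvd_mult_iff prime_dvd_power_iff)
    note sum_Legendre_quadratic[OF this]
    moreover have "Legendre (- a1 * a3 * x1\<^sup>2) p = Legendre (- a1 * a3) p"
      using Legendre_square_mult[OF assms, of "- a1 * a3"] by (simp only: mult.commute)
    ultimately show ?thesis by (simp only:)
  qed
  finally have sum_leg: "(\<Sum>x2\<in>?U. Legendre (- a3 * (a1 * x1\<^sup>2 + a2 * x2\<^sup>2)) p)
     = - Legendre (- a2 * a3) p - Legendre (- a1 * a3) p" .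
  have "(\<Sum>x2\<in>?U. if p dvd a1 * x1\<^sup>2 + a2 * x2\<^sup>2 then 1 else 0) = int (card (roots 1 a2 (a1 * x1\<^sup>2)))"
  proof -
    have "roots 1 a2 (a1 * x1\<^sup>2) = {x2\<in>?U. p dvd a1 * x1\<^sup>2 + a2 * x2\<^sup>2}"
      unfolding roots_def by (simp only: power_one_right add.commute) blast
    then have "int (card (roots 1 a2 (a1 * x1\<^sup>2))) = (\<Sum>x2\<in>{x2\<in>?U. p dvd a1 * x1\<^sup>2 + a2 * x2\<^sup>2}. 1)"
      by simp
    also have "\<dots> = (\<Sum>x2\<in>?U. if p dvd a1 * x1\<^sup>2 + a2 * x2\<^sup>2 then 1 else 0)"
      by (rule sum.inter_filter[OF finU])
    finally show ?thesis by simp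
  qed
  also have "\<dots> = 1 + Legendre (- a1 * a2) p"
  proof -
    have "\<not> p dvd a1 * x1\<^sup>2" using units assms p(1) by (auto simp: prime_dvd_mult_iff prime_dvd_power_iff)
    moreover have "Legendre (- a2 * (a1 * x1\<^sup>2)) p = Legendre (- a1 * a2) p"
      using Legendre_square_mult[OF assms, of "- a1 * a2"] by (simp only: mult_ac mult_minus_left mult_minus_right)
    ultimately show ?thesis unfolding card_roots_1[OF units(2)] by simp
  qed
  finally have sum_dvd: "(\<Sum>x2\<in>?U. if p dvd a1 * x1\<^sup>2 + a2 * x2\<^sup>2 then 1 else 0) = 1 + Legendre (- a1 * a2) p" .
  show ?thesis
    unfolding card_roots_1[OF units(3)] sum_subtractf sum.distrib sum_leg sum_dvd
    using cardU by (simp add: s_p_def)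
qed

lemma sum_units_periodic:
  fixes f :: "int \<Rightarrow> int"
  assumes "\<And>x y. p dvd x - y \<Longrightarrow> f x = f y"
  shows "(\<Sum>x\<in>{x\<in>{0..<p ^ Suc k}. \<not> p dvd x}. f x) = p ^ k * (\<Sum>x\<in>{x\<in>{0..<p}. \<not> p dvd x}. f x)"
proof -
  have "(\<Sum>x\<in>{x\<in>{0..<p ^ Suc k}. \<not> p dvd x}. f x) = (\<Sum>x\<in>{0..<p ^ Suc k}. if \<not> p dvd x then f x else 0)"
    by (rule sum.inter_filter) simp
  also have "\<dots> = p ^ k * (\<Sum>x\<in>{0..<p}. if \<not> p dvd x then f x else 0)"
    by (rule sum_periodic) (metis assms p_dvd_cong_diff)
  also have "(\<Sum>x\<in>{0..<p}. if \<not> p dvd x then f x else 0) = (\<Sum>x\<in>{x\<in>{0..<p}. \<not> p dvd x}. f x)"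
    by (rule sum.inter_filter[symmetric]) simp
  finally show ?thesis .
qed

text \<open>By lifting, the number of choices for the third coordinate depends only on the first two
  modulo p. Each of these contributes a factor p^k, which leaves the count modulo p.\<close>

lemma card_sols:
  "int (card (sols (Suc k))) = (p - s_p p a1 a2 a3) * (p - 1) * p ^ (2 * k)"
proof -
  let ?f = "\<lambda>x1 x2. int (card (roots 1 a3 (a1 * x1\<^sup>2 + a2 * x2\<^sup>2)))"
  have cong2: "?f x y = ?f x z" if "p dvd y - z" for x y z
  proof -
    have "p dvd (a1 * x\<^sup>2 + a2 * y\<^sup>2) - (a1 * x\<^sup>2 + a2 * z\<^sup>2)"
      by (rule dvd_linear2[OF that that, of _ "a2 * (y + z)" 0]) (simp add: power2_eq_square algebra_simps)
    then show ?thesis using card_roots_cong units(3) by metis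
  qed
  have cardU: "int (card {x\<in>{0..<p}. \<not> p dvd x}) = p - 1"
    unfolding units_p_eq using p_pos by (subst card_Diff_subset) auto
  have "int (card (sols (Suc k))) = (\<Sum>x1\<in>{x\<in>{0..<p ^ Suc k}. \<not> p dvd x}. \<Sum>x2\<in>{x\<in>{0..<p ^ Suc k}. \<not> p dvd x}. ?f x1 x2)"
    unfolding card_sols_eq_sum by (simp add: card_roots[of "Suc k", OF _ units(3)])
  also have "\<dots> = (\<Sum>x1\<in>{x\<in>{0..<p ^ Suc k}. \<not> p dvd x}. p ^ k * (\<Sum>x2\<in>{x\<in>{0..<p}. \<not> p dvd x}. ?f x1 x2))"
    using cong2 by (intro sum.cong refl sum_units_periodic)
  also have "\<dots> = (\<Sum>x1\<in>{x\<in>{0..<p ^ Suc k}. \<not> p dvd x}. p ^ k * (p - s_p p a1 a2 a3))"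
    using inner_sum_units by (intro sum.cong refl) simp
  also have "\<dots> = p ^ k * (\<Sum>x1\<in>{x\<in>{0..<p}. \<not> p dvd x}. p ^ k * (p - s_p p a1 a2 a3))"
    by (intro sum_units_periodic) simp
  also have "\<dots> = (p - s_p p a1 a2 a3) * (p - 1) * p ^ (2 * k)"
    using cardU by (simp add: power_add mult_2)
  finally show ?thesis .
qed

end

section \<open>Isotropic vectors of the dual form\<close>

context ternary_form
begin

text \<open>The form of the adjugate matrix, that is a1 a2 a3 times the inverse form. At (a1 x1, a2
  x2, a3 x3), half the gradient of the quadratic form, it takes the value a1 a2 a3 times the form at
  x, so it vanishes on the normals of the cone.\<close>

definition dual_form :: "int \<Rightarrow> int \<Rightarrow> int \<Rightarrow> int" where
  "dual_form k1 k2 k3 = a2 * a3 * k1\<^sup>2 + a1 * a3 * k2\<^sup>2 + a1 * a2 * k3\<^sup>2"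

text \<open>Chosen so that the dual form is at most \<open>height\<close> times the square of the
  radius on a box centred at 0.\<close>

definition height :: int where
  "height = \<bar>a2 * a3\<bar> + \<bar>a1 * a3\<bar> + \<bar>a1 * a2\<bar>"

text \<open>All coordinates are required to be units modulo p, so that ratios such as k2/k1 make
  sense modulo every power of p. Frequencies with a nonvanishing sum inherit this from the units in
  the solutions.\<close>

definition primitive_isotropic :: "int \<Rightarrow> (int \<times> int \<times> int) set" where
  "primitive_isotropic Y = {(k1, k2, k3). \<bar>k1\<bar> \<le> Y \<and> \<bar>k2\<bar> \<le> Y \<and> \<bar>k3\<bar> \<le> Y \<and>
     \<not> p dvd k1 \<and> \<not> p dvd k2 \<and> \<not> p dvd k3 \<and> gcd k1 (gcd k2 k3) = 1 \<and> dual_form k1 k2 k3 = 0}"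

lemma coeff_nonzero: "a1 \<noteq> 0" "a2 \<noteq> 0" "a3 \<noteq> 0"
  using units by auto

lemma height_ge_1: "height \<ge> 1"
proof -
  have "a2 * a3 \<noteq> 0" using coeff_nonzero by simp
  then show ?thesis unfolding height_def by linarith
qed

lemma finite_primitive_isotropic [simp]: "finite (primitive_isotropic Y)"
  by (rule finite_subset[of _ "{-Y..Y} \<times> {-Y..Y} \<times> {-Y..Y}"]) (auto simp: primitive_isotropic_def)

lemma prime_power_dvd_cancel:
  assumes "p ^ e dvd x * y" "\<not> p dvd x"
  shows "p ^ e dvd y"
proof -
  have "coprime x (p ^ e)" using assms(2) coprime_p_iff by simp
  then show ?thesis using assms(1) by (simp add: coprime_commute coprime_dvd_mult_right_iff)
qed

lemma primitive_dvd:
  fixes a b c d x :: int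
  assumes "gcd a (gcd b c) = 1" "d dvd x * a" "d dvd x * b" "d dvd x * c"
  shows "d dvd x"
proof -
  obtain r t where rt: "r * a + t * gcd b c = gcd a (gcd b c)" using bezout_int by blast
  obtain u v where uv: "u * b + v * c = gcd b c" using bezout_int by blast
  have "r * a + t * (u * b + v * c) = 1" unfolding uv rt by (rule assms(1))
  then have "x = x * (r * a + t * (u * b + v * c))" by simp
  then have "x = r * (x * a) + (t * u) * (x * b) + (t * v) * (x * c)" by (simp add: algebra_simps)
  then show ?thesis by (rule dvd_linear3[OF assms(2-4)])
qed

text \<open>If two isotropic vectors are proportional modulo a large power of \<open>p\<close>, their bilinear
  product is divisible by the square of that power, hence zero by size; a nondegenerate ternary
  form has no totally isotropic plane.\<close>

lemma isotropic_proportional: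
  assumes k: "(k1, k2, k3) \<in> primitive_isotropic Y" and l: "(l1, l2, l3) \<in> primitive_isotropic Y"
    and dvd: "p ^ e dvd l2 * k1 - l1 * k2" "p ^ e dvd l3 * k1 - l1 * k3"
    and size: "height * Y\<^sup>2 < p ^ (2 * e)"
  shows "(l1, l2, l3) = (k1, k2, k3) \<or> (l1, l2, l3) = (- k1, - k2, - k3)"
proof -
  define B where "B = a2 * a3 * k1 * l1 + a1 * a3 * k2 * l2 + a1 * a2 * k3 * l3"
  define u v where "u = l2 * k1 - l1 * k2" and "v = l3 * k1 - l1 * k3"
  have Dk: "dual_form k1 k2 k3 = 0" and Dl: "dual_form l1 l2 l3 = 0" using k l by (auto simp: primitive_isotropic_def)
  have k1: "k1 \<noteq> 0" and l1: "l1 \<noteq> 0" using k l by (auto simp: primitive_isotropic_def)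
  \<comment> \<open>\<open>B\<close> is the polar form of k and l. The vector k1 l - l1 k has
    coordinates (0, u, v), and its dual form is expanded bilinearly; for isotropic k and l only the
    polar term survives.\<close>
  have "a1 * a3 * u\<^sup>2 + a1 * a2 * v\<^sup>2
      = k1\<^sup>2 * dual_form l1 l2 l3 - (2 * k1 * l1) * B + l1\<^sup>2 * dual_form k1 k2 k3"
    by (simp add: u_def v_def B_def dual_form_def power2_eq_square algebra_simps)
  then have uv: "a1 * a3 * u\<^sup>2 + a1 * a2 * v\<^sup>2 = (- 2 * k1 * l1) * B"
    unfolding Dk Dl by simp
  have sq: "p ^ (2 * e) = p ^ e * p ^ e" by (simp add: mult_2 power_add)
  have "p ^ (2 * e) dvd u * u" "p ^ (2 * e) dvd v * v"
    unfolding sq u_def v_def by (intro mult_dvd_mono dvd)+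
  then have "p ^ (2 * e) dvd a1 * a3 * u\<^sup>2 + a1 * a2 * v\<^sup>2"
    by (rule dvd_linear2) (simp add: power2_eq_square)
  then have "p ^ (2 * e) dvd (- 2 * k1 * l1) * B" unfolding uv .
  moreover have "\<not> p dvd - 2 * k1 * l1"
    using k l p(1) not_p_dvd_2 by (auto simp: primitive_isotropic_def prime_dvd_mult_iff)
  ultimately have B_dvd: "p ^ (2 * e) dvd B" by (rule prime_power_dvd_cancel)
  have "\<bar>B\<bar> \<le> height * Y\<^sup>2"
  proof -
    have Y: "\<bar>x * y\<bar> \<le> Y\<^sup>2" if "\<bar>x\<bar> \<le> Y" "\<bar>y\<bar> \<le> Y" for x y :: int
      unfolding abs_mult power2_eq_square using that by (intro mult_mono) auto
    have "\<bar>k1 * l1\<bar> \<le> Y\<^sup>2" "\<bar>k2 * l2\<bar> \<le> Y\<^sup>2" "\<bar>k3 * l3\<bar> \<le> Y\<^sup>2"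
      using k l by (auto simp: primitive_isotropic_def intro!: Y)
    then have "\<bar>a2 * a3\<bar> * \<bar>k1 * l1\<bar> + \<bar>a1 * a3\<bar> * \<bar>k2 * l2\<bar> + \<bar>a1 * a2\<bar> * \<bar>k3 * l3\<bar>
       \<le> \<bar>a2 * a3\<bar> * Y\<^sup>2 + \<bar>a1 * a3\<bar> * Y\<^sup>2 + \<bar>a1 * a2\<bar> * Y\<^sup>2"
      by (intro add_mono mult_left_mono) auto
    moreover have "\<bar>B\<bar> \<le> \<bar>a2 * a3 * (k1 * l1)\<bar> + \<bar>a1 * a3 * (k2 * l2)\<bar> + \<bar>a1 * a2 * (k3 * l3)\<bar>"
      unfolding B_def by (simp add: mult.assoc)
    ultimately show ?thesis unfolding height_def abs_mult distrib_right by linarith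
  qed
  then have B0: "B = 0" using B_dvd size dvd_imp_le_int[of B "p ^ (2 * e)"] by linarith
  have e1: "a3 * u\<^sup>2 + a2 * v\<^sup>2 = 0"
  proof -
    have "a1 * (a3 * u\<^sup>2 + a2 * v\<^sup>2) = 0" using uv B0 by (simp add: algebra_simps)
    then show ?thesis using coeff_nonzero by simp
  qed
  \<comment> \<open>Orthogonality of k to the same vector (0, u, v), which is isotropic by
    \<open>e1\<close>.\<close>
  have e2: "a3 * u * k2 + a2 * v * k3 = 0"
  proof -
    have "a1 * (a3 * u * k2 + a2 * v * k3) = k1 * B - l1 * dual_form k1 k2 k3"
      by (simp add: u_def v_def B_def dual_form_def power2_eq_square algebra_simps)
    then show ?thesis using B0 Dk coeff_nonzero by simp
  qed
  \<comment> \<open>Otherwise \<open>e1\<close> and \<open>e2\<close> make (k2, k3) proportional to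
    (u, v), hence isotropic for the binary part. Isotropy of k then forces k1 = 0.\<close>
  have u0: "u = 0"
  proof (rule ccontr)
    assume u: "u \<noteq> 0"
    have "a3 * u * (u * k3 - v * k2) = k3 * (a3 * u\<^sup>2 + a2 * v\<^sup>2) - v * (a3 * u * k2 + a2 * v * k3)"
      by (simp add: power2_eq_square algebra_simps)
    then have "a3 * u * (u * k3 - v * k2) = 0" unfolding e1 e2 by simp
    then have uk: "u * k3 = v * k2" using u coeff_nonzero by simp
    have "u\<^sup>2 * (a3 * k2\<^sup>2 + a2 * k3\<^sup>2) = a3 * u\<^sup>2 * k2\<^sup>2 + a2 * (u * k3)\<^sup>2"
      by (simp add: power2_eq_square algebra_simps)
    also have "\<dots> = k2\<^sup>2 * (a3 * u\<^sup>2 + a2 * v\<^sup>2)"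
      unfolding uk by (simp add: power2_eq_square algebra_simps)
    finally have "u\<^sup>2 * (a3 * k2\<^sup>2 + a2 * k3\<^sup>2) = 0" unfolding e1 by simp
    then have k23: "a3 * k2\<^sup>2 + a2 * k3\<^sup>2 = 0" using u by simp
    have "dual_form k1 k2 k3 = a2 * a3 * k1\<^sup>2 + a1 * (a3 * k2\<^sup>2 + a2 * k3\<^sup>2)"
      by (simp add: dual_form_def algebra_simps)
    then have "a2 * a3 * k1\<^sup>2 = 0" unfolding Dk k23 by simp
    then show False using k1 coeff_nonzero by simp
  qed
  then have v0: "v = 0" using e1 coeff_nonzero by simp
  have r2: "l2 * k1 = l1 * k2" and r3: "l3 * k1 = l1 * k3" using u0 v0 by (simp_all add: u_def v_def)
  \<comment> \<open>The vectors are now proportional over the rationals; since both are primitive,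
    their first coordinates divide each other.\<close>
  have "k1 dvd l1"
  proof (rule primitive_dvd[of k1 k2 k3])
    show "k1 dvd l1 * k2" "k1 dvd l1 * k3" by (simp_all flip: r2 r3)
  qed (use k in \<open>auto simp: primitive_isotropic_def\<close>)
  moreover have "l1 dvd k1"
  proof (rule primitive_dvd[of l1 l2 l3])
    show "l1 dvd k1 * l2" "l1 dvd k1 * l3" by (simp_all add: mult.commute[of k1] r2 r3)
  qed (use l in \<open>auto simp: primitive_isotropic_def\<close>)
  ultimately have "\<bar>l1\<bar> = \<bar>k1\<bar>" by (intro zdvd_antisym_abs)
  then consider "l1 = k1" | "l1 = - k1" by linarith
  then show ?thesis
  proof cases
    case 1
    then show ?thesis using r2 r3 k1 by simp
  next
    case 2
    then have "(l2 + k2) * k1 = 0" "(l3 + k3) * k1 = 0" using r2 r3 by (simp_all add: algebra_simps)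
    then have "l2 = - k2" "l3 = - k3" using k1 by auto
    then show ?thesis using 2 by simp
  qed
qed

text \<open>Fixing k2/k1 modulo p^e fixes the square of k3/k1 by isotropy, hence k3/k1 up to sign.
  Changing the sign of k3 preserves the dual form, so both signs reduce to full
  proportionality.\<close>

lemma primitive_isotropic_fibre:
  assumes k: "(k1, k2, k3) \<in> primitive_isotropic Y" and l: "(l1, l2, l3) \<in> primitive_isotropic Y"
    and dvd: "p ^ e dvd l2 * k1 - l1 * k2"
    and size: "height * Y\<^sup>2 < p ^ (2 * e)"
  shows "(l1, l2, l3) \<in> {(k1, k2, k3), (- k1, - k2, - k3), (k1, k2, - k3), (- k1, - k2, k3)}"
proof -
  have Dk: "dual_form k1 k2 k3 = 0" and Dl: "dual_form l1 l2 l3 = 0" using k l by (auto simp: primitive_isotropic_def)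
  have "a2 * a1 * (k3 * l1 - l3 * k1) * (k3 * l1 + l3 * k1)
     = l1\<^sup>2 * dual_form k1 k2 k3 - k1\<^sup>2 * dual_form l1 l2 l3 + a1 * a3 * (l2 * k1 + l1 * k2) * (l2 * k1 - l1 * k2)"
    by (simp only: dual_form_def power2_eq_square) (simp only: algebra_simps)
  also have "p ^ e dvd \<dots>"
    unfolding Dk Dl using dvd by simp
  finally have "p ^ e dvd (a2 * a1) * (k3 * l1 - l3 * k1) * (k3 * l1 + l3 * k1)" .
  moreover have "\<not> p dvd a2 * a1" "\<not> p dvd k3 * l1"
    using units k l p(1) by (auto simp: primitive_isotropic_def prime_dvd_mult_iff)
  ultimately have "p ^ e dvd k3 * l1 - l3 * k1 \<or> p ^ e dvd k3 * l1 + l3 * k1"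
    by (rule prime_power_dvd_square_diff)
  then consider "p ^ e dvd l3 * k1 - l1 * k3" | "p ^ e dvd l3 * k1 - l1 * (- k3)"
    by (simp only: dvd_diff_commute[of _ "k3 * l1"]) (auto simp: algebra_simps)
  then show ?thesis
  proof cases
    case 1
    then show ?thesis using isotropic_proportional[OF k l dvd _ size] by auto
  next
    case 2
    have "(k1, k2, - k3) \<in> primitive_isotropic Y" using k by (auto simp: primitive_isotropic_def dual_form_def)
    from isotropic_proportional[OF this l dvd 2 size] show ?thesis by auto
  qed
qed

lemma prime_power_between:
  assumes "X \<ge> 1"
  obtains e where "p ^ e > X" "p ^ e \<le> p * X"
proof -
  have ex: "\<exists>e. p ^ e > X"
  proof
    have "2 ^ nat X \<le> p ^ nat X" using p by (intro power_mono) auto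
    moreover have "int (nat X) < 2 ^ nat X" by (metis of_nat_less_two_power)
    ultimately show "p ^ nat X > X" using assms by simp
  qed
  define e where "e = (LEAST e. p ^ e > X)"
  have e: "p ^ e > X" unfolding e_def using ex by (rule LeastI_ex)
  then obtain f where f: "e = Suc f" using assms by (cases e) auto
  have "\<not> p ^ f > X" using not_less_Least[of f "\<lambda>e. p ^ e > X"] f unfolding e_def by simp
  then have "p ^ e \<le> p * X" unfolding f using p_pos by simp
  then show ?thesis using e that by blast
qed

text \<open>The vectors are sorted by the residue \<open>b\<close> of k2/k1 modulo p^e, with p^e the
  first power above \<open>height\<close> * Y. Each residue is shared by at most four vectors, and
  p^e \<le> p * \<open>height\<close> * Y; this is the constant in the bound.\<close>

lemma card_primitive_isotropic_le:
  assumes Y: "Y \<ge> 1"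
  shows "int (card (primitive_isotropic Y)) \<le> 4 * p * height * Y"
proof -
  have "height * Y \<ge> 1 * 1" using height_ge_1 Y by (intro mult_mono) auto
  then obtain e where e: "p ^ e > height * Y" "p ^ e \<le> p * (height * Y)"
    using prime_power_between[of "height * Y"] by auto
  have size: "height * Y\<^sup>2 < p ^ (2 * e)"
  proof -
    have "1 * (height * Y\<^sup>2) \<le> height * (height * Y\<^sup>2)" using height_ge_1 by (intro mult_right_mono) auto
    also have "\<dots> = (height * Y)\<^sup>2" by (simp add: power2_eq_square algebra_simps)
    also have "\<dots> < (p ^ e)\<^sup>2" using e(1) height_ge_1 Y by (intro power_strict_mono) auto
    finally show ?thesis by (simp add: power_mult mult.commute)
  qed
  have "\<exists>b. b \<in> {0..<p ^ e} \<and> p ^ e dvd k1 * b - k2" if nd: "\<not> p dvd k1" for k1 k2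
  proof -
    obtain i where i: "p ^ e dvd k1 * i - 1" using unit_inverse_mod[OF nd, of e] by blast
    have "p ^ e dvd i * k2 - (i * k2) mod p ^ e" by (rule dvd_minus_mod)
    then have "p ^ e dvd k1 * ((i * k2) mod p ^ e) - k2"
      by (rule dvd_linear2[OF i, of _ _ k2 "- k1"]) (simp add: algebra_simps)
    then show ?thesis using p_pos by (intro exI[of _ "(i * k2) mod p ^ e"]) auto
  qed
  then obtain b where b: "\<And>k1 k2. \<not> p dvd k1 \<Longrightarrow> b k1 k2 \<in> {0..<p ^ e} \<and> p ^ e dvd k1 * b k1 k2 - k2"
    by metis
  define F where "F = (\<lambda>c. {(k1, k2, k3). (k1, k2, k3) \<in> primitive_isotropic Y \<and> b k1 k2 = c})"
  have finF: "finite (F c)" for c by (rule finite_subset[OF _ finite_primitive_isotropic[of Y]]) (auto simp: F_def)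
  have F_le: "card (F c) \<le> 4" for c
  proof (cases "F c = {}")
    case False
    then obtain k1 k2 k3 where k: "(k1, k2, k3) \<in> primitive_isotropic Y" "b k1 k2 = c" by (auto simp: F_def)
    have "F c \<subseteq> {(k1, k2, k3), (- k1, - k2, - k3), (k1, k2, - k3), (- k1, - k2, k3)}"
    proof (intro subsetI)
      fix l assume "l \<in> F c"
      then obtain l1 l2 l3 where l: "l = (l1, l2, l3)" "(l1, l2, l3) \<in> primitive_isotropic Y" "b l1 l2 = c"
        by (auto simp: F_def)
      have bk: "p ^ e dvd k1 * c - k2" using b[of k1 k2] k by (auto simp: primitive_isotropic_def)
      have bl: "p ^ e dvd l1 * c - l2" using b[of l1 l2] l by (auto simp: primitive_isotropic_def)
      have "p ^ e dvd l2 * k1 - l1 * k2"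
        by (rule dvd_linear2[OF bk bl, of _ l1 "- k1"]) (simp add: algebra_simps)
      from primitive_isotropic_fibre[OF k(1) l(2) this size]
      show "l \<in> {(k1, k2, k3), (- k1, - k2, - k3), (k1, k2, - k3), (- k1, - k2, k3)}" using l by simp
    qed
    then have "card (F c) \<le> card {(k1, k2, k3), (- k1, - k2, - k3), (k1, k2, - k3), (- k1, - k2, k3)}"
      by (intro card_mono) auto
    also have "\<dots> \<le> 4" by (simp add: card_insert_if)
    finally show ?thesis .
  qed simp
  have "primitive_isotropic Y \<subseteq> (\<Union>c\<in>{0..<p ^ e}. F c)"
    using b by (auto simp: F_def primitive_isotropic_def)
  then have "card (primitive_isotropic Y) \<le> card (\<Union>c\<in>{0..<p ^ e}. F c)"
    using finF by (intro card_mono) auto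
  also have "\<dots> \<le> (\<Sum>c\<in>{0..<p ^ e}. card (F c))" by (intro card_UN_le) simp
  also have "\<dots> \<le> (\<Sum>c\<in>{0..<p ^ e}. 4)" using F_le by (intro sum_mono)
  finally have "card (primitive_isotropic Y) \<le> 4 * nat (p ^ e)" by (simp add: mult.commute)
  then have "int (card (primitive_isotropic Y)) \<le> int (4 * nat (p ^ e))" by (simp only: of_nat_le_iff)
  also have "\<dots> = 4 * p ^ e" using p_pos by simp
  also have "\<dots> \<le> 4 * (p * (height * Y))" using e(2) by simp
  finally show ?thesis by (simp add: mult.assoc)
qed

end

section \<open>Bounds for the exponential sums\<close>

context ternary_form
begin

definition char_sum :: "nat \<Rightarrow> int \<Rightarrow> int \<Rightarrow> int \<Rightarrow> complex" where
  "char_sum n k1 k2 k3 = (\<Sum>(x1, x2, x3)\<in>sols n. ee (p ^ n) (k1 * x1 + k2 * x2 + k3 * x3))"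

text \<open>The points that survive averaging. The first two congruences come from the infinitesimal
  isometries and say that k is proportional to (a1 x1, a2 x2, a3 x3) modulo p^(n div 2); the third
  comes from the scalings.\<close>

definition resonant :: "nat \<Rightarrow> int \<Rightarrow> int \<Rightarrow> int \<Rightarrow> (int \<times> int \<times> int) set" where
  "resonant n k1 k2 k3 = {(x1, x2, x3). (x1, x2, x3) \<in> sols n \<and>
     p ^ (n div 2) dvd k1 * a2 * x2 - k2 * a1 * x1 \<and>
     p ^ (n div 2) dvd k1 * a3 * x3 - k3 * a1 * x1 \<and>
     p ^ (n - 1) dvd k1 * x1 + k2 * x2 + k3 * x3}"

lemma char_sum_0: "char_sum n 0 0 0 = of_nat (card (sols n))"
  by (simp add: char_sum_def case_prod_unfold)

lemma norm_char_sum_le_card: "norm (char_sum n k1 k2 k3) \<le> real (card (sols n))"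
proof -
  have "norm (char_sum n k1 k2 k3) \<le> (\<Sum>x\<in>sols n. 1)"
    unfolding char_sum_def by (rule sum_norm_le) (simp add: case_prod_unfold)
  then show ?thesis by simp
qed

lemma quad_form_cong:
  assumes "d dvd x1 - y1" "d dvd x2 - y2" "d dvd x3 - y3"
  shows "d dvd quad_form x1 x2 x3 - quad_form y1 y2 y3"
  by (rule dvd_linear3[OF assms, of _ "a1 * (x1 + y1)" "a2 * (x2 + y2)" "a3 * (x3 + y3)"])
     (simp add: quad_form_def power2_eq_square algebra_simps)

lemma sols_modI:
  assumes "n > 0" "\<not> p dvd y1" "\<not> p dvd y2" "\<not> p dvd y3" "p ^ n dvd quad_form y1 y2 y3"
  shows "(y1 mod p ^ n, y2 mod p ^ n, y3 mod p ^ n) \<in> sols n"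
proof -
  have pq: "p dvd p ^ n" using assms(1) by simp
  have "p dvd y - y mod p ^ n" for y using pq dvd_minus_mod dvd_trans by metis
  then have "\<not> p dvd y mod p ^ n" if "\<not> p dvd y" for y
    using p_dvd_cong_diff that by metis
  moreover have "p ^ n dvd quad_form (y1 mod p ^ n) (y2 mod p ^ n) (y3 mod p ^ n)"
  proof -
    have "p ^ n dvd quad_form y1 y2 y3 - quad_form (y1 mod p ^ n) (y2 mod p ^ n) (y3 mod p ^ n)"
      by (intro quad_form_cong dvd_minus_mod)
    from this assms(5) show ?thesis by (rule dvd_linear2[of _ _ _ _ "-1" 1]) simp
  qed
  ultimately show ?thesis using assms p_pos by (simp add: sols_def)
qed

text \<open>The linear maps \<open>x \<mapsto> x + s t E x\<close> with \<open>E\<close> in the Lie algebra of the orthogonal group of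
  the form and \<open>s\<^sup>2\<close> divisible by \<open>p ^ n\<close> preserve the solution set modulo \<open>p ^ n\<close>.\<close>

lemma sum_ee_shear:
  fixes u v :: int
  assumes n: "n > 0"
    and S: "S \<subseteq> sols n"
    and closed: "\<And>x1 x2 x3 y1 y2 y3. (x1, x2, x3) \<in> S \<Longrightarrow> (y1, y2, y3) \<in> sols n \<Longrightarrow>
      p ^ (n - n div 2) dvd y1 - x1 \<Longrightarrow> p ^ (n - n div 2) dvd y2 - x2 \<Longrightarrow>
      p ^ (n - n div 2) dvd y3 - x3 \<Longrightarrow> (y1, y2, y3) \<in> S"
  shows "(\<Sum>(x1, x2, x3)\<in>S. ee (p ^ n) (k1 * x1 + k2 * x2 + k3 * x3)) =
    (\<Sum>(x1, x2, x3)\<in>{(x1, x2, x3). (x1, x2, x3) \<in> S \<and>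
       p ^ (n div 2) dvd u * (k1 * a2 * x2 - k2 * a1 * x1) + v * (k1 * a3 * x3 - k3 * a1 * x1)}.
     ee (p ^ n) (k1 * x1 + k2 * x2 + k3 * x3))"
proof -
  \<comment> \<open>The exponent is n/2 rounded up, so q divides s^2, while the phase, which moves
    by multiples of s, still sees a congruence modulo q/s = p^(n div 2).\<close>
  define q s where "q = p ^ n" and "s = p ^ (n - n div 2)"
  have q0: "q > 0" using p_pos by (simp add: q_def)
  have q_eq: "q = s * p ^ (n div 2)" by (simp add: q_def s_def flip: power_add)
  have s_q: "s dvd q" by (simp add: q_eq)
  have q_ss: "q dvd s * s"
    unfolding q_def s_def by (simp add: le_imp_power_dvd flip: power_add)
  have p_s: "p dvd s" using n by (simp add: s_def)
  \<comment> \<open>The parameters \<open>u\<close> and \<open>v\<close> weight the infinitesimal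
    rotations in the planes of coordinates 1, 2 and 1, 3. The first-order change of the form is zero
    identically, so only a term with s^2 t^2 remains.\<close>
  define Y where "Y = (\<lambda>t::int. \<lambda>(x1, x2, x3).
    (x1 + s * t * (u * a2 * x2 + v * a3 * x3), x2 - s * t * u * a1 * x1, x3 - s * t * v * a1 * x1))"
  define R where "R = (\<lambda>(x1::int, x2::int, x3::int). (x1 mod q, x2 mod q, x3 mod q))"
  define f where "f = (\<lambda>t x. R (Y t x))"
  define \<psi> where "\<psi> = (\<lambda>(x1, x2, x3). k1 * x1 + k2 * x2 + k3 * x3)"
  define c where "c = (\<lambda>(x1, x2, x3). s * (u * (k1 * a2 * x2 - k2 * a1 * x1) + v * (k1 * a3 * x3 - k3 * a1 * x1)))"
  have maps: "f t x \<in> S" if x: "x \<in> S" for t x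
  proof -
    obtain x1 x2 x3 where x_eq: "x = (x1, x2, x3)" by (cases x)
    obtain y1 y2 y3 where y: "Y t x = (y1, y2, y3)" by (cases "Y t x")
    have sol: "(x1, x2, x3) \<in> sols n" using x S x_eq by auto
    have y_eq: "y1 - x1 = s * (t * (u * a2 * x2 + v * a3 * x3))" "y2 - x2 = s * (- t * u * a1 * x1)"
      "y3 - x3 = s * (- t * v * a1 * x1)"
      using y by (auto simp: Y_def x_eq algebra_simps)
    have s_dvd: "s dvd y1 - x1" "s dvd y2 - x2" "s dvd y3 - x3" unfolding y_eq by simp_all
    then have "p dvd y1 - x1" "p dvd y2 - x2" "p dvd y3 - x3" by (simp_all only: dvd_trans[OF p_s])
    then have nd: "\<not> p dvd y1" "\<not> p dvd y2" "\<not> p dvd y3"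
      using p_dvd_cong_diff[of y1 x1] p_dvd_cong_diff[of y2 x2] p_dvd_cong_diff[of y3 x3] sol
      unfolding sols_def by simp_all
    have "quad_form y1 y2 y3 = quad_form x1 x2 x3 + s * s * (t * t) *
        (a1 * (u * a2 * x2 + v * a3 * x3)\<^sup>2 + a2 * (u * a1 * x1)\<^sup>2 + a3 * (v * a1 * x1)\<^sup>2)"
    proof -
      have ye: "y1 = x1 + s * (t * (u * a2 * x2 + v * a3 * x3))" "y2 = x2 + s * (- t * u * a1 * x1)"
        "y3 = x3 + s * (- t * v * a1 * x1)" using y_eq by linarith+
      show ?thesis unfolding ye quad_form_def by (simp add: power2_eq_square algebra_simps)
    qed
    moreover have "q dvd quad_form x1 x2 x3" using sol by (auto simp: sols_def q_def)
    ultimately have "q dvd quad_form y1 y2 y3" using q_ss by (simp only: dvd_add dvd_mult2)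
    then have fsol: "(y1 mod q, y2 mod q, y3 mod q) \<in> sols n"
      unfolding q_def using nd n by (intro sols_modI) auto
    have md: "s dvd y mod q - x" if "s dvd y - x" for y x
    proof -
      have "s dvd y - y mod q" using s_q dvd_minus_mod dvd_trans by metis
      from this that show ?thesis by (rule dvd_linear2[of _ _ _ _ "-1" 1]) simp
    qed
    have "(y1 mod q, y2 mod q, y3 mod q) \<in> S"
      using md[OF s_dvd(1)] md[OF s_dvd(2)] md[OF s_dvd(3)] unfolding s_def
      by (rule closed[OF x[unfolded x_eq] fsol])
    then show ?thesis by (simp add: f_def R_def y)
  qed
  \<comment> \<open>Composing the maps for t and -t leaves the identity up to multiples of s^2,
    which vanish modulo q.\<close>
  have inv: "f (- t) (f t x) = x" if x: "x \<in> S" for t x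
  proof -
    obtain x1 x2 x3 where x_eq: "x = (x1, x2, x3)" by (cases x)
    obtain y1 y2 y3 where y: "Y t x = (y1, y2, y3)" by (cases "Y t x")
    obtain z1 z2 z3 where z: "Y (- t) (y1 mod q, y2 mod q, y3 mod q) = (z1, z2, z3)"
      by (cases "Y (- t) (y1 mod q, y2 mod q, y3 mod q)")
    define w1 w2 w3 where "w1 = y1 - y1 mod q" and "w2 = y2 - y2 mod q" and "w3 = y3 - y3 mod q"
    have w: "q dvd w1" "q dvd w2" "q dvd w3" unfolding w1_def w2_def w3_def by (rule dvd_minus_mod)+
    have y_eq: "y1 = x1 + s * t * (u * a2 * x2 + v * a3 * x3)" "y2 = x2 - s * t * u * a1 * x1"
      "y3 = x3 - s * t * v * a1 * x1"
      using y by (auto simp: Y_def x_eq)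
    have ym: "y1 mod q = y1 - w1" "y2 mod q = y2 - w2" "y3 mod q = y3 - w3"
      by (simp_all add: w1_def w2_def w3_def)
    have z_eq: "z1 = y1 - w1 - s * t * (u * a2 * (y2 - w2) + v * a3 * (y3 - w3))"
      "z2 = y2 - w2 + s * t * u * a1 * (y1 - w1)" "z3 = y3 - w3 + s * t * v * a1 * (y1 - w1)"
      using z unfolding ym by (auto simp: Y_def algebra_simps)
    have "q dvd z1 - x1"
    proof -
      have "z1 - x1 = s * s * (t * t * a1 * x1 * (u * u * a2 + v * v * a3)) + (- 1) * w1
          + s * t * u * a2 * w2 + s * t * v * a3 * w3"
        unfolding z_eq y_eq by (simp add: algebra_simps)
      then show ?thesis
        using dvd_add[OF dvd_add[OF dvd_add[OF dvd_mult2[OF q_ss] dvd_mult[OF w(1)]] dvd_mult[OF w(2)]] dvd_mult[OF w(3)]]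
        by (simp only:)
    qed
    moreover have "q dvd z2 - x2"
    proof -
      have "z2 - x2 = s * s * (t * t * u * a1 * (u * a2 * x2 + v * a3 * x3)) + (- 1) * w2
          + (- s * t * u * a1) * w1"
        unfolding z_eq y_eq by (simp add: algebra_simps)
      then show ?thesis
        using dvd_add[OF dvd_add[OF dvd_mult2[OF q_ss] dvd_mult[OF w(2)]] dvd_mult[OF w(1)]] by (simp only:)
    qed
    moreover have "q dvd z3 - x3"
    proof -
      have "z3 - x3 = s * s * (t * t * v * a1 * (u * a2 * x2 + v * a3 * x3)) + (- 1) * w3
          + (- s * t * v * a1) * w1"
        unfolding z_eq y_eq by (simp add: algebra_simps)
      then show ?thesis
        using dvd_add[OF dvd_add[OF dvd_mult2[OF q_ss] dvd_mult[OF w(3)]] dvd_mult[OF w(1)]] by (simp only:)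
    qed
    ultimately have "z1 mod q = x1 mod q" "z2 mod q = x2 mod q" "z3 mod q = x3 mod q"
      by (simp_all add: mod_eq_dvd_iff)
    moreover have "x1 mod q = x1" "x2 mod q = x2" "x3 mod q = x3"
      using x S unfolding x_eq by (auto simp: sols_def q_def)
    ultimately show ?thesis by (simp add: f_def R_def y[unfolded x_eq] z x_eq)
  qed
  have inj: "inj_on (f t) S" for t
    by (rule inj_on_inverseI[of _ "f (- t)"]) (rule inv)
  have phase: "[\<psi> (f t x) = \<psi> x + t * c x] (mod q)" for t x
  proof -
    obtain x1 x2 x3 where x_eq: "x = (x1, x2, x3)" by (cases x)
    obtain y1 y2 y3 where y: "Y t x = (y1, y2, y3)" by (cases "Y t x")
    have "[\<psi> (f t x) = k1 * y1 + k2 * y2 + k3 * y3] (mod q)"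
      unfolding \<psi>_def f_def R_def y by (auto intro!: cong_add cong_mult)
    also have "k1 * y1 + k2 * y2 + k3 * y3 = \<psi> x + t * c x"
      using y by (auto simp: Y_def x_eq \<psi>_def c_def algebra_simps)
    finally show ?thesis .
  qed
  have "finite S" using S finite_sols finite_subset by blast
  have "(\<Sum>x\<in>S. ee q (\<psi> x)) = (\<Sum>x\<in>{x\<in>S. q dvd c x}. ee q (\<psi> x))"
    by (rule sum_ee_average[OF \<open>finite S\<close> q0 maps inj phase])
  moreover have "{x\<in>S. q dvd c x} = {(x1, x2, x3). (x1, x2, x3) \<in> S \<and>
       p ^ (n div 2) dvd u * (k1 * a2 * x2 - k2 * a1 * x1) + v * (k1 * a3 * x3 - k3 * a1 * x1)}"
  proof -
    have "s \<noteq> 0" using p_pos by (simp add: s_def)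
    then show ?thesis unfolding c_def q_eq by auto
  qed
  ultimately show ?thesis unfolding \<psi>_def q_def by (simp add: case_prod_unfold)
qed


text \<open>Scaling by 1 + p t multiplies the form by a square and changes the phase by p t times
  itself. Every integer t must be allowed in the average, and the factor p keeps 1 + p t a unit for
  all of them; it costs one power of p, whence the exponent n - 1.\<close>

lemma sum_ee_scale:
  assumes n: "n > 0"
    and S: "S \<subseteq> sols n"
    and closed: "\<And>x1 x2 x3 y1 y2 y3 r. (x1, x2, x3) \<in> S \<Longrightarrow> (y1, y2, y3) \<in> sols n \<Longrightarrow>
      p ^ n dvd y1 - r * x1 \<Longrightarrow> p ^ n dvd y2 - r * x2 \<Longrightarrow> p ^ n dvd y3 - r * x3 \<Longrightarrow> (y1, y2, y3) \<in> S"
  shows "(\<Sum>(x1, x2, x3)\<in>S. ee (p ^ n) (k1 * x1 + k2 * x2 + k3 * x3)) =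
    (\<Sum>(x1, x2, x3)\<in>{(x1, x2, x3). (x1, x2, x3) \<in> S \<and> p ^ (n - 1) dvd k1 * x1 + k2 * x2 + k3 * x3}.
     ee (p ^ n) (k1 * x1 + k2 * x2 + k3 * x3))"
proof -
  define q where "q = p ^ n"
  have q0: "q > 0" using p_pos by (simp add: q_def)
  have q_eq: "q = p * p ^ (n - 1)" using n by (simp add: q_def power_eq_if)
  define R where "R = (\<lambda>(x1::int, x2::int, x3::int). (x1 mod q, x2 mod q, x3 mod q))"
  define f where "f = (\<lambda>t (x1, x2, x3). R ((1 + p * t) * x1, (1 + p * t) * x2, (1 + p * t) * x3))"
  define \<psi> where "\<psi> = (\<lambda>(x1, x2, x3). k1 * x1 + k2 * x2 + k3 * x3)"
  have nr: "\<not> p dvd 1 + p * t" for t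
  proof
    assume "p dvd 1 + p * t"
    from this dvd_triv_left[of p t] have "p dvd 1" by (rule dvd_linear2[of _ _ _ _ 1 "-1"]) simp
    then show False using p by simp
  qed
  have maps: "f t x \<in> S" if x: "x \<in> S" for t x
  proof -
    obtain x1 x2 x3 where x_eq: "x = (x1, x2, x3)" by (cases x)
    define r where "r = 1 + p * t"
    have r: "\<not> p dvd r" using nr by (simp add: r_def)
    have sol: "(x1, x2, x3) \<in> sols n" using x S x_eq by auto
    have "quad_form (r * x1) (r * x2) (r * x3) = r\<^sup>2 * quad_form x1 x2 x3"
      by (simp add: quad_form_def power_mult_distrib algebra_simps)
    then have "p ^ n dvd quad_form (r * x1) (r * x2) (r * x3)" using sol by (simp add: sols_def)
    then have fsol: "(r * x1 mod q, r * x2 mod q, r * x3 mod q) \<in> sols n"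
      unfolding q_def using sol r p(1) by (intro sols_modI n) (auto simp: sols_def prime_dvd_mult_iff)
    have md: "p ^ n dvd y mod q - y" for y
      unfolding q_def by (simp add: mod_eq_dvd_iff[symmetric])
    have "(r * x1 mod q, r * x2 mod q, r * x3 mod q) \<in> S"
      by (rule closed[OF x[unfolded x_eq] fsol md md md])
    then show ?thesis by (simp add: f_def R_def x_eq r_def)
  qed
  have inj: "inj_on (f t) S" for t
  proof -
    obtain i where i: "p ^ n dvd (1 + p * t) * i - 1" using unit_inverse_mod[OF nr, of n t] by blast
    have "x = y" if "0 \<le> x" "x < q" "0 \<le> y" "y < q" "(1 + p * t) * x mod q = (1 + p * t) * y mod q" for x y
    proof (rule residue_eqI[OF that(1-4)])
      have "q dvd (1 + p * t) * x - (1 + p * t) * y" using that(5) by (simp only: mod_eq_dvd_iff)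
      from this i[folded q_def] show "q dvd x - y"
        by (rule dvd_linear2[of _ _ _ _ i "- (x - y)"]) (simp add: algebra_simps)
    qed
    note inj1 = this
    show ?thesis
    proof (rule inj_onI)
      fix x y assume x: "x \<in> S" and y: "y \<in> S" and eq: "f t x = f t y"
      obtain x1 x2 x3 where x_eq: "x = (x1, x2, x3)" by (cases x)
      obtain y1 y2 y3 where y_eq: "y = (y1, y2, y3)" by (cases y)
      have "(x1, x2, x3) \<in> sols n" "(y1, y2, y3) \<in> sols n" using x y S x_eq y_eq by auto
      then show "x = y"
        using eq inj1[of x1 y1] inj1[of x2 y2] inj1[of x3 y3]
        by (simp add: x_eq y_eq f_def R_def sols_def q_def)
    qed
  qed
  have phase: "[\<psi> (f t x) = \<psi> x + t * (p * \<psi> x)] (mod q)" for t x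
  proof -
    obtain x1 x2 x3 where x_eq: "x = (x1, x2, x3)" by (cases x)
    have "[\<psi> (f t x) = k1 * ((1 + p * t) * x1) + k2 * ((1 + p * t) * x2) + k3 * ((1 + p * t) * x3)] (mod q)"
      unfolding \<psi>_def f_def R_def x_eq by (auto intro!: cong_add cong_mult)
    also have "k1 * ((1 + p * t) * x1) + k2 * ((1 + p * t) * x2) + k3 * ((1 + p * t) * x3) = \<psi> x + t * (p * \<psi> x)"
      by (simp add: x_eq \<psi>_def algebra_simps)
    finally show ?thesis .
  qed
  have "finite S" using S finite_sols finite_subset by blast
  have "(\<Sum>x\<in>S. ee q (\<psi> x)) = (\<Sum>x\<in>{x\<in>S. q dvd p * \<psi> x}. ee q (\<psi> x))"
    by (rule sum_ee_average[OF \<open>finite S\<close> q0 maps inj phase])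
  moreover have "{x\<in>S. q dvd p * \<psi> x} = {(x1, x2, x3). (x1, x2, x3) \<in> S \<and> p ^ (n - 1) dvd k1 * x1 + k2 * x2 + k3 * x3}"
    using p_pos unfolding q_eq \<psi>_def by auto
  ultimately show ?thesis unfolding \<psi>_def q_def by (simp add: case_prod_unfold)
qed

text \<open>Three averagings in succession, each over a set stable under the next action. The shear
  conditions depend on x only modulo p^(n div 2), which further shears leave fixed, and they are
  homogeneous in x, hence stable under scaling.\<close>

lemma norm_char_sum_le_card_resonant:
  assumes n: "n > 0"
  shows "norm (char_sum n k1 k2 k3) \<le> real (card (resonant n k1 k2 k3))"
proof -
  define m where "m = n div 2"
  define w2 w3 where "w2 = (\<lambda>x1 x2. k1 * a2 * x2 - k2 * a1 * x1)" and "w3 = (\<lambda>x1 x3. k1 * a3 * x3 - k3 * a1 * x1)"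
  define S1 where "S1 = {(x1, x2, x3). (x1, x2, x3) \<in> sols n \<and> p ^ m dvd w2 x1 x2}"
  define S2 where "S2 = {(x1, x2, x3). (x1, x2, x3) \<in> S1 \<and> p ^ m dvd w3 x1 x3}"
  let ?e = "\<lambda>(x1, x2, x3). ee (p ^ n) (k1 * x1 + k2 * x2 + k3 * x3)"
  have m_s: "p ^ m dvd p ^ (n - n div 2)" by (intro le_imp_power_dvd) (simp add: m_def)
  have m_n: "p ^ m dvd p ^ n" by (intro le_imp_power_dvd) (simp add: m_def)
  have w_lin: "d dvd w2 y1 y2" if "d dvd w2 x1 x2" "d dvd y1 - x1" "d dvd y2 - x2" for d x1 x2 y1 y2
    by (rule dvd_linear3[OF that, of _ 1 "- k2 * a1" "k1 * a2"]) (simp add: w2_def algebra_simps)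
  have w2_scale: "p ^ m dvd w2 y1 y2" if "p ^ m dvd w2 x1 x2" "p ^ n dvd y1 - r * x1" "p ^ n dvd y2 - r * x2" for x1 x2 y1 y2 r
    by (rule dvd_linear3[OF that(1) dvd_trans[OF m_n that(2)] dvd_trans[OF m_n that(3)], of _ r "- k2 * a1" "k1 * a2"])
      (simp add: w2_def algebra_simps)
  have w3_scale: "p ^ m dvd w3 y1 y2" if "p ^ m dvd w3 x1 x2" "p ^ n dvd y1 - r * x1" "p ^ n dvd y2 - r * x2" for x1 x2 y1 y2 r
    by (rule dvd_linear3[OF that(1) dvd_trans[OF m_n that(2)] dvd_trans[OF m_n that(3)], of _ r "- k3 * a1" "k1 * a3"])
      (simp add: w3_def algebra_simps)
  have "char_sum n k1 k2 k3 = sum ?e S1"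
    unfolding char_sum_def S1_def using sum_ee_shear[OF n, of "sols n" k1 k2 k3 1 0]
    by (simp add: w2_def m_def)
  also have "sum ?e S1 = sum ?e S2"
  proof -
    have "(y1, y2, y3) \<in> S1" if "(x1, x2, x3) \<in> S1" "(y1, y2, y3) \<in> sols n"
      "p ^ (n - n div 2) dvd y1 - x1" "p ^ (n - n div 2) dvd y2 - x2" for x1 x2 x3 y1 y2 y3
    proof -
      have "p ^ m dvd w2 x1 x2" using that(1) by (simp add: S1_def)
      then have "p ^ m dvd w2 y1 y2"
        using w_lin dvd_trans[OF m_s that(3)] dvd_trans[OF m_s that(4)] by blast
      then show ?thesis using that(2) by (simp add: S1_def)
    qed
    note closed = this
    have S1_sub: "S1 \<subseteq> sols n" by (auto simp: S1_def)
    show ?thesis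
    proof -
      have "sum ?e S1 = sum ?e {(x1, x2, x3). (x1, x2, x3) \<in> S1 \<and>
          p ^ (n div 2) dvd 0 * (k1 * a2 * x2 - k2 * a1 * x1) + 1 * (k1 * a3 * x3 - k3 * a1 * x1)}"
        by (rule sum_ee_shear[OF n S1_sub closed])
      then show ?thesis by (simp add: w3_def m_def S2_def)
    qed
  qed
  also have "sum ?e S2 = sum ?e (resonant n k1 k2 k3)"
  proof -
    have "(y1, y2, y3) \<in> S2" if "(x1, x2, x3) \<in> S2" "(y1, y2, y3) \<in> sols n"
      "p ^ n dvd y1 - r * x1" "p ^ n dvd y2 - r * x2" "p ^ n dvd y3 - r * x3" for x1 x2 x3 y1 y2 y3 r
    proof -
      have "p ^ m dvd w2 x1 x2" "p ^ m dvd w3 x1 x3" using that(1) by (simp_all add: S1_def S2_def)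
      then have "p ^ m dvd w2 y1 y2" "p ^ m dvd w3 y1 y3"
        using w2_scale[OF _ that(3,4)] w3_scale[OF _ that(3,5)] by blast+
      then show ?thesis using that(2) by (simp add: S1_def S2_def)
    qed
    note closed = this
    have S2_sub: "S2 \<subseteq> sols n" by (auto simp: S1_def S2_def)
    have "sum ?e S2 = sum ?e {(x1, x2, x3). (x1, x2, x3) \<in> S2 \<and> p ^ (n - 1) dvd k1 * x1 + k2 * x2 + k3 * x3}"
      by (rule sum_ee_scale[OF n S2_sub closed])
    also have "{(x1, x2, x3). (x1, x2, x3) \<in> S2 \<and> p ^ (n - 1) dvd k1 * x1 + k2 * x2 + k3 * x3} = resonant n k1 k2 k3"
      by (auto simp: S1_def S2_def resonant_def w2_def w3_def m_def)
    finally show ?thesis .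
  qed
  finally have "norm (char_sum n k1 k2 k3) \<le> (\<Sum>x\<in>resonant n k1 k2 k3. 1)"
    by (simp only:) (rule sum_norm_le, simp add: case_prod_unfold)
  then show ?thesis by simp
qed

end

section \<open>Counting resonant points and summing over frequencies\<close>

lemma card_linear_congruence_le:
  fixes c b q M :: int
  assumes "q > 0" "M > 0" "M dvd q"
  shows "int (card {x\<in>{0..<q}. M dvd c * x - b}) \<le> (q div M) * gcd c M"
proof -
  let ?S = "{x\<in>{0..<q}. M dvd c * x - b}"
  define g where "g = gcd c M"
  have g: "g > 0" using assms(2) by (simp add: g_def)
  have gd: "g dvd c" "g dvd M" by (simp_all add: g_def)
  from gd(1) obtain c' where c': "c = g * c'" by (rule dvdE)
  from gd(2) obtain M' where M': "M = g * M'" by (rule dvdE)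
  have M'0: "M' > 0" using assms(2) g M' by (simp add: zero_less_mult_iff)
  have cop: "coprime c' M'"
  proof -
    have "gcd c M = g" by (simp only: g_def)
    then have "g * gcd c' M' = g" using g gcd_mult_distrib_int[of g c' M'] unfolding c' M' by simp
    then show ?thesis using g by (simp add: coprime_iff_gcd_eq_1)
  qed
  obtain r where r: "q = M * r" using assms(3) by (auto simp: dvd_def)
  have r0: "r \<ge> 0" using assms r by (simp add: zero_less_mult_iff)
  \<comment> \<open>Dividing the congruence by g determines x modulo M' = M/g, so each block of
    length M' contains at most one solution.\<close>
  have inj: "inj_on (\<lambda>x. x div M') ?S"
  proof (rule inj_onI)
    fix x y assume x: "x \<in> ?S" and y: "y \<in> ?S" and eq: "x div M' = y div M'"
    have "M dvd (c * x - b) - (c * y - b)" by (rule dvd_diff) (use x y in simp_all)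
    then have "g * M' dvd g * (c' * (x - y))" unfolding M' c' by (simp add: algebra_simps)
    then have "M' dvd c' * (x - y)" using g by simp
    then have "M' dvd x - y" using cop by (simp add: coprime_commute coprime_dvd_mult_right_iff)
    then have "x mod M' = y mod M'" by (simp only: mod_eq_dvd_iff)
    then show "x = y" using eq by (metis mult_div_mod_eq)
  qed
  have "(\<lambda>x. x div M') ` ?S \<subseteq> {0..<g * r}"
  proof clarify
    fix x assume x: "x \<in> {0..<q}"
    have "M' * (x div M') < M' * (g * r)"
    proof -
      have "M' * (x div M') + x mod M' = x" by simp
      moreover have "x mod M' \<ge> 0" using M'0 by simp
      moreover have "x < M' * (g * r)" using x unfolding r M' by (simp add: mult_ac)
      ultimately show ?thesis by linarith
    qed
    then show "x div M' \<in> {0..<g * r}"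
      using x M'0 by (auto simp: pos_imp_zdiv_nonneg_iff)
  qed
  then have "card ?S \<le> card {0..<g * r}"
    using inj by (intro card_inj_on_le) auto
  then have "card ?S \<le> nat (g * r)" by simp
  then have "int (card ?S) \<le> int (nat (g * r))" by (simp only: of_nat_le_iff)
  also have "\<dots> = g * r" using g r0 by simp
  also have "\<dots> = (q div M) * gcd c M" using assms(2) by (simp add: r g_def)
  finally show ?thesis .
qed

context ternary_form
begin

text \<open>There are p^n choices of x1; the first congruence is linear in x2 with leading
  coefficient k1 a2, which has the same gcd with p^(n div 2) as k1; at most two roots remain for
  x3.\<close>

lemma card_resonant_le:
  assumes n: "n > 0"
  shows "real (card (resonant n k1 k2 k3)) \<le> 2 * real_of_int (p ^ n * p ^ (n - n div 2) * gcd k1 (p ^ (n div 2)))"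
proof -
  define m where "m = n div 2"
  define X where "X = (\<lambda>x1. {x2\<in>{0..<p ^ n}. p ^ m dvd (k1 * a2) * x2 - k2 * a1 * x1})"
  let ?T = "SIGMA x:(SIGMA x1:{0..<p ^ n}. X x1). roots n a3 (a1 * (fst x)\<^sup>2 + a2 * (snd x)\<^sup>2)"
  have fin: "finite (X x1)" for x1 unfolding X_def by (rule finite_subset[of _ "{0..<p ^ n}"]) auto
  have cop: "coprime (p ^ m) a2" using units(2) coprime_p_iff by (simp add: coprime_commute)
  have "p ^ n div p ^ m = p ^ (n - m)" using p_pos by (simp add: m_def power_diff)
  moreover have "gcd (k1 * a2) (p ^ m) = gcd k1 (p ^ m)"
    using cop by (simp add: gcd_mult_right_right_cancel gcd.commute coprime_commute gcd_mult_left_right_cancel)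
  moreover have "p ^ m dvd p ^ n" by (intro le_imp_power_dvd) (simp add: m_def)
  ultimately have card_X: "int (card (X x1)) \<le> p ^ (n - m) * gcd k1 (p ^ m)" for x1
    using card_linear_congruence_le[of "p ^ n" "p ^ m" "k1 * a2" "k2 * a1 * x1"] p_pos by (simp add: X_def)
  have "resonant n k1 k2 k3 \<subseteq> (\<lambda>((x1, x2), x3). (x1, x2, x3)) ` ?T" (is "_ \<subseteq> ?g ` _")
  proof (rule subsetI)
    fix x assume x: "x \<in> resonant n k1 k2 k3"
    obtain x1 x2 x3 where x_eq: "x = (x1, x2, x3)" by (cases x)
    have "((x1, x2), x3) \<in> ?T"
      using x unfolding x_eq by (simp add: resonant_def sols_def roots_def X_def quad_form_def add.commute m_def)
    moreover have "x = ?g ((x1, x2), x3)" by (simp add: x_eq)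
    ultimately show "x \<in> ?g ` ?T" by (rule rev_image_eqI)
  qed
  then have "card (resonant n k1 k2 k3) \<le> card ?T"
    using fin by (intro surj_card_le) auto
  also have "\<dots> = (\<Sum>x\<in>(SIGMA x1:{0..<p ^ n}. X x1). card (roots n a3 (a1 * (fst x)\<^sup>2 + a2 * (snd x)\<^sup>2)))"
    using fin by (subst card_SigmaI) auto
  also have "\<dots> \<le> (\<Sum>x\<in>(SIGMA x1:{0..<p ^ n}. X x1). 2)"
    by (intro sum_mono card_roots_le units n)
  also have "\<dots> = 2 * (\<Sum>x1\<in>{0..<p ^ n}. card (X x1))"
    using fin by simp
  finally have "int (card (resonant n k1 k2 k3)) \<le> int (2 * (\<Sum>x1\<in>{0..<p ^ n}. card (X x1)))"
    by (simp only: of_nat_le_iff)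
  also have "\<dots> = 2 * (\<Sum>x1\<in>{0..<p ^ n}. int (card (X x1)))" by simp
  also have "\<dots> \<le> 2 * (\<Sum>x1\<in>{0..<p ^ n}. p ^ (n - m) * gcd k1 (p ^ m))"
    using card_X by (intro mult_left_mono sum_mono) auto
  also have "\<dots> = 2 * (p ^ n * p ^ (n - n div 2) * gcd k1 (p ^ (n div 2)))"
    using p_pos by (simp add: m_def)
  finally have "real_of_int (int (card (resonant n k1 k2 k3))) \<le>
      real_of_int (2 * (p ^ n * p ^ (n - n div 2) * gcd k1 (p ^ (n div 2))))"
    by (simp only: of_int_le_iff)
  then show ?thesis by simp
qed

text \<open>The vector a1 x1 k differs from k1 (a1 x1, a2 x2, a3 x3) by (0, w2, w3) up to sign.
  Expanding the dual form gives a multiple of the form at x, a multiple of k.x, and terms quadratic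
  in w2, w3. The latter carry p^(2 (n div 2)), and 2 (n div 2) \<ge> n - 1 also for odd n.\<close>

lemma resonant_imp_isotropic:
  assumes "x \<in> resonant n k1 k2 k3" "n > 0"
  shows "p ^ (n - 1) dvd dual_form k1 k2 k3"
proof -
  obtain x1 x2 x3 where x_eq: "x = (x1, x2, x3)" by (cases x)
  define w2 w3 where "w2 = k1 * a2 * x2 - k2 * a1 * x1" and "w3 = k1 * a3 * x3 - k3 * a1 * x1"
  have sol: "(x1, x2, x3) \<in> sols n" and w: "p ^ (n div 2) dvd w2" "p ^ (n div 2) dvd w3"
    and k: "p ^ (n - 1) dvd k1 * x1 + k2 * x2 + k3 * x3"
    using assms(1) by (auto simp: resonant_def x_eq w2_def w3_def)
  have "p ^ (n - 1) dvd p ^ n" by (intro le_imp_power_dvd) simp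
  then have Qd: "p ^ (n - 1) dvd quad_form x1 x2 x3" using sol dvd_trans by (auto simp: sols_def)
  have ww: "p ^ (n - 1) dvd u * u" if "p ^ (n div 2) dvd u" for u
  proof -
    have "p ^ (n - 1) dvd p ^ (n div 2 + n div 2)" by (intro le_imp_power_dvd) linarith
    also have "\<dots> dvd u * u" unfolding power_add using that by (intro mult_dvd_mono)
    finally show ?thesis .
  qed
  have "(a1 * x1)\<^sup>2 * dual_form k1 k2 k3 = (- (a1 * a2 * a3) * k1\<^sup>2) * quad_form x1 x2 x3
      + (2 * k1 * (a1 * a2 * a3) * a1 * x1) * (k1 * x1 + k2 * x2 + k3 * x3)
      + (a1 * a3) * (w2 * w2) + (a1 * a2) * (w3 * w3)"
    unfolding dual_form_def quad_form_def w2_def w3_def by (simp add: power2_eq_square algebra_simps)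
  also have "p ^ (n - 1) dvd \<dots>"
    by (rule dvd_add[OF dvd_add[OF dvd_add[OF dvd_mult[OF Qd] dvd_mult[OF k]] dvd_mult[OF ww[OF w(1)]]] dvd_mult[OF ww[OF w(2)]]])
  finally have "p ^ (n - 1) dvd (a1 * x1)\<^sup>2 * dual_form k1 k2 k3" .
  moreover have "\<not> p dvd (a1 * x1)\<^sup>2"
    using units sol p(1) by (auto simp: sols_def prime_dvd_mult_iff prime_dvd_power_iff)
  ultimately show ?thesis by (rule prime_power_dvd_cancel)
qed

lemma abs_dual_form_le:
  assumes "\<bar>k1\<bar> \<le> L" "\<bar>k2\<bar> \<le> L" "\<bar>k3\<bar> \<le> L"
  shows "\<bar>dual_form k1 k2 k3\<bar> \<le> height * L\<^sup>2"
proof -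
  have "k\<^sup>2 \<le> L\<^sup>2" if "\<bar>k\<bar> \<le> L" for k using that by (metis abs_ge_zero power2_abs power_mono)
  then have "\<bar>a2 * a3\<bar> * k1\<^sup>2 + \<bar>a1 * a3\<bar> * k2\<^sup>2 + \<bar>a1 * a2\<bar> * k3\<^sup>2
       \<le> \<bar>a2 * a3\<bar> * L\<^sup>2 + \<bar>a1 * a3\<bar> * L\<^sup>2 + \<bar>a1 * a2\<bar> * L\<^sup>2"
    using assms by (intro add_mono mult_left_mono) auto
  moreover have "\<bar>dual_form k1 k2 k3\<bar> \<le> \<bar>a2 * a3 * k1\<^sup>2\<bar> + \<bar>a1 * a3 * k2\<^sup>2\<bar> + \<bar>a1 * a2 * k3\<^sup>2\<bar>"
    unfolding dual_form_def by linarith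
  ultimately show ?thesis unfolding height_def abs_mult distrib_right abs_power2 by linarith
qed

text \<open>Here l = k/g with g the gcd of the coordinates. Because g \<le> L is below p^(n div 2),
  the proportionality congruences keep at least one factor p after division by g. Hence p divides
  all coordinates of l or none, and primitivity excludes the former; so the p-part of k1 is that of
  g.\<close>

lemma resonant_nonempty_decompose:
  assumes resonant: "resonant n k1 k2 k3 \<noteq> {}" and n: "n > 0" and k: "(k1, k2, k3) \<noteq> (0, 0, 0)"
    and L: "\<bar>k1\<bar> \<le> L" "\<bar>k2\<bar> \<le> L" "\<bar>k3\<bar> \<le> L" "L < p ^ (n div 2)" "height * L\<^sup>2 < p ^ (n - 1)"
  obtains g l1 l2 l3 where "g \<in> {1..L}" "(l1, l2, l3) \<in> primitive_isotropic (L div g)"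
    "k1 = g * l1" "k2 = g * l2" "k3 = g * l3" "gcd k1 (p ^ (n div 2)) = gcd g (p ^ (n div 2))"
proof -
  obtain x1 x2 x3 where x: "(x1, x2, x3) \<in> resonant n k1 k2 k3" using resonant by (metis ex_in_conv prod_cases3)
  have D0: "dual_form k1 k2 k3 = 0"
    using resonant_imp_isotropic[OF x n] abs_dual_form_le[OF L(1-3)] L(5) dvd_imp_le_int[of "dual_form k1 k2 k3" "p ^ (n - 1)"]
    by linarith
  define g where "g = gcd k1 (gcd k2 k3)"
  have g0: "g > 0" using k by (auto simp: g_def)
  have "g dvd gcd k2 k3" unfolding g_def by (rule gcd_dvd2)
  then have gd: "g dvd k1" "g dvd k2" "g dvd k3"
    using dvd_trans[OF _ gcd_dvd1] dvd_trans[OF _ gcd_dvd2] by (auto simp: g_def)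
  from gd(1) obtain l1 where l1: "k1 = g * l1" by (rule dvdE)
  from gd(2) obtain l2 where l2: "k2 = g * l2" by (rule dvdE)
  from gd(3) obtain l3 where l3: "k3 = g * l3" by (rule dvdE)
  have le: "g * \<bar>l1\<bar> \<le> L" "g * \<bar>l2\<bar> \<le> L" "g * \<bar>l3\<bar> \<le> L"
    using L(1-3) g0 unfolding l1 l2 l3 abs_mult by simp_all
  have "g \<le> L"
  proof -
    have "l1 \<noteq> 0 \<or> l2 \<noteq> 0 \<or> l3 \<noteq> 0" using k l1 l2 l3 by auto
    then obtain l where l: "l \<noteq> 0" "g * \<bar>l\<bar> \<le> L" using le by blast
    have "g * 1 \<le> g * \<bar>l\<bar>" using g0 l(1) by (intro mult_left_mono) auto
    then show ?thesis using l(2) by simp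
  qed
  have prim1: "gcd l1 (gcd l2 l3) = 1"
  proof -
    have "g = g * gcd l1 (gcd l2 l3)"
    proof -
      have "gcd k2 k3 = g * gcd l2 l3" unfolding l2 l3 using gcd_mult_distrib_int[of g l2 l3] g0 by simp
      then have "gcd k1 (gcd k2 k3) = g * gcd l1 (gcd l2 l3)"
        using gcd_mult_distrib_int[of g l1 "gcd l2 l3"] g0 l1 by simp
      then show ?thesis by (simp only: g_def)
    qed
    then show ?thesis using g0 by simp
  qed
  have "dual_form k1 k2 k3 = g\<^sup>2 * dual_form l1 l2 l3" unfolding l1 l2 l3 dual_form_def by (simp add: power2_eq_square algebra_simps)
  then have Dl: "dual_form l1 l2 l3 = 0" using D0 g0 by simp
  have sol: "\<not> p dvd x1" "\<not> p dvd x2" "\<not> p dvd x3" using x by (auto simp: resonant_def sols_def)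
  have p_of: "p dvd y" if "p ^ (n div 2) dvd g * y" for y
  proof (rule ccontr)
    assume "\<not> p dvd y"
    have "p ^ (n div 2) dvd y * g" using that by (simp only: mult.commute)
    then have "p ^ (n div 2) dvd g" using \<open>\<not> p dvd y\<close> by (rule prime_power_dvd_cancel)
    then show False using zdvd_imp_le[OF _ g0] \<open>g \<le> L\<close> L(4) by fastforce
  qed
  have "p ^ (n div 2) dvd g * (l1 * (a2 * x2) - l2 * (a1 * x1))"
    "p ^ (n div 2) dvd g * (l1 * (a3 * x3) - l3 * (a1 * x1))"
    using x by (auto simp: resonant_def l1 l2 l3 algebra_simps)
  then have e: "p dvd l1 * (a2 * x2) - l2 * (a1 * x1)" "p dvd l1 * (a3 * x3) - l3 * (a1 * x1)"
    by (simp_all only: p_of)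
  have ax: "\<not> p dvd a1 * x1" "\<not> p dvd a2 * x2" "\<not> p dvd a3 * x3"
    using units sol p(1) by (auto simp: prime_dvd_mult_iff)
  have i12: "p dvd l1 \<longleftrightarrow> p dvd l2"
    using p_dvd_cong_diff[OF e(1)] p(1) ax by (simp only: prime_dvd_mult_iff) blast
  have i13: "p dvd l1 \<longleftrightarrow> p dvd l3"
    using p_dvd_cong_diff[OF e(2)] p(1) ax by (simp only: prime_dvd_mult_iff) blast
  have nd: "\<not> p dvd l1"
  proof
    assume "p dvd l1"
    then have "p dvd gcd l1 (gcd l2 l3)" using i12 i13 by simp
    then show False using prim1 p by simp
  qed
  have "(l1, l2, l3) \<in> primitive_isotropic (L div g)"
  proof -
    have "\<bar>l\<bar> \<le> L div g" if "g * \<bar>l\<bar> \<le> L" for l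
    proof -
      have "(g * \<bar>l\<bar>) div g \<le> L div g" using that g0 by (intro zdiv_mono1)
      then show ?thesis using g0 by simp
    qed
    then show ?thesis using le nd i12 i13 prim1 Dl by (simp add: primitive_isotropic_def)
  qed
  moreover have "gcd k1 (p ^ (n div 2)) = gcd g (p ^ (n div 2))"
  proof -
    have "coprime (p ^ (n div 2)) l1" using nd coprime_p_iff[of l1] by (simp add: coprime_commute)
    then show ?thesis unfolding l1 by (rule gcd_mult_left_right_cancel)
  qed
  ultimately show ?thesis using that[of g l1 l2 l3] g0 \<open>g \<le> L\<close> l1 l2 l3 by simp
qed

text \<open>Grouping by g, there are O(L/g) primitive directions, each with weight proportional to
  gcd(g, p^(n div 2)). The averaged gcd then leaves L times (n + 1) times a harmonic sum. The
  constant 8 is 2 for the roots times 4 for the fibres.\<close>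

lemma sum_norm_char_sum_near_le:
  assumes n: "n > 0" and L: "L \<ge> 0" "L < p ^ (n div 2)" "height * L\<^sup>2 < p ^ (n - 1)"
  shows "(\<Sum>(k1, k2, k3)\<in>{-L..L} \<times> {-L..L} \<times> {-L..L} - {(0, 0, 0)}. norm (char_sum n k1 k2 k3))
    \<le> 8 * real_of_int (p ^ n * p ^ (n - n div 2) * p * height * L) * (real n + 1) * (\<Sum>h\<in>{1..L}. 1 / real_of_int h)"
proof -
  define m where "m = n div 2"
  define c where "c = 2 * real_of_int (p ^ n * p ^ (n - n div 2))"
  have c0: "c \<ge> 0" using p_pos by (simp add: c_def)
  define B where "B = {-L..L} \<times> {-L..L} \<times> {-L..L} - {(0, 0, 0)}"
  define K where "K = {(k1, k2, k3). (k1, k2, k3) \<in> B \<and> resonant n k1 k2 k3 \<noteq> {}}"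
  define T where "T = (SIGMA g:{1..L}. primitive_isotropic (L div g))"
  define f where "f = (\<lambda>(k1::int, k2::int, k3::int). c * real_of_int (gcd k1 (p ^ m)))"
  define \<phi> where "\<phi> = (\<lambda>(g::int, l1, l2, l3). (g * l1, g * l2, g * l3))"
  have finB: "finite B" by (simp add: B_def)
  have KB: "K \<subseteq> B" by (auto simp: K_def)
  have finT: "finite T" by (simp add: T_def)
  have "(\<Sum>(k1, k2, k3)\<in>B. norm (char_sum n k1 k2 k3)) = (\<Sum>(k1, k2, k3)\<in>K. norm (char_sum n k1 k2 k3))"
  proof (rule sum.mono_neutral_right[OF finB KB], clarify)
    fix k1 k2 k3 assume "(k1, k2, k3) \<in> B" "(k1, k2, k3) \<notin> K"
    then have "resonant n k1 k2 k3 = {}" by (simp add: K_def)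
    then show "norm (char_sum n k1 k2 k3) = 0" using norm_char_sum_le_card_resonant[OF n, of k1 k2 k3] by simp
  qed
  also have "\<dots> \<le> (\<Sum>k\<in>K. f k)"
  proof (rule sum_mono, clarify)
    fix k1 k2 k3
    show "norm (char_sum n k1 k2 k3) \<le> f (k1, k2, k3)"
      using norm_char_sum_le_card_resonant[OF n, of k1 k2 k3] card_resonant_le[OF n, of k1 k2 k3]
      by (simp add: f_def c_def m_def)
  qed
  also have "\<dots> \<le> (\<Sum>t\<in>T. c * real_of_int (gcd (fst t) (p ^ m)))"
  proof (rule sum_le_included[where i = \<phi>, OF finite_subset[OF KB finB] finT])
    show "\<forall>t\<in>T. 0 \<le> c * real_of_int (gcd (fst t) (p ^ m))" using c0 by simp
    show "\<forall>k\<in>K. \<exists>t\<in>T. \<phi> t = k \<and> f k \<le> c * real_of_int (gcd (fst t) (p ^ m))"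
    proof clarify
      fix k1 k2 k3 assume k: "(k1, k2, k3) \<in> K"
      have "resonant n k1 k2 k3 \<noteq> {}" "(k1, k2, k3) \<noteq> (0, 0, 0)" "\<bar>k1\<bar> \<le> L" "\<bar>k2\<bar> \<le> L" "\<bar>k3\<bar> \<le> L"
        using k by (auto simp: K_def B_def)
      from resonant_nonempty_decompose[OF this(1) n this(2-5) L(2,3)]
      obtain g l1 l2 l3 where g: "g \<in> {1..L}" "(l1, l2, l3) \<in> primitive_isotropic (L div g)"
        "k1 = g * l1" "k2 = g * l2" "k3 = g * l3" "gcd k1 (p ^ (n div 2)) = gcd g (p ^ (n div 2))" by blast
      have "(g, l1, l2, l3) \<in> T" using g by (simp add: T_def)
      moreover have "\<phi> (g, l1, l2, l3) = (k1, k2, k3)" using g by (simp add: \<phi>_def)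
      moreover have "f (k1, k2, k3) \<le> c * real_of_int (gcd (fst (g, l1, l2, l3)) (p ^ m))"
        using g(6) by (simp add: f_def m_def)
      ultimately show "\<exists>t\<in>T. \<phi> t = (k1, k2, k3) \<and> f (k1, k2, k3) \<le> c * real_of_int (gcd (fst t) (p ^ m))"
        by blast
    qed
  qed
  also have "\<dots> = (\<Sum>g\<in>{1..L}. \<Sum>l\<in>primitive_isotropic (L div g). c * real_of_int (gcd g (p ^ m)))"
    unfolding T_def by (subst sum.Sigma) (auto simp: case_prod_unfold)
  also have "\<dots> \<le> (\<Sum>g\<in>{1..L}. c * real_of_int (4 * p * height * L) * (real_of_int (gcd g (p ^ m)) / real_of_int g))"
  proof (rule sum_mono)
    fix g assume g: "g \<in> {1..L}"
    have "L div g \<ge> 1" using g zdiv_mono1[of g L g] by simp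
    then have "int (card (primitive_isotropic (L div g))) \<le> 4 * p * height * (L div g)" by (rule card_primitive_isotropic_le)
    then have "real_of_int (int (card (primitive_isotropic (L div g)))) \<le> real_of_int (4 * p * height * (L div g))"
      by (simp only: of_int_le_iff)
    also have "\<dots> = real_of_int (4 * p * height) * real_of_int (L div g)" by simp
    also have "\<dots> \<le> real_of_int (4 * p * height) * (real_of_int L / real_of_int g)"
    proof (rule mult_left_mono)
      show "real_of_int (L div g) \<le> real_of_int L / real_of_int g" by (rule real_of_int_div4)
      have "4 * p * height \<ge> 0" using p_pos height_ge_1 by simp
      then show "0 \<le> real_of_int (4 * p * height)" by (simp only: of_int_0_le_iff)
    qed
    finally have "real (card (primitive_isotropic (L div g))) * (c * real_of_int (gcd g (p ^ m)))
        \<le> real_of_int (4 * p * height) * (real_of_int L / real_of_int g) * (c * real_of_int (gcd g (p ^ m)))"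
      using c0 by (intro mult_right_mono) auto
    then show "(\<Sum>l\<in>primitive_isotropic (L div g). c * real_of_int (gcd g (p ^ m)))
       \<le> c * real_of_int (4 * p * height * L) * (real_of_int (gcd g (p ^ m)) / real_of_int g)"
      by (simp add: field_simps)
  qed
  also have "\<dots> = c * real_of_int (4 * p * height * L) * (\<Sum>g\<in>{1..L}. real_of_int (gcd g (p ^ m)) / real_of_int g)"
    by (simp only: sum_distrib_left)
  also have "\<dots> \<le> c * real_of_int (4 * p * height * L) * ((real n + 1) * (\<Sum>h\<in>{1..L}. 1 / real_of_int h))"
  proof (rule mult_left_mono)
    have "(\<Sum>g\<in>{1..L}. real_of_int (gcd g (p ^ m)) / real_of_int g) \<le> (real m + 1) * (\<Sum>h\<in>{1..L}. 1 / real_of_int h)"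
      by (rule sum_gcd_prime_power_div_le[OF p(1)])
    also have "\<dots> \<le> (real n + 1) * (\<Sum>h\<in>{1..L}. 1 / real_of_int h)"
      by (intro mult_right_mono sum_nonneg) (auto simp: m_def)
    finally show "(\<Sum>g\<in>{1..L}. real_of_int (gcd g (p ^ m)) / real_of_int g) \<le> (real n + 1) * (\<Sum>h\<in>{1..L}. 1 / real_of_int h)" .
    have "4 * p * height * L \<ge> 0" using p_pos height_ge_1 L(1) by simp
    then show "0 \<le> c * real_of_int (4 * p * height * L)" using c0 by (simp only: of_int_0_le_iff mult_nonneg_nonneg)
  qed
  finally show ?thesis by (simp add: B_def c_def mult_ac)
qed

end

section \<open>Finite Fourier inversion\<close>

lemma has_sum_finite_sum:
  fixes f :: "'i \<Rightarrow> 'a \<Rightarrow> complex"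
  assumes "finite I" "\<And>i. i \<in> I \<Longrightarrow> (f i has_sum s i) A"
  shows "((\<lambda>x. \<Sum>i\<in>I. f i x) has_sum (\<Sum>i\<in>I. s i)) A"
  using assms by (induction I rule: finite_induct) (auto intro!: has_sum_add)

lemma abs_summable_on_times:
  fixes f g :: "_ \<Rightarrow> complex"
  assumes "(\<lambda>x. norm (f x)) summable_on A" "(\<lambda>x. norm (g x)) summable_on B"
  shows "(\<lambda>z. norm (case z of (x, y) \<Rightarrow> f x * g y)) summable_on A \<times> B"
  unfolding Infinite_Sum.abs_summable_on_Sigma_iff
proof (intro conjI ballI)
  fix x assume "x \<in> A"
  show "(\<lambda>y. norm (case (x, y) of (x, y) \<Rightarrow> f x * g y)) summable_on B"
    using summable_on_cmult_right[OF assms(2), of "norm (f x)"] by (simp add: norm_mult)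
next
  have "(\<lambda>x. \<bar>norm (f x) * infsum (\<lambda>y. norm (g y)) B\<bar>) summable_on A"
    using summable_on_cmult_left[OF assms(1), of "infsum (\<lambda>y. norm (g y)) B"]
    by (simp add: abs_mult infsum_nonneg)
  then show "(\<lambda>x. norm (\<Sum>\<^sub>\<infinity>y\<in>B. norm (case (x, y) of (x, y) \<Rightarrow> f x * g y))) summable_on A"
    using assms(2) by (simp add: norm_mult infsum_cmult_right)
qed

lemma has_sum_times:
  fixes f g :: "_ \<Rightarrow> complex"
  assumes "(\<lambda>x. norm (f x)) summable_on A" "(\<lambda>x. norm (g x)) summable_on B"
  shows "((\<lambda>(x, y). f x * g y) has_sum (infsum f A * infsum g B)) (A \<times> B)"
proof -
  have sum: "(\<lambda>(x, y). f x * g y) summable_on A \<times> B"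
    using abs_summable_on_times[OF assms] by (rule Infinite_Sum.abs_summable_summable)
  have "infsum (\<lambda>(x, y). f x * g y) (A \<times> B) = infsum (\<lambda>x. infsum (\<lambda>y. f x * g y) B) A"
    using infsum_Sigma'_banach[of "\<lambda>x y. f x * g y" A "\<lambda>_. B"] sum by simp
  also have "\<dots> = infsum f A * infsum g B"
    using assms[THEN Infinite_Sum.abs_summable_summable] by (simp add: infsum_cmult_right infsum_cmult_left)
  finally show ?thesis using has_sum_infsum[OF sum] by simp
qed

lemma sum_cartesian_times:
  fixes f g :: "_ \<Rightarrow> complex"
  shows "(\<Sum>(x, y)\<in>A \<times> B. f x * g y) = sum f A * sum g B"
  by (simp add: sum_product sum.cartesian_product)

lemma has_sum_minus:
  fixes f g :: "_ \<Rightarrow> 'b::real_normed_vector"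
  assumes "(f has_sum a) A" "(g has_sum b) A"
  shows "((\<lambda>x. f x - g x) has_sum (a - b)) A"
  using has_sum_add[OF assms(1), of "\<lambda>x. - g x" "- b"] assms(2) by (simp add: has_sum_uminus)

lemma infsum_complex_of_real:
  assumes "f summable_on A"
  shows "(\<Sum>\<^sub>\<infinity>x\<in>A. complex_of_real (f x)) = of_real (infsum f A)"
  by (intro infsumI has_sum_of_real has_sum_infsum assms)

text \<open>The sum runs over all integers: this is the discrete Fourier transform of the
  q-periodisation of f.\<close>

definition fourier_mod :: "int \<Rightarrow> (int \<Rightarrow> real) \<Rightarrow> int \<Rightarrow> complex" where
  "fourier_mod q f k = (\<Sum>\<^sub>\<infinity>x. of_real (f x) * ee q (k * x))"

lemma abs_summable_fourier_mod:
  fixes f :: "int \<Rightarrow> real"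
  assumes "f summable_on UNIV"
  shows "(\<lambda>x. norm (of_real (f x) * ee q (k * x))) summable_on UNIV"
  using summable_on_iff_abs_summable_on_real[THEN iffD1, OF assms] by (simp add: norm_mult)

lemma norm_fourier_mod_le:
  assumes "f summable_on UNIV"
  shows "norm (fourier_mod q f k) \<le> (\<Sum>\<^sub>\<infinity>x. \<bar>f x\<bar>)"
  using norm_infsum_bound[OF abs_summable_fourier_mod[OF assms, of q k]] by (simp add: fourier_mod_def norm_mult)

lemma fourier_mod_0: "f summable_on UNIV \<Longrightarrow> fourier_mod q f 0 = of_real (\<Sum>\<^sub>\<infinity>x. f x)"
  by (simp add: fourier_mod_def infsum_complex_of_real)

lemma fourier_mod_difference:
  assumes "f summable_on UNIV"
  shows "(\<lambda>x. f (x + 1) - f x) summable_on UNIV"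
    and "fourier_mod q (\<lambda>x. f (x + 1) - f x) k = (ee q (- k) - 1) * fourier_mod q f k"
proof -
  have bij: "bij_betw (\<lambda>x::int. x + 1) UNIV UNIV"
    by (rule bij_betwI[of _ _ _ "\<lambda>x. x - 1"]) auto
  have shift: "(\<lambda>x. f (x + 1)) summable_on UNIV"
    using summable_on_reindex_bij_betw[OF bij, of f] assms by simp
  then show "(\<lambda>x. f (x + 1) - f x) summable_on UNIV" 
    using has_sum_minus[OF has_sum_infsum has_sum_infsum[OF assms]] by (auto intro: has_sum_imp_summable)
  have s: "(\<lambda>x. of_real (f x) * ee q (k * x)) summable_on UNIV"
    "(\<lambda>x. of_real (f (x + 1)) * ee q (k * x)) summable_on UNIV"
    by (rule Infinite_Sum.abs_summable_summable[OF abs_summable_fourier_mod[OF assms]],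
        rule Infinite_Sum.abs_summable_summable[OF abs_summable_fourier_mod[OF shift]])
  have "(\<Sum>\<^sub>\<infinity>x. of_real (f (x + 1)) * ee q (k * x)) = (\<Sum>\<^sub>\<infinity>x. ee q (- k) * (of_real (f (x + 1)) * ee q (k * (x + 1))))"
  proof (intro infsum_cong)
    fix x
    have "ee q (k * x) = ee q (- k) * ee q (k * (x + 1))"
      unfolding ee_add[symmetric] by (simp add: algebra_simps)
    then show "of_real (f (x + 1)) * ee q (k * x) = ee q (- k) * (of_real (f (x + 1)) * ee q (k * (x + 1)))"
      by (simp add: mult_ac)
  qed
  also have "\<dots> = (\<Sum>\<^sub>\<infinity>x. ee q (- k) * (of_real (f x) * ee q (k * x)))"
    using infsum_reindex_bij_betw[OF bij, of "\<lambda>x. ee q (- k) * (of_real (f x) * ee q (k * x))"] .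
  also have "\<dots> = ee q (- k) * fourier_mod q f k"
    unfolding fourier_mod_def using s(1) by (intro infsum_cmult_right)
  finally have e: "(\<Sum>\<^sub>\<infinity>x. of_real (f (x + 1)) * ee q (k * x)) = ee q (- k) * fourier_mod q f k" .
  have "fourier_mod q (\<lambda>x. f (x + 1) - f x) k = (\<Sum>\<^sub>\<infinity>x. of_real (f (x + 1)) * ee q (k * x) - of_real (f x) * ee q (k * x))"
    unfolding fourier_mod_def by (intro infsum_cong) (simp add: algebra_simps)
  also have "\<dots> = ee q (- k) * fourier_mod q f k - fourier_mod q f k"
    using has_sum_minus[OF has_sum_infsum[OF s(2)] has_sum_infsum[OF s(1)]] unfolding e
    by (auto simp: fourier_mod_def intro!: infsumI)
  finally show "fourier_mod q (\<lambda>x. f (x + 1) - f x) k = (ee q (- k) - 1) * fourier_mod q f k" by (simp add: algebra_simps)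
qed

definition fdiff :: "(int \<Rightarrow> real) \<Rightarrow> int \<Rightarrow> real" where
  "fdiff f = (\<lambda>x. f (x + 1) - f x)"

text \<open>Each forward difference multiplies the transform by \<open>ee q (- k) - 1\<close>, whose
  norm is at least |k|/q for |k| \<le> q/2. Frequencies must therefore be represented by their
  smallest residues.\<close>

lemma norm_fourier_mod_fdiff_le:
  assumes "f summable_on UNIV" "q > 0" "2 * \<bar>k\<bar> \<le> q"
  shows "(real_of_int \<bar>k\<bar> / real_of_int q) ^ j * norm (fourier_mod q f k) \<le> (\<Sum>\<^sub>\<infinity>x. \<bar>(fdiff ^^ j) f x\<bar>)"
proof -
  have main: "(fdiff ^^ j) f summable_on UNIV \<and> fourier_mod q ((fdiff ^^ j) f) k = (ee q (- k) - 1) ^ j * fourier_mod q f k"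
  proof (induction j)
    case (Suc j)
    then show ?case
      using fourier_mod_difference(1)[of "(fdiff ^^ j) f"] fourier_mod_difference(2)[of "(fdiff ^^ j) f" q k]
      by (simp add: fdiff_def[of "(fdiff ^^ j) f"])
  qed (use assms in simp)
  have "(real_of_int \<bar>k\<bar> / real_of_int q) ^ j \<le> norm (ee q (- k) - 1) ^ j"
    using norm_ee_minus_1_ge[of q "- k"] assms by (intro power_mono) auto
  then have "(real_of_int \<bar>k\<bar> / real_of_int q) ^ j * norm (fourier_mod q f k) \<le> norm (fourier_mod q ((fdiff ^^ j) f) k)"
    using main by (simp add: norm_mult norm_power mult_right_mono)
  also have "\<dots> \<le> (\<Sum>\<^sub>\<infinity>x. \<bar>(fdiff ^^ j) f x\<bar>)"
    using main by (intro norm_fourier_mod_le) simp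
  finally show ?thesis .
qed

text \<open>Membership of x modulo q in S is detected by characters in each coordinate. As q is odd,
  -h..h is a complete residue system with 2|k| < q, the range in which the transform is known to
  decay.\<close>

lemma infsum_residues_eq_fourier_mod:
  fixes S :: "(int \<times> int \<times> int) set"
  assumes f: "f summable_on UNIV" and q: "q = 2 * h + 1" "h \<ge> 0"
    and S: "S \<subseteq> {0..<q} \<times> {0..<q} \<times> {0..<q}"
    and P: "\<And>x1 x2 x3. (x1, x2, x3) \<in> P \<longleftrightarrow> (x1 mod q, x2 mod q, x3 mod q) \<in> S"
  shows "complex_of_real (\<Sum>\<^sub>\<infinity>(x1, x2, x3)\<in>P. f x1 * f x2 * f x3) =
    (1 / of_int q ^ 3) * (\<Sum>(k1, k2, k3)\<in>{-h..h} \<times> {-h..h} \<times> {-h..h}.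
       (\<Sum>(a1, a2, a3)\<in>S. ee q (k1 * a1 + k2 * a2 + k3 * a3)) * (fourier_mod q f (- k1) * fourier_mod q f (- k2) * fourier_mod q f (- k3)))"
proof -
  define K where "K = {-h..h} \<times> {-h..h} \<times> {-h..h}"
  define E where "E = (\<lambda>(k1, k2, k3). \<Sum>(a1, a2, a3)\<in>S. ee q (k1 * a1 + k2 * a2 + k3 * a3))"
  define g where "g = (\<lambda>k x. complex_of_real (f x) * ee q (- k * x))"
  define G where "G = (\<lambda>(k1, k2, k3) (x1, x2, x3). g k1 x1 * (g k2 x2 * g k3 x3))"
  have q0: "q > 0" using q by simp
  have finS: "finite S" using S by (rule finite_subset) simp
  have interval: "{-h..h} = {-h..<-h+q}" using q by auto
  have g_sum: "(\<lambda>x. norm (g k x)) summable_on UNIV" for k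
    unfolding g_def by (rule abs_summable_fourier_mod[OF f])
  have g_inf: "infsum (g k) UNIV = fourier_mod q f (- k)" for k by (simp add: g_def fourier_mod_def)
  have G_sum: "(G (k1, k2, k3) has_sum (fourier_mod q f (- k1) * fourier_mod q f (- k2) * fourier_mod q f (- k3))) UNIV" for k1 k2 k3
  proof -
    have 1: "((\<lambda>(x, y). g k2 x * g k3 y) has_sum (infsum (g k2) UNIV * infsum (g k3) UNIV)) (UNIV \<times> UNIV)"
      by (rule has_sum_times[OF g_sum g_sum])
    have "((\<lambda>(x, y). g k1 x * (case y of (x, y) \<Rightarrow> g k2 x * g k3 y)) has_sum
        (infsum (g k1) UNIV * infsum (\<lambda>(x, y). g k2 x * g k3 y) (UNIV \<times> UNIV))) (UNIV \<times> (UNIV \<times> UNIV))"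
      by (rule has_sum_times[OF g_sum abs_summable_on_times[OF g_sum g_sum]])
    also have "infsum (\<lambda>(x, y). g k2 x * g k3 y) (UNIV \<times> UNIV) = fourier_mod q f (- k2) * fourier_mod q f (- k3)"
      using 1 by (simp add: infsumI g_inf)
    finally show ?thesis by (simp add: G_def g_inf case_prod_unfold mult.assoc)
  qed
  have "((\<lambda>x. \<Sum>k\<in>K. E k * G k x) has_sum
      (\<Sum>k\<in>K. E k * (case k of (k1, k2, k3) \<Rightarrow> fourier_mod q f (- k1) * fourier_mod q f (- k2) * fourier_mod q f (- k3)))) UNIV"
  proof (rule has_sum_finite_sum)
    fix k assume "k \<in> K"
    obtain k1 k2 k3 where k: "k = (k1, k2, k3)" by (cases k)
    show "((\<lambda>x. E k * G k x) has_sum (E k * (case k of (k1, k2, k3) \<Rightarrow> fourier_mod q f (- k1) * fourier_mod q f (- k2) * fourier_mod q f (- k3)))) UNIV"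
      unfolding k using has_sum_cmult_right[OF G_sum[of k1 k2 k3], of "E (k1, k2, k3)"] by simp
  qed (simp add: K_def)
  moreover have "(\<Sum>k\<in>K. E k * G k x) = (case x of (x1, x2, x3) \<Rightarrow>
      if x \<in> P then of_int q ^ 3 * complex_of_real (f x1 * f x2 * f x3) else 0)" for x
  proof -
    obtain x1 x2 x3 where x: "x = (x1, x2, x3)" by (cases x)
    define F where "F = complex_of_real (f x1 * f x2 * f x3)"
    have ee_diff: "ee q (k * (a - y)) = ee q (k * a) * ee q (- (k * y))" for k a y
      unfolding ee_add[symmetric] by (simp add: algebra_simps)
    have one: "(\<Sum>k\<in>{-h..h}. ee q (k * c)) = (if q dvd c then of_int q else 0)" for c
      unfolding interval by (rule sum_ee[OF q0])
    have "(\<Sum>k\<in>K. E k * G k x) = (\<Sum>k\<in>K. \<Sum>a\<in>S. F *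
        (case k of (k1, k2, k3) \<Rightarrow> case a of (a1, a2, a3) \<Rightarrow>
          ee q (k1 * (a1 - x1)) * (ee q (k2 * (a2 - x2)) * ee q (k3 * (a3 - x3)))))"
    proof (rule sum.cong[OF refl])
      fix k assume "k \<in> K"
      obtain k1 k2 k3 where k: "k = (k1, k2, k3)" by (cases k)
      show "E k * G k x = (\<Sum>a\<in>S. F * (case k of (k1, k2, k3) \<Rightarrow> case a of (a1, a2, a3) \<Rightarrow>
          ee q (k1 * (a1 - x1)) * (ee q (k2 * (a2 - x2)) * ee q (k3 * (a3 - x3)))))"
        unfolding E_def k prod.case sum_distrib_right
      proof (rule sum.cong[OF refl], clarify)
        fix a1 a2 a3
        show "ee q (k1 * a1 + k2 * a2 + k3 * a3) * G (k1, k2, k3) x =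
            F * (ee q (k1 * (a1 - x1)) * (ee q (k2 * (a2 - x2)) * ee q (k3 * (a3 - x3))))"
          unfolding G_def g_def x F_def by (simp add: ee_add ee_diff)
      qed
    qed
    also have "\<dots> = F * (\<Sum>a\<in>S. \<Sum>k\<in>K. 
        (case k of (k1, k2, k3) \<Rightarrow> case a of (a1, a2, a3) \<Rightarrow>
          ee q (k1 * (a1 - x1)) * (ee q (k2 * (a2 - x2)) * ee q (k3 * (a3 - x3)))))"
      by (subst sum.swap) (simp add: sum_distrib_left)
    also have "\<dots> = F * (\<Sum>a\<in>S. case a of (a1, a2, a3) \<Rightarrow>
       (\<Sum>k\<in>{-h..h}. ee q (k * (a1 - x1))) * ((\<Sum>k\<in>{-h..h}. ee q (k * (a2 - x2))) * (\<Sum>k\<in>{-h..h}. ee q (k * (a3 - x3)))))"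
    proof -
      have "(\<Sum>k\<in>K. (case k of (k1, k2, k3) \<Rightarrow> u k1 * (v k2 * w k3)))
         = (\<Sum>k\<in>{-h..h}. u k) * ((\<Sum>k\<in>{-h..h}. v k) * (\<Sum>k\<in>{-h..h}. w k))" for u v w :: "int \<Rightarrow> complex"
        unfolding K_def
        using sum_cartesian_times[of u "\<lambda>(k2, k3). v k2 * w k3" "{-h..h}" "{-h..h} \<times> {-h..h}"]
          sum_cartesian_times[of v w "{-h..h}" "{-h..h}"]
        by (simp add: case_prod_unfold)
      note split = this
      show ?thesis
        by (rule arg_cong[where f = "\<lambda>z. F * z"], rule sum.cong[OF refl], clarify) (simp only: prod.case split)
    qed
    also have "\<dots> = F * (\<Sum>a\<in>S. if a = (x1 mod q, x2 mod q, x3 mod q) then of_int q ^ 3 else 0)"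
    proof -
      have "q dvd a - y \<longleftrightarrow> a = y mod q" if "a \<in> {0..<q}" for a y
        using that mod_eq_dvd_iff[of a q y] by simp
      moreover have "a1 \<in> {0..<q} \<and> a2 \<in> {0..<q} \<and> a3 \<in> {0..<q}" if "(a1, a2, a3) \<in> S" for a1 a2 a3
        using that S by auto
      ultimately show ?thesis
        unfolding one
        by (intro arg_cong[where f = "\<lambda>z. F * z"] sum.cong refl, clarify) (simp add: power3_eq_cube)
    qed
    also have "\<dots> = (if (x1 mod q, x2 mod q, x3 mod q) \<in> S then of_int q ^ 3 * F else 0)"
      using finS by (simp add: mult.commute)
    finally show ?thesis by (simp add: x F_def P)
  qed
  ultimately have "((\<lambda>x. case x of (x1, x2, x3) \<Rightarrow> if x \<in> P then of_int q ^ 3 * complex_of_real (f x1 * f x2 * f x3) else 0) has_sum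
      (\<Sum>k\<in>K. E k * (case k of (k1, k2, k3) \<Rightarrow> fourier_mod q f (- k1) * fourier_mod q f (- k2) * fourier_mod q f (- k3)))) UNIV"
    by simp
  then have "((\<lambda>x. of_int q ^ 3 * complex_of_real (case x of (x1, x2, x3) \<Rightarrow> f x1 * f x2 * f x3)) has_sum
      (\<Sum>k\<in>K. E k * (case k of (k1, k2, k3) \<Rightarrow> fourier_mod q f (- k1) * fourier_mod q f (- k2) * fourier_mod q f (- k3)))) P"
    by (rule has_sum_cong_neutral[THEN iffD1, rotated -1]) (auto split: if_splits)
  from has_sum_cmult_right[OF this, of "1 / of_int q ^ 3"] q0
  have "((\<lambda>x. complex_of_real (case x of (x1, x2, x3) \<Rightarrow> f x1 * f x2 * f x3)) has_sum
      (1 / of_int q ^ 3 * (\<Sum>k\<in>K. E k * (case k of (k1, k2, k3) \<Rightarrow> fourier_mod q f (- k1) * fourier_mod q f (- k2) * fourier_mod q f (- k3))))) P"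
    by simp
  note has_sum_P = this
  have "(\<lambda>x. case x of (x1, x2, x3) \<Rightarrow> f x1 * f x2 * f x3) summable_on P"
    using has_sum_imp_summable[OF has_sum_Re[OF has_sum_P]] by simp
  note of_real = infsum_complex_of_real[OF this]
  from has_sum_P have "(\<Sum>\<^sub>\<infinity>x\<in>P. complex_of_real (case x of (x1, x2, x3) \<Rightarrow> f x1 * f x2 * f x3)) =
      (1 / of_int q ^ 3 * (\<Sum>k\<in>K. E k * (case k of (k1, k2, k3) \<Rightarrow> fourier_mod q f (- k1) * fourier_mod q f (- k2) * fourier_mod q f (- k3))))"
    by (rule infsumI)
  then show ?thesis unfolding of_real
    by (simp add: K_def E_def case_prod_unfold)
qed

section \<open>Schwartz functions\<close>

lemma derivative_decay:
  assumes "schwartz \<Phi>"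
  obtains C where "C \<ge> 0" "\<And>x. \<bar>(deriv ^^ k) \<Phi> x\<bar> \<le> C / (1 + x\<^sup>2)"
proof -
  obtain C0 where C0: "\<And>x. \<bar>x\<bar> ^ 0 * \<bar>(deriv ^^ k) \<Phi> x\<bar> \<le> C0"
    using assms unfolding schwartz_def by blast
  obtain C2 where C2: "\<And>x. \<bar>x\<bar> ^ 2 * \<bar>(deriv ^^ k) \<Phi> x\<bar> \<le> C2"
    using assms unfolding schwartz_def by blast
  have le: "\<bar>(deriv ^^ k) \<Phi> x\<bar> \<le> (C0 + C2) / (1 + x\<^sup>2)" for x
  proof -
    have "\<bar>(deriv ^^ k) \<Phi> x\<bar> * (1 + x\<^sup>2) \<le> C0 + C2"
      using C0[of x] C2[of x] by (simp add: algebra_simps)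
    moreover have "1 + x\<^sup>2 > 0" by (simp add: add_pos_nonneg)
    ultimately show ?thesis by (simp add: pos_le_divide_eq)
  qed
  have "C0 + C2 \<ge> 0" using le[of 0] by simp
  then show ?thesis using le that by blast
qed

lemma schwartz_has_derivative:
  assumes "schwartz \<Phi>"
  shows "((deriv ^^ k) \<Phi> has_real_derivative (deriv ^^ Suc k) \<Phi> x) (at x)"
  using assms unfolding schwartz_def
  by (simp add: DERIV_deriv_iff_real_differentiable)

section \<open>Finite differences of sampled functions\<close>

text \<open>A discrete mean value theorem. Stating it for a whole tower \<open>G\<close> of
  derivatives lets the induction pass to the tower of first differences, whose top member is at most
  h M by the mean value theorem.\<close>

lemma iterated_difference_le:
  fixes G :: "nat \<Rightarrow> real \<Rightarrow> real"
  assumes "\<And>i x. (G i has_real_derivative G (Suc i) x) (at x)" "h \<ge> 0"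
    "\<And>y. x \<le> y \<Longrightarrow> y \<le> x + real k * h \<Longrightarrow> \<bar>G k y\<bar> \<le> M"
  shows "\<bar>((\<lambda>f x. f (x + h) - f x) ^^ k) (G 0) x\<bar> \<le> h ^ k * M"
  using assms
proof (induction k arbitrary: G M)
  case 0
  then show ?case by simp
next
  case (Suc k)
  let ?G = "\<lambda>i x. G i (x + h) - G i x"
  have "\<bar>((\<lambda>f x. f (x + h) - f x) ^^ k) (?G 0) x\<bar> \<le> h ^ k * (h * M)"
  proof (rule Suc.IH)
    fix i x
    show "(?G i has_real_derivative ?G (Suc i) x) (at x)"
      by (intro DERIV_diff Suc.prems(1) DERIV_shift[THEN iffD1])
  next
    fix y assume y: "x \<le> y" "y \<le> x + real k * h"
    show "\<bar>?G k y\<bar> \<le> h * M"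
    proof (cases "h = 0")
      case False
      then have "y < y + h" using Suc.prems(2) by simp
      then obtain z where z: "y < z" "z < y + h" "G k (y + h) - G k y = (y + h - y) * G (Suc k) z"
        using MVT2[of y "y + h" "G k" "G (Suc k)"] Suc.prems(1) by blast
      have "\<bar>G (Suc k) z\<bar> \<le> M"
        using y z Suc.prems(2) by (intro Suc.prems(3)) (auto simp: algebra_simps)
      then show ?thesis using z(3) Suc.prems(2) by (simp add: abs_mult mult_left_mono)
    qed simp
  qed (use Suc.prems in simp)
  then show ?case by (simp add: funpow_Suc_right mult_ac del: funpow.simps)
qed

lemma fdiff_scale:
  "(fdiff ^^ k) (\<lambda>x. f (real_of_int x / N)) = (\<lambda>x. ((\<lambda>f x. f (x + 1 / N) - f x) ^^ k) f (real_of_int x / N))"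
  by (induction k) (simp_all add: fdiff_def add_divide_distrib fun_eq_iff)

text \<open>Comparison with the integral: by monotonicity the term at x > 0 is at most N times the
  increment of arctan over ((x-1)/N, x/N), which telescopes. With arctan < 2 the total is at most 1
  + 4N \<le> 5N.\<close>

lemma sum_cauchy_density_le:
  fixes N :: real
  assumes N: "N \<ge> 1"
  shows "(\<Sum>x\<in>{- int M..int M}. 1 / (1 + (real_of_int x / N)\<^sup>2)) \<le> 5 * N"
proof -
  let ?w = "\<lambda>x. 1 / (1 + (real_of_int x / N)\<^sup>2)"
  have "(\<Sum>x\<in>{- int M..int M}. ?w x) \<le> 1 + 2 * (N * arctan (real M / N))"
  proof (induction M)
    case (Suc M)
    have "{- int (Suc M)..int (Suc M)} = insert (int (Suc M)) (insert (- int (Suc M)) {- int M..int M})" by auto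
    then have "(\<Sum>x\<in>{- int (Suc M)..int (Suc M)}. ?w x)
        = ?w (int (Suc M)) + (?w (- int (Suc M)) + (\<Sum>x\<in>{- int M..int M}. ?w x))"
      by simp
    moreover have "?w (- y) = ?w y" for y by simp
    ultimately have "(\<Sum>x\<in>{- int (Suc M)..int (Suc M)}. ?w x) = 2 * ?w (int (Suc M)) + (\<Sum>x\<in>{- int M..int M}. ?w x)"
      by (simp only:)
    moreover have "?w (int (Suc M)) \<le> N * (arctan (real (Suc M) / N) - arctan (real M / N))"
    proof -
      have lt: "real M / N < real (Suc M) / N" using N by (simp add: divide_strict_right_mono)
      obtain z where z: "real M / N < z" "z < real (Suc M) / N"
        "arctan (real (Suc M) / N) - arctan (real M / N) = (real (Suc M) / N - real M / N) * inverse (1 + z\<^sup>2)"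
        using MVT2[OF lt, of arctan "\<lambda>x. inverse (1 + x\<^sup>2)"] DERIV_arctan by blast
      have z0: "z \<ge> 0" using z(1) N by (meson divide_nonneg_nonneg le_less_trans less_imp_le of_nat_0_le_iff order_trans zero_le_one)
      have "z\<^sup>2 \<le> (real (Suc M) / N)\<^sup>2" using z(2) z0 by (intro power_mono) auto
      then have "?w (int (Suc M)) \<le> inverse (1 + z\<^sup>2)"
        unfolding inverse_eq_divide by (intro divide_left_mono) (auto intro!: mult_pos_pos add_pos_nonneg)
      moreover have "N * (real (Suc M) / N - real M / N) = 1" using N by (simp add: field_simps)
      ultimately show ?thesis unfolding z(3) by (simp only: mult.assoc[symmetric] mult_1)
    qed
    ultimately show ?case using Suc.IH by (simp add: algebra_simps)
  qed simp
  moreover have "N * arctan (real M / N) \<le> N * 2"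
    using N arctan_ubound[of "real M / N"] pi_less_4 by (intro mult_left_mono) auto
  ultimately show ?thesis using N by linarith
qed

lemma cauchy_density_summable:
  fixes N :: real
  assumes N: "N \<ge> 1"
  shows "(\<lambda>x::int. 1 / (1 + (real_of_int x / N)\<^sup>2)) summable_on UNIV"
    and "(\<Sum>\<^sub>\<infinity>x::int. 1 / (1 + (real_of_int x / N)\<^sup>2)) \<le> 5 * N"
proof -
  let ?w = "\<lambda>x. 1 / (1 + (real_of_int x / N)\<^sup>2)"
  have fin: "sum ?w F \<le> 5 * N" if "finite F" for F
  proof -
    define M where "M = nat (\<Sum>x\<in>F. \<bar>x\<bar>)"
    have "F \<subseteq> {- int M..int M}"
    proof
      fix x assume "x \<in> F"
      then have "\<bar>x\<bar> \<le> (\<Sum>x\<in>F. \<bar>x\<bar>)" using that by (intro member_le_sum) auto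
      then show "x \<in> {- int M..int M}" by (auto simp: M_def)
    qed
    then have "sum ?w F \<le> (\<Sum>x\<in>{- int M..int M}. ?w x)" by (intro sum_mono2) auto
    then show ?thesis using sum_cauchy_density_le[OF N, of M] by linarith
  qed
  show s: "?w summable_on UNIV"
    by (rule nonneg_bdd_above_summable_on) (auto intro!: bdd_aboveI2[where M = "5 * N"] fin)
  show "infsum ?w UNIV \<le> 5 * N"
    by (rule infsum_le_finite_sums[OF s]) (use fin in auto)
qed

lemma schwartz_fdiff_bound:
  assumes "schwartz \<Phi>"
  obtains C where "C \<ge> 0" "\<And>N x. N \<ge> 1 \<Longrightarrow>
     \<bar>(fdiff ^^ k) (\<lambda>x. \<Phi> (real_of_int x / N)) x\<bar> \<le> C / N ^ k * (1 / (1 + (real_of_int x / N)\<^sup>2))"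
proof -
  obtain C where C: "C \<ge> 0" "\<And>x. \<bar>(deriv ^^ k) \<Phi> x\<bar> \<le> C / (1 + x\<^sup>2)"
    using derivative_decay[OF assms] by blast
  \<comment> \<open>The difference samples the derivative at points z within k/N \<le> k of the base
    point y. The factor is the price of moving the decay from z to y: 1 + y^2 \<le> (2 + 2 k^2)(1 +
    z^2).\<close>
  define C' where "C' = C * (2 + 2 * (real k)\<^sup>2)"
  have "\<bar>(fdiff ^^ k) (\<lambda>x. \<Phi> (real_of_int x / N)) x\<bar> \<le> C' / N ^ k * (1 / (1 + (real_of_int x / N)\<^sup>2))"
    if N: "N \<ge> 1" for N x
  proof -
    let ?y = "real_of_int x / N"
    have "\<bar>((\<lambda>f x. f (x + 1 / N) - f x) ^^ k) ((deriv ^^ 0) \<Phi>) ?y\<bar> \<le> (1 / N) ^ k * (C' * (1 / (1 + ?y\<^sup>2)))"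
    proof (rule iterated_difference_le[where G = "\<lambda>i. (deriv ^^ i) \<Phi>"])
      fix z assume z: "?y \<le> z" "z \<le> ?y + real k * (1 / N)"
      have "real k * (1 / N) \<le> real k" using N by (simp add: divide_le_eq mult_le_cancel_left1)
      then have "\<bar>?y - z\<bar> \<le> real k" using z by linarith
      then have d: "(?y - z)\<^sup>2 \<le> (real k)\<^sup>2" by (metis abs_ge_zero power2_abs power_mono)
      have "y\<^sup>2 \<le> 2 * z\<^sup>2 + 2 * (y - z)\<^sup>2" for y :: real
        using zero_le_power2[of "y - 2 * z"] by (simp add: power2_eq_square algebra_simps)
      from this[of ?y] have "1 + ?y\<^sup>2 \<le> 2 + 2 * (real k)\<^sup>2 + 2 * z\<^sup>2" using d by linarith
      also have "\<dots> \<le> (2 + 2 * (real k)\<^sup>2) * (1 + z\<^sup>2)"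
        using mult_nonneg_nonneg[of "(real k)\<^sup>2" "z\<^sup>2"] by (simp add: algebra_simps)
      finally have le: "1 + ?y\<^sup>2 \<le> (2 + 2 * (real k)\<^sup>2) * (1 + z\<^sup>2)" .
      have pos: "1 + ?y\<^sup>2 > 0" "1 + z\<^sup>2 > 0" by (simp_all add: add_pos_nonneg)
      have "C * (1 + ?y\<^sup>2) \<le> C * ((2 + 2 * (real k)\<^sup>2) * (1 + z\<^sup>2))" using le C(1) by (rule mult_left_mono)
      then have "C / (1 + z\<^sup>2) \<le> C' * (1 / (1 + ?y\<^sup>2))"
        using pos by (simp add: C'_def frac_le_eq pos_divide_le_eq pos_le_divide_eq mult_ac)
      then show "\<bar>(deriv ^^ k) \<Phi> z\<bar> \<le> C' * (1 / (1 + ?y\<^sup>2))" using C(2)[of z] by linarith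
    qed (use N schwartz_has_derivative[OF assms] in auto)
    then show ?thesis unfolding fdiff_scale by (simp add: power_one_over field_simps)
  qed
  moreover have "C' \<ge> 0" using C(1) by (simp add: C'_def)
  ultimately show ?thesis using that by blast
qed

lemma schwartz_fdiff_sum:
  assumes "schwartz \<Phi>"
  obtains C where "C \<ge> 0" "\<And>N. N \<ge> 1 \<Longrightarrow> (\<Sum>\<^sub>\<infinity>x. \<bar>(fdiff ^^ k) (\<lambda>x. \<Phi> (real_of_int x / N)) x\<bar>) \<le> C * N / N ^ k"
    "\<And>N. N \<ge> 1 \<Longrightarrow> (\<lambda>x. \<bar>(fdiff ^^ k) (\<lambda>x. \<Phi> (real_of_int x / N)) x\<bar>) summable_on UNIV"
proof -
  obtain C where C: "C \<ge> 0" "\<And>N x. N \<ge> 1 \<Longrightarrow>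
     \<bar>(fdiff ^^ k) (\<lambda>x. \<Phi> (real_of_int x / N)) x\<bar> \<le> C / N ^ k * (1 / (1 + (real_of_int x / N)\<^sup>2))"
    using schwartz_fdiff_bound[OF assms] by blast
  have sum: "(\<lambda>x. C / N ^ k * (1 / (1 + (real_of_int x / N)\<^sup>2))) summable_on UNIV" if "N \<ge> 1" for N
    using cauchy_density_summable(1)[OF that] by (rule summable_on_cmult_right)
  have s: "(\<lambda>x. \<bar>(fdiff ^^ k) (\<lambda>x. \<Phi> (real_of_int x / N)) x\<bar>) summable_on UNIV" if "N \<ge> 1" for N
    by (rule summable_on_comparison_test[OF sum[OF that]]) (use C that in auto)
  have "(\<Sum>\<^sub>\<infinity>x. \<bar>(fdiff ^^ k) (\<lambda>x. \<Phi> (real_of_int x / N)) x\<bar>) \<le> (5 * C) * N / N ^ k" if N: "N \<ge> 1" for N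
  proof -
    have "(\<Sum>\<^sub>\<infinity>x. \<bar>(fdiff ^^ k) (\<lambda>x. \<Phi> (real_of_int x / N)) x\<bar>) \<le> (\<Sum>\<^sub>\<infinity>x. C / N ^ k * (1 / (1 + (real_of_int x / N)\<^sup>2)))"
      by (rule infsum_mono[OF s[OF N] sum[OF N] C(2)[OF N]])
    also have "\<dots> = C / N ^ k * (\<Sum>\<^sub>\<infinity>x. 1 / (1 + (real_of_int x / N)\<^sup>2))"
      by (intro infsum_cmult_right cauchy_density_summable N)
    also have "\<dots> \<le> C / N ^ k * (5 * N)"
      using cauchy_density_summable(2)[OF N] C(1) N by (intro mult_left_mono) auto
    finally show ?thesis by (simp add: mult_ac)
  qed
  then show ?thesis using that[of "5 * C"] C(1) s by simp
qed

section \<open>Integrals and Riemann sums\<close>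

lemma differentiable_schwartz: "schwartz \<Phi> \<Longrightarrow> (\<Phi> has_real_derivative deriv \<Phi> x) (at x)"
  using schwartz_has_derivative[of \<Phi> 0 x] by simp

lemma continuous_on_schwartz: "schwartz \<Phi> \<Longrightarrow> continuous_on S \<Phi>"
  using differentiable_schwartz by (meson DERIV_isCont continuous_at_imp_continuous_on)

text \<open>Monotone convergence of the truncations to [-M, M]. Their integrals are bounded by
  comparison with C/(1 + x^2), whose integral is below 4C.\<close>

lemma schwartz_pos_integral:
  assumes \<Phi>: "schwartz \<Phi>" "\<And>x. \<Phi> x \<ge> 0"
  shows "\<Phi> integrable_on UNIV"
    and "(\<lambda>M. integral {- real M..real M} \<Phi>) \<longlonglongrightarrow> integral UNIV \<Phi>"
proof -
  obtain C where C: "C \<ge> 0" "\<And>x. \<bar>(deriv ^^ 0) \<Phi> x\<bar> \<le> C / (1 + x\<^sup>2)"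
    using derivative_decay[OF \<Phi>(1)] by blast
  define f where "f = (\<lambda>M x. if x \<in> {- real M..real M} then \<Phi> x else 0)"
  have int_f: "(f M has_integral integral {- real M..real M} \<Phi>) UNIV" for M
    unfolding f_def has_integral_restrict_UNIV
    by (intro integrable_integral integrable_continuous_interval continuous_on_schwartz \<Phi>)
  have le: "integral {- real M..real M} \<Phi> \<le> 4 * C" for M
  proof -
    have "((\<lambda>x. C * inverse (1 + x\<^sup>2)) has_integral C * arctan (real M) - C * arctan (- real M)) {- real M..real M}"
      by (intro fundamental_theorem_of_calculus)
         (auto intro!: DERIV_subset[OF DERIV_cmult[OF DERIV_arctan]] simp flip: has_real_derivative_iff_has_vector_derivative)
    then have "integral {- real M..real M} \<Phi> \<le> C * arctan (real M) - C * arctan (- real M)"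
    proof (rule has_integral_le[rotated])
      show "(\<Phi> has_integral integral {- real M..real M} \<Phi>) {- real M..real M}"
        by (intro integrable_integral integrable_continuous_interval continuous_on_schwartz \<Phi>)
      show "\<Phi> x \<le> C * inverse (1 + x\<^sup>2)" for x using C(2)[of x] by (simp add: divide_inverse)
    qed
    also have "\<dots> = C * (2 * arctan (real M))" by (simp add: arctan_minus)
    also have "\<dots> \<le> C * 4" using arctan_ubound[of "real M"] pi_less_4 C(1) by (intro mult_left_mono) auto
    finally show ?thesis by simp
  qed
  have ge: "0 \<le> integral {- real M..real M} \<Phi>" for M
    by (intro integral_nonneg integrable_continuous_interval continuous_on_schwartz \<Phi>)
  have "\<Phi> integrable_on UNIV \<and> (\<lambda>M. integral UNIV (f M)) \<longlonglongrightarrow> integral UNIV \<Phi>"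
  proof (rule monotone_convergence_increasing)
    show "f M integrable_on UNIV" for M using int_f by blast
    show "f M x \<le> f (Suc M) x" for M x using \<Phi>(2) by (auto simp: f_def)
    show "(\<lambda>M. f M x) \<longlonglongrightarrow> \<Phi> x" for x
    proof (rule tendsto_eventually)
      have "eventually (\<lambda>M. real M \<ge> \<bar>x\<bar>) sequentially"
        using filterlim_real_sequentially unfolding filterlim_at_top by blast
      then show "eventually (\<lambda>M. f M x = \<Phi> x) sequentially"
        by eventually_elim (auto simp: f_def abs_le_iff)
    qed
    show "bounded (range (\<lambda>M. integral UNIV (f M)))"
      unfolding bounded_iff using le ge integral_unique[OF int_f] by (intro exI[of _ "4 * C"]) auto
  qed
  then show "\<Phi> integrable_on UNIV" "(\<lambda>M. integral {- real M..real M} \<Phi>) \<longlonglongrightarrow> integral UNIV \<Phi>"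
    using integral_unique[OF int_f] by simp_all
qed

lemma integral_pos_schwartz:
  assumes \<Phi>: "schwartz \<Phi>" "\<And>x. \<Phi> x \<ge> 0" and nz: "\<Phi> x0 \<noteq> 0"
  shows "integral UNIV \<Phi> > 0"
proof -
  have int: "\<Phi> integrable_on UNIV" using schwartz_pos_integral(1)[OF \<Phi>] .
  have intb: "\<Phi> integrable_on {x0 - 1..x0 + 1}"
    by (intro integrable_continuous_interval continuous_on_schwartz \<Phi>)
  have ge: "integral {x0 - 1..x0 + 1} \<Phi> \<ge> 0" using intb \<Phi> by (intro integral_nonneg)
  have "integral {x0 - 1..x0 + 1} \<Phi> \<noteq> 0"
  proof
    assume "integral {x0 - 1..x0 + 1} \<Phi> = 0"
    then have "(\<Phi> has_integral 0) (cbox (x0 - 1) (x0 + 1))"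
      using integrable_integral[OF intb] by simp
    then have "\<Phi> x0 = 0"
      by (rule has_integral_0_cbox_imp_0[rotated 2]) (use \<Phi> continuous_on_schwartz in auto)
    then show False using nz by simp
  qed
  moreover have "integral {x0 - 1..x0 + 1} \<Phi> \<le> integral UNIV \<Phi>"
    using int intb \<Phi> by (intro integral_subset_le) auto
  ultimately show ?thesis using ge by linarith
qed

text \<open>The error is bounded independently of N: each sample differs from N times the integral
  over its cell by the oscillation on a cell of length 1/N, and these sum to a multiple of the
  integral of the derivative bound. Here 20 is 4, from moving the decay across a cell, times 5, from
  the sum of Cauchy densities.\<close>

lemma riemann_sum_error:
  assumes \<Phi>: "schwartz \<Phi>" "\<And>x. \<Phi> x \<ge> 0"
  obtains C where "C \<ge> 0" "\<And>N. N \<ge> 1 \<Longrightarrow> \<bar>(\<Sum>\<^sub>\<infinity>x::int. \<Phi> (real_of_int x / N)) - N * integral UNIV \<Phi>\<bar> \<le> C"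
proof -
  obtain C where C: "C \<ge> 0" "\<And>x. \<bar>(deriv ^^ 1) \<Phi> x\<bar> \<le> C / (1 + x\<^sup>2)"
    using derivative_decay[OF \<Phi>(1)] by blast
  obtain C0 where C0: "\<And>N. N \<ge> 1 \<Longrightarrow> (\<lambda>x. \<bar>(fdiff ^^ 0) (\<lambda>x. \<Phi> (real_of_int x / N)) x\<bar>) summable_on UNIV"
    using schwartz_fdiff_sum[OF \<Phi>(1)] by metis
  have "\<bar>(\<Sum>\<^sub>\<infinity>x::int. \<Phi> (real_of_int x / N)) - N * integral UNIV \<Phi>\<bar> \<le> 20 * C" if N: "N \<ge> 1" for N
  proof -
    have int: "\<Phi> integrable_on {a..b}" for a b
      by (intro integrable_continuous_interval continuous_on_schwartz \<Phi>)
    have step: "\<bar>\<Phi> (real_of_int x / N) - N * integral {real_of_int x / N..real_of_int (x + 1) / N} \<Phi>\<bar>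
        \<le> 4 * C / N * (1 / (1 + (real_of_int x / N)\<^sup>2))" for x
    proof -
      define y where "y = real_of_int x / N"
      have y1: "real_of_int (x + 1) / N = y + 1 / N" by (simp add: y_def add_divide_distrib)
      define e where "e = 4 * C / N * (1 / (1 + y\<^sup>2))"
      have close: "\<bar>\<Phi> z - \<Phi> y\<bar> \<le> e" if z: "z \<in> {y..y + 1 / N}" for z
      proof (cases "z = y")
        case False
        then have "y < z" using z by simp
        then obtain w where w: "y < w" "w < z" "\<Phi> z - \<Phi> y = (z - y) * deriv \<Phi> w"
          using MVT2[of y z \<Phi> "deriv \<Phi>"] differentiable_schwartz[OF \<Phi>(1)] by blast
        have "1 / N \<le> 1" using N by simp
        then have "\<bar>y - w\<bar> \<le> 1" using w z by (simp only: atLeastAtMost_iff) linarith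
        then have d: "(y - w)\<^sup>2 \<le> 1" using abs_square_le_1 by blast
        have "y\<^sup>2 \<le> 2 * w\<^sup>2 + 2 * (y - w)\<^sup>2"
          using zero_le_power2[of "y - 2 * w"] by (simp add: power2_eq_square algebra_simps)
        also have "\<dots> \<le> 2 * w\<^sup>2 + 2 * 1" by (intro add_left_mono mult_left_mono d) simp
        finally have le: "1 + y\<^sup>2 \<le> 4 * (1 + w\<^sup>2)" using zero_le_power2[of w] unfolding distrib_left by linarith
        have pos: "1 + y\<^sup>2 > 0" "1 + w\<^sup>2 > 0" by (simp_all add: add_pos_nonneg)
        have "C / (1 + w\<^sup>2) \<le> 4 * C / (1 + y\<^sup>2)"
          using mult_left_mono[OF le C(1)] pos by (simp add: pos_divide_le_eq pos_le_divide_eq mult_ac)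
        then have "\<bar>deriv \<Phi> w\<bar> \<le> 4 * C / (1 + y\<^sup>2)" using C(2)[of w] by simp
        moreover have "\<bar>z - y\<bar> \<le> 1 / N" using z by simp
        ultimately have "\<bar>z - y\<bar> * \<bar>deriv \<Phi> w\<bar> \<le> 1 / N * (4 * C / (1 + y\<^sup>2))"
          using N by (intro mult_mono) auto
        then show ?thesis unfolding w(3) abs_mult by (simp add: e_def)
      qed (use C(1) N in \<open>simp add: e_def\<close>)
      have "norm (integral {y..y + 1 / N} (\<lambda>z. \<Phi> z - \<Phi> y)) \<le> integral {y..y + 1 / N} (\<lambda>z. e)"
        by (rule integral_norm_bound_integral) (use close int in \<open>auto intro!: integrable_diff\<close>)
      moreover have "integral {y..y + 1 / N} (\<lambda>z. \<Phi> z - \<Phi> y) = integral {y..y + 1 / N} \<Phi> - \<Phi> y / N"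
        using N by (subst integral_diff) (auto intro: int)
      ultimately have "\<bar>integral {y..y + 1 / N} \<Phi> - \<Phi> y / N\<bar> \<le> e / N" using N by simp
      then have "N * \<bar>integral {y..y + 1 / N} \<Phi> - \<Phi> y / N\<bar> \<le> N * (e / N)" using N by (intro mult_left_mono) auto
      moreover have "N * \<bar>integral {y..y + 1 / N} \<Phi> - \<Phi> y / N\<bar> = \<bar>\<Phi> y - N * integral {y..y + 1 / N} \<Phi>\<bar>"
        using N by (simp add: abs_mult_pos' right_diff_distrib abs_minus_commute)
      ultimately have "\<bar>\<Phi> y - N * integral {y..y + 1 / N} \<Phi>\<bar> \<le> e" using N by simp
      then show ?thesis unfolding y1 e_def unfolding y_def .
    qed
    have telescope: "(\<Sum>x\<in>{- int M..<int M}. integral {real_of_int x / N..real_of_int (x + 1) / N} \<Phi>)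
        = integral {- real M / N..real M / N} \<Phi>" for M
    proof (induction M)
      case (Suc M)
      have set: "{- int (Suc M)..<int (Suc M)} = insert (int M) (insert (- int (Suc M)) {- int M..<int M})" by auto
      have "(\<Sum>x\<in>{- int (Suc M)..<int (Suc M)}. integral {real_of_int x / N..real_of_int (x + 1) / N} \<Phi>)
        = integral {real M / N..real (Suc M) / N} \<Phi> + (integral {- real (Suc M) / N..- real M / N} \<Phi> + integral {- real M / N..real M / N} \<Phi>)"
        unfolding set using Suc.IH by (simp add: add.commute)
      also have "integral {- real (Suc M) / N..- real M / N} \<Phi> + integral {- real M / N..real M / N} \<Phi>
         = integral {- real (Suc M) / N..real M / N} \<Phi>"
        using N by (intro Henstock_Kurzweil_Integration.integral_combine int divide_right_mono) auto
      also have "integral {real M / N..real (Suc M) / N} \<Phi> + integral {- real (Suc M) / N..real M / N} \<Phi>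
         = integral {- real (Suc M) / N..real (Suc M) / N} \<Phi>"
        using N by (subst add.commute) (intro Henstock_Kurzweil_Integration.integral_combine int divide_right_mono, auto)
      finally show ?case .
    qed simp
    have fin: "\<bar>(\<Sum>x\<in>{- int M..<int M}. \<Phi> (real_of_int x / N)) - N * integral {- real M / N..real M / N} \<Phi>\<bar> \<le> 20 * C" for M
    proof -
      have "\<bar>(\<Sum>x\<in>{- int M..<int M}. \<Phi> (real_of_int x / N)) - N * integral {- real M / N..real M / N} \<Phi>\<bar>
         = \<bar>\<Sum>x\<in>{- int M..<int M}. \<Phi> (real_of_int x / N) - N * integral {real_of_int x / N..real_of_int (x + 1) / N} \<Phi>\<bar>"
        by (simp only: sum_subtractf sum_distrib_left[symmetric] telescope)
      also have "\<dots> \<le> (\<Sum>x\<in>{- int M..<int M}. 4 * C / N * (1 / (1 + (real_of_int x / N)\<^sup>2)))"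
        by (rule order_trans[OF sum_abs sum_mono[OF step]])
      also have "\<dots> = 4 * C / N * (\<Sum>x\<in>{- int M..<int M}. 1 / (1 + (real_of_int x / N)\<^sup>2))"
        by (simp only: sum_distrib_left)
      also have "\<dots> \<le> 4 * C / N * (5 * N)"
      proof (rule mult_left_mono)
        have "(\<Sum>x\<in>{- int M..<int M}. 1 / (1 + (real_of_int x / N)\<^sup>2)) \<le> (\<Sum>x\<in>{- int M..int M}. 1 / (1 + (real_of_int x / N)\<^sup>2))"
          by (intro sum_mono2) auto
        then show "(\<Sum>x\<in>{- int M..<int M}. 1 / (1 + (real_of_int x / N)\<^sup>2)) \<le> 5 * N"
          using sum_cauchy_density_le[OF N, of M] by linarith
      qed (use C(1) N in simp)
      also have "\<dots> = 20 * C" using N by simp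
      finally show ?thesis .
    qed
    have lim1: "(\<lambda>M. \<Sum>x\<in>{- int M..<int M}. \<Phi> (real_of_int x / N)) \<longlonglongrightarrow> (\<Sum>\<^sub>\<infinity>x::int. \<Phi> (real_of_int x / N))"
    proof -
      have "((\<lambda>x::int. \<Phi> (real_of_int x / N)) has_sum (\<Sum>\<^sub>\<infinity>x::int. \<Phi> (real_of_int x / N))) UNIV"
        using C0[OF N] \<Phi>(2) by (intro has_sum_infsum) simp
      moreover have "filterlim (\<lambda>M. {- int M..<int M}) (finite_subsets_at_top UNIV) sequentially"
      proof (rule filterlim_finite_subsets_at_top[THEN iffD2], intro allI impI)
        fix X :: "int set" assume X: "finite X \<and> X \<subseteq> UNIV"
        define B where "B = nat (\<Sum>x\<in>X. \<bar>x\<bar>) + 1"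
        have "X \<subseteq> {- int M..<int M}" if "M \<ge> B" for M
        proof
          fix x assume "x \<in> X"
          then have "\<bar>x\<bar> \<le> (\<Sum>x\<in>X. \<bar>x\<bar>)" using X by (intro member_le_sum) auto
          then show "x \<in> {- int M..<int M}" using that by (auto simp: B_def)
        qed
        then show "\<forall>\<^sub>F M in sequentially. finite {- int M..<int M} \<and> X \<subseteq> {- int M..<int M} \<and> {- int M..<int M} \<subseteq> UNIV"
          unfolding eventually_sequentially by auto
      qed
      ultimately show ?thesis
        unfolding has_sum_def by (rule filterlim_compose)
    qed
    \<comment> \<open>The endpoints M/N need not be integers, so the integral is squeezed between
      the truncation at the floor of M/N and the full integral, using positivity.\<close>
    have lim2: "(\<lambda>M. integral {- real M / N..real M / N} \<Phi>) \<longlonglongrightarrow> integral UNIV \<Phi>"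
    proof (rule tendsto_sandwich)
      have fl: "filterlim (\<lambda>M. nat \<lfloor>real M / N\<rfloor>) at_top sequentially"
        unfolding filterlim_at_top eventually_sequentially
      proof (intro allI exI[of _ "nat \<lceil>real Z * N\<rceil>" for Z] impI)
        fix Z M :: nat assume "nat \<lceil>real Z * N\<rceil> \<le> M"
        then have "real Z * N \<le> real M" by linarith
        then have "real Z \<le> real M / N" using N by (simp add: pos_le_divide_eq)
        then have "int Z \<le> \<lfloor>real M / N\<rfloor>" by (simp add: le_floor_iff)
        then show "Z \<le> nat \<lfloor>real M / N\<rfloor>" by linarith
      qed
      show "(\<lambda>M. integral {- real (nat \<lfloor>real M / N\<rfloor>)..real (nat \<lfloor>real M / N\<rfloor>)} \<Phi>) \<longlonglongrightarrow> integral UNIV \<Phi>"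
        using filterlim_compose[OF schwartz_pos_integral(2)[OF \<Phi>] fl] .
      have "real (nat \<lfloor>real M / N\<rfloor>) \<le> real M / N" for M using N by simp
      then show "\<forall>\<^sub>F M in sequentially. integral {- real (nat \<lfloor>real M / N\<rfloor>)..real (nat \<lfloor>real M / N\<rfloor>)} \<Phi> \<le> integral {- real M / N..real M / N} \<Phi>"
        using int \<Phi>(2) by (intro always_eventually allI integral_subset_le) auto
      show "\<forall>\<^sub>F M in sequentially. integral {- real M / N..real M / N} \<Phi> \<le> integral UNIV \<Phi>"
        using int \<Phi>(2) schwartz_pos_integral(1)[OF \<Phi>]
        by (intro always_eventually allI integral_subset_le) auto
      show "(\<lambda>M. integral UNIV \<Phi>) \<longlonglongrightarrow> integral UNIV \<Phi>" by simp
    qed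
    have "(\<lambda>M. \<bar>(\<Sum>x\<in>{- int M..<int M}. \<Phi> (real_of_int x / N)) - N * integral {- real M / N..real M / N} \<Phi>\<bar>)
       \<longlonglongrightarrow> \<bar>(\<Sum>\<^sub>\<infinity>x::int. \<Phi> (real_of_int x / N)) - N * integral UNIV \<Phi>\<bar>"
      by (intro tendsto_intros lim1 lim2)
    then show ?thesis by (rule LIMSEQ_le_const2) (use fin in auto)
  qed
  then show ?thesis using that[of "20 * C"] C(1) by simp
qed

section \<open>The error term\<close>

lemma sum_inverse_le_ln:
  assumes "L \<ge> 1"
  shows "(\<Sum>h\<in>{1..L}. 1 / real_of_int h) \<le> 1 + ln (real_of_int L)"
proof -
  define m where "m = nat (L - 1)"
  have m: "L = int (Suc m)" using assms by (simp add: m_def)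
  have "(\<Sum>h\<in>{1..L}. 1 / real_of_int h) = harm (Suc m)"
    unfolding harm_def m
    by (rule sum.reindex_bij_witness[of _ int nat]) (auto simp: field_simps)
  moreover have "harm (Suc m) - ln (real (Suc m)) \<le> harm (Suc 0) - ln (real (Suc 0))"
    by (rule decseqD[OF decseq_harm_diff_ln]) simp
  ultimately show ?thesis by (simp add: m harm_def)
qed

context ternary_form
begin

text \<open>The conditions are kept in the form of the final statement, so that unfolding yields its
  sum verbatim.\<close>

definition weighted_count :: "nat \<Rightarrow> (int \<Rightarrow> real) \<Rightarrow> real" where
  "weighted_count n f = (\<Sum>\<^sub>\<infinity>(x1, x2, x3)\<in>{(x1, x2, x3). coprime (x1 * x2 * x3) p \<and>
     [a1 * x1\<^sup>2 + a2 * x2\<^sup>2 + a3 * x3\<^sup>2 = 0] (mod (p ^ n))}. f x1 * f x2 * f x3)"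

lemma solution_iff_mod_in_sols:
  assumes "n > 0"
  shows "coprime (x1 * x2 * x3) p \<and> [a1 * x1\<^sup>2 + a2 * x2\<^sup>2 + a3 * x3\<^sup>2 = 0] (mod (p ^ n)) \<longleftrightarrow>
    (x1 mod p ^ n, x2 mod p ^ n, x3 mod p ^ n) \<in> sols n"
proof -
  have dp: "p dvd x \<longleftrightarrow> p dvd x mod p ^ n" for x
    using assms by (simp add: dvd_mod_iff)
  have "p ^ n dvd quad_form x1 x2 x3 - quad_form (x1 mod p ^ n) (x2 mod p ^ n) (x3 mod p ^ n)"
    by (intro quad_form_cong dvd_minus_mod)
  then have "p ^ n dvd quad_form x1 x2 x3 \<longleftrightarrow> p ^ n dvd quad_form (x1 mod p ^ n) (x2 mod p ^ n) (x3 mod p ^ n)"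
    by (metis diff_add_cancel dvd_add_right_iff)
  moreover have "coprime (x1 * x2 * x3) p \<longleftrightarrow> \<not> p dvd x1 \<and> \<not> p dvd x2 \<and> \<not> p dvd x3"
    unfolding coprime_p_iff using p(1) by (simp add: prime_dvd_mult_iff)
  ultimately show ?thesis
    using p_pos dp[of x1] dp[of x2] dp[of x3] by (simp add: sols_def cong_0_iff quad_form_def)
qed

lemma odd_power_p: obtains h where "p ^ n = 2 * h + 1" "h \<ge> 0"
proof -
  have "odd (p ^ n)" using odd_p by simp
  then obtain h where h: "p ^ n = 2 * h + 1" by (rule oddE)
  have "p ^ n > 0" using p_pos by simp
  then have "h \<ge> 0" using h by linarith
  then show ?thesis using that h by blast
qed

text \<open>Near frequencies use the bound \<open>W\<close> for the exponential sums and only the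
  trivial bound for the transforms. Far ones use the reverse: at most q^3 frequencies, each sum at
  most q^3, and at least one of the three transforms bounded by \<open>B1\<close>.\<close>

lemma weighted_count_error:
  assumes n: "n > 0" and h: "p ^ n = 2 * h + 1" "h \<ge> 0" and f: "f summable_on UNIV"
    and B0: "\<And>k. norm (fourier_mod (p ^ n) f k) \<le> B0" "B0 \<ge> 0"
    and B1: "\<And>k. \<bar>k\<bar> \<le> h \<Longrightarrow> \<bar>k\<bar> > L \<Longrightarrow> norm (fourier_mod (p ^ n) f k) \<le> B1" "B1 \<ge> 0"
    and near: "(\<Sum>(k1, k2, k3)\<in>{-L..L} \<times> {-L..L} \<times> {-L..L} - {(0, 0, 0)}. norm (char_sum n k1 k2 k3)) \<le> W"
  shows "\<bar>weighted_count n f - real (card (sols n)) * (\<Sum>\<^sub>\<infinity>x. f x) ^ 3 / real_of_int (p ^ n) ^ 3\<bar>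
    \<le> (B0 ^ 3 * W + real_of_int (p ^ n) ^ 6 * (B0\<^sup>2 * B1)) / real_of_int (p ^ n) ^ 3"
proof -
  define q where "q = p ^ n"
  define qr where "qr = real_of_int q"
  have q0: "q > 0" using p_pos by (simp add: q_def)
  have qr0: "qr > 0" using q0 by (simp add: qr_def)
  define K where "K = {-h..h} \<times> {-h..h} \<times> {-h..h}"
  define B where "B = {-L..L} \<times> {-L..L} \<times> {-L..L} - {(0::int, 0::int, 0::int)}"
  define far where "far = K - {-L..L} \<times> {-L..L} \<times> {-L..L}"
  define t where "t = (\<lambda>(k1, k2, k3). char_sum n k1 k2 k3 * (fourier_mod q f (- k1) * fourier_mod q f (- k2) * fourier_mod q f (- k3)))"
  have finK: "finite K" and finB: "finite B" and finfar: "finite far" by (simp_all add: K_def B_def far_def)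
  have weighted_count_eq: "complex_of_real (weighted_count n f) = (1 / of_int q ^ 3) * (\<Sum>k\<in>K. t k)"
  proof -
    have sub: "sols n \<subseteq> {0..<p ^ n} \<times> {0..<p ^ n} \<times> {0..<p ^ n}" by (auto simp: sols_def)
    let ?P = "{(x1, x2, x3). coprime (x1 * x2 * x3) p \<and> [a1 * x1\<^sup>2 + a2 * x2\<^sup>2 + a3 * x3\<^sup>2 = 0] (mod (p ^ n))}"
    have mem: "(x1, x2, x3) \<in> ?P \<longleftrightarrow> (x1 mod p ^ n, x2 mod p ^ n, x3 mod p ^ n) \<in> sols n" for x1 x2 x3
      unfolding mem_Collect_eq prod.case by (rule solution_iff_mod_in_sols[OF n])
    show ?thesis
      unfolding weighted_count_def infsum_residues_eq_fourier_mod[OF f h sub mem]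
      by (simp add: K_def t_def char_sum_def q_def case_prod_unfold)
  qed
  have zero: "(0, 0, 0) \<in> K" using h by (simp add: K_def)
  have t0: "t (0, 0, 0) = of_real (real (card (sols n)) * (\<Sum>\<^sub>\<infinity>x. f x) ^ 3)"
    by (simp add: t_def char_sum_0 fourier_mod_0[OF f] power3_eq_cube)
  have "complex_of_real (weighted_count n f) = (1 / of_int q ^ 3) * (t (0, 0, 0) + (\<Sum>k\<in>K - {(0, 0, 0)}. t k))"
    unfolding weighted_count_eq by (simp add: sum.remove[OF finK zero])
  then have "complex_of_real (weighted_count n f - real (card (sols n)) * (\<Sum>\<^sub>\<infinity>x. f x) ^ 3 / qr ^ 3)
      = (1 / of_int q ^ 3) * (\<Sum>k\<in>K - {(0, 0, 0)}. t k)"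
    unfolding t0 qr_def by (simp add: algebra_simps)
  then have "norm (complex_of_real (weighted_count n f - real (card (sols n)) * (\<Sum>\<^sub>\<infinity>x. f x) ^ 3 / qr ^ 3))
      = norm (\<Sum>k\<in>K - {(0, 0, 0)}. t k) / qr ^ 3"
    using q0 by (simp add: norm_mult norm_divide norm_power qr_def)
  then have eq: "\<bar>weighted_count n f - real (card (sols n)) * (\<Sum>\<^sub>\<infinity>x. f x) ^ 3 / qr ^ 3\<bar>
      = norm (\<Sum>k\<in>K - {(0, 0, 0)}. t k) / qr ^ 3"
    by (simp only: norm_of_real)
  have "norm (\<Sum>k\<in>K - {(0, 0, 0)}. t k) \<le> (\<Sum>k\<in>K - {(0, 0, 0)}. norm (t k))" by (rule norm_sum)
  also have "\<dots> \<le> (\<Sum>k\<in>B \<union> far. norm (t k))"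
    using finB finfar by (intro sum_mono2) (auto simp: B_def far_def)
  also have "\<dots> \<le> (\<Sum>k\<in>B. norm (t k)) + (\<Sum>k\<in>far. norm (t k))"
    using sum.union_inter[OF finB finfar, of "\<lambda>k. norm (t k)"] sum_nonneg[of "B \<inter> far" "\<lambda>k. norm (t k)"]
    by simp
  also have "(\<Sum>k\<in>B. norm (t k)) \<le> B0 ^ 3 * W"
  proof -
    have "(\<Sum>k\<in>B. norm (t k)) \<le> (\<Sum>k\<in>B. B0 ^ 3 * (case k of (k1, k2, k3) \<Rightarrow> norm (char_sum n k1 k2 k3)))"
    proof (rule sum_mono, clarify)
      fix k1 k2 k3
      have "norm (fourier_mod q f (- k1) * fourier_mod q f (- k2) * fourier_mod q f (- k3)) \<le> B0 * B0 * B0"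
        unfolding norm_mult q_def using B0 by (intro mult_mono) auto
      then show "norm (t (k1, k2, k3)) \<le> B0 ^ 3 * norm (char_sum n k1 k2 k3)"
        by (simp add: t_def norm_mult power3_eq_cube mult.commute[of "norm (char_sum n k1 k2 k3)"] mult_right_mono)
    qed
    also have "\<dots> = B0 ^ 3 * (\<Sum>(k1, k2, k3)\<in>B. norm (char_sum n k1 k2 k3))" by (simp add: sum_distrib_left)
    also have "\<dots> \<le> B0 ^ 3 * W" using near B0(2) unfolding B_def by (intro mult_left_mono) auto
    finally show ?thesis .
  qed
  also have "(\<Sum>k\<in>far. norm (t k)) \<le> qr ^ 6 * (B0\<^sup>2 * B1)"
  proof -
    have card_sols_le: "real (card (sols n)) \<le> qr ^ 3"
    proof -
      have "card (sols n) \<le> card ({0..<q} \<times> {0..<q} \<times> {0..<q})"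
        by (intro card_mono) (auto simp: sols_def q_def)
      also have "\<dots> = nat q ^ 3" by (simp add: power3_eq_cube)
      finally have "real (card (sols n)) \<le> real (nat q ^ 3)" by (simp only: of_nat_le_iff)
      then show ?thesis using q0 by (simp add: qr_def)
    qed
    have card_far: "real (card far) \<le> qr ^ 3"
    proof -
      have "card far \<le> card K" using finK by (intro card_mono) (auto simp: far_def)
      also have "\<dots> = nat q ^ 3" using h by (simp add: K_def power3_eq_cube q_def)
      finally have "real (card far) \<le> real (nat q ^ 3)" by (simp only: of_nat_le_iff)
      then show ?thesis using q0 by (simp add: qr_def)
    qed
    have "(\<Sum>k\<in>far. norm (t k)) \<le> (\<Sum>k\<in>far. qr ^ 3 * (B0\<^sup>2 * B1))"
    proof (rule sum_mono)
      fix k assume k: "k \<in> far"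
      obtain k1 k2 k3 where k_eq: "k = (k1, k2, k3)" by (cases k)
      have F0: "norm (fourier_mod q f k) \<le> B0" for k using B0(1) by (simp add: q_def)
      have F1: "norm (fourier_mod q f (- k)) \<le> B1" if "k \<in> {-h..h}" "k \<notin> {-L..L}" for k
        unfolding q_def using that by (intro B1(1)) auto
      consider "k1 \<notin> {-L..L}" | "k2 \<notin> {-L..L}" | "k3 \<notin> {-L..L}" using k by (auto simp: far_def k_eq)
      then have "norm (fourier_mod q f (- k1) * fourier_mod q f (- k2) * fourier_mod q f (- k3)) \<le> B0\<^sup>2 * B1"
      proof cases
        case 1
        then have "norm (fourier_mod q f (- k1)) \<le> B1" using k by (intro F1) (auto simp: far_def K_def k_eq)
        then have "norm (fourier_mod q f (- k1)) * norm (fourier_mod q f (- k2)) * norm (fourier_mod q f (- k3)) \<le> B1 * B0 * B0"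
          using B0(2) B1(2) F0 by (intro mult_mono) auto
        then show ?thesis by (simp add: norm_mult power2_eq_square mult_ac)
      next
        case 2
        then have "norm (fourier_mod q f (- k2)) \<le> B1" using k by (intro F1) (auto simp: far_def K_def k_eq)
        then have "norm (fourier_mod q f (- k1)) * norm (fourier_mod q f (- k2)) * norm (fourier_mod q f (- k3)) \<le> B0 * B1 * B0"
          using B0(2) B1(2) F0 by (intro mult_mono) auto
        then show ?thesis by (simp add: norm_mult power2_eq_square mult_ac)
      next
        case 3
        then have "norm (fourier_mod q f (- k3)) \<le> B1" using k by (intro F1) (auto simp: far_def K_def k_eq)
        then have "norm (fourier_mod q f (- k1)) * norm (fourier_mod q f (- k2)) * norm (fourier_mod q f (- k3)) \<le> B0 * B0 * B1"
          using B0(2) B1(2) F0 by (intro mult_mono) auto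
        then show ?thesis by (simp add: norm_mult power2_eq_square mult_ac)
      qed
      moreover have "norm (char_sum n k1 k2 k3) \<le> qr ^ 3" using norm_char_sum_le_card[of n k1 k2 k3] card_sols_le by linarith
      ultimately show "norm (t k) \<le> qr ^ 3 * (B0\<^sup>2 * B1)"
        unfolding t_def k_eq prod.case norm_mult[of "char_sum n k1 k2 k3"] using qr0
        by (intro mult_mono) auto
    qed
    also have "\<dots> = real (card far) * (qr ^ 3 * (B0\<^sup>2 * B1))" by simp
    also have "\<dots> \<le> qr ^ 3 * (qr ^ 3 * (B0\<^sup>2 * B1))"
      using card_far qr0 B0(2) B1(2) by (intro mult_right_mono) auto
    also have "\<dots> = qr ^ 6 * (B0\<^sup>2 * B1)" by (simp flip: mult.assoc power_add)
    finally show ?thesis .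
  qed
  finally have "norm (\<Sum>k\<in>K - {(0, 0, 0)}. t k) \<le> B0 ^ 3 * W + qr ^ 6 * (B0\<^sup>2 * B1)" by simp
  then have "norm (\<Sum>k\<in>K - {(0, 0, 0)}. t k) / qr ^ 3 \<le> (B0 ^ 3 * W + qr ^ 6 * (B0\<^sup>2 * B1)) / qr ^ 3"
    using qr0 by (intro divide_right_mono) auto
  then show ?thesis unfolding qr_def q_def eq[unfolded qr_def q_def] .
qed


text \<open>The exponents add up as q * p q^(1/2) * q^(1/2 - \<epsilon>/2) = p q^(2 - \<epsilon>/2),
  the rounding of n/2 costing at most the factor p. Capping \<epsilon> at 1/2 keeps the exponent of
  L positive.\<close>

lemma near_sum_bound:
  assumes n: "n > 0" and \<epsilon>: "0 < \<epsilon>" "\<epsilon> \<le> 1 / 2"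
    and large: "real_of_int (p ^ n) powr \<epsilon> > real_of_int (p * height)"
  defines "L \<equiv> \<lfloor>real_of_int (p ^ n) powr (1 / 2 - \<epsilon> / 2)\<rfloor>"
  shows "(\<Sum>(k1, k2, k3)\<in>{-L..L} \<times> {-L..L} \<times> {-L..L} - {(0, 0, 0)}. norm (char_sum n k1 k2 k3))
    \<le> 8 * real_of_int (p\<^sup>2 * height) * real_of_int (p ^ n) ^ 2 * real_of_int (p ^ n) powr (- \<epsilon> / 2)
       * ((real n + 1) * (1 + real n * ln (real_of_int p)))"
proof -
  define q where "q = real_of_int (p ^ n)"
  define P where "P = real_of_int p"
  define H where "H = real_of_int height"
  define y where "y = q powr (1 / 2 - \<epsilon> / 2)"
  have P1: "P > 1" using p by (simp add: P_def)
  have q_eq: "q = P ^ n" by (simp add: q_def P_def)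
  have q1: "q \<ge> 1" using P1 by (simp add: q_eq)
  have H1: "H \<ge> 1" using height_ge_1 by (simp add: H_def)
  have y1: "y \<ge> 1" using q1 \<epsilon> by (simp add: y_def ge_one_powr_ge_zero)
  have L_eq: "L = \<lfloor>y\<rfloor>" by (simp add: L_def y_def q_def)
  have L1: "L \<ge> 1" unfolding L_eq using y1 by simp
  have Ly: "real_of_int L \<le> y" unfolding L_eq by simp
  have y_le_q: "y \<le> q" using powr_mono[of "1 / 2 - \<epsilon> / 2" 1 q] q1 \<epsilon> by (simp add: y_def)
  have y2: "y\<^sup>2 * q powr \<epsilon> = q"
  proof -
    have "y\<^sup>2 = q powr (1 - \<epsilon>)"
      unfolding y_def power2_eq_square powr_add[symmetric] by simp
    then have "y\<^sup>2 * q powr \<epsilon> = q powr 1" by (simp flip: powr_add)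
    then show ?thesis using q1 by simp
  qed
  \<comment> \<open>Since L^2 \<le> q^(1 - \<epsilon>), it suffices that q^\<epsilon> exceeds p *
    \<open>height\<close>; the extra p pays for p^(n-1) in place of q.\<close>
  have hL: "height * L\<^sup>2 < p ^ (n - 1)"
  proof -
    have "(P * H) * y\<^sup>2 < q powr \<epsilon> * y\<^sup>2"
      using large y1 by (intro mult_strict_right_mono) (auto simp: P_def H_def q_def)
    also have "\<dots> = q" using y2 by (simp add: mult.commute)
    also have "\<dots> = P * P ^ (n - 1)" using n by (simp add: q_eq power_eq_if)
    finally have "P * (H * y\<^sup>2) < P * P ^ (n - 1)" by (simp only: mult.assoc)
    then have "H * y\<^sup>2 < P ^ (n - 1)" using P1 by simp
    moreover have "H * (real_of_int L)\<^sup>2 \<le> H * y\<^sup>2"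
      using Ly L1 H1 by (intro mult_left_mono power_mono) auto
    ultimately have "H * (real_of_int L)\<^sup>2 < P ^ (n - 1)" by linarith
    then have "real_of_int (height * L\<^sup>2) < real_of_int (p ^ (n - 1))" by (simp add: H_def P_def)
    then show ?thesis by (simp only: of_int_less_iff)
  qed
  have Lm: "L < p ^ (n div 2)"
  proof -
    have "1 * L\<^sup>2 \<le> height * L\<^sup>2" using height_ge_1 by (intro mult_right_mono) auto
    also have "\<dots> < p ^ (n - 1)" by (rule hL)
    also have "\<dots> \<le> p ^ (2 * (n div 2))" using p by (intro power_increasing) linarith+
    also have "\<dots> = (p ^ (n div 2))\<^sup>2" by (rule power_even_eq)
    finally have "L\<^sup>2 < (p ^ (n div 2))\<^sup>2" by simp
    then show ?thesis using p_pos by (intro power2_less_imp_less[of L]) auto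
  qed
  have half: "P ^ (n - n div 2) \<le> P * q powr (1 / 2)"
  proof (rule power2_le_imp_le)
    have "(P ^ (n - n div 2))\<^sup>2 = P ^ (2 * (n - n div 2))" by (rule power_even_eq[symmetric])
    also have "\<dots> \<le> P ^ (n + 2)" using P1 by (intro power_increasing) linarith+
    also have "\<dots> = P\<^sup>2 * q" by (simp add: q_eq power_add power2_eq_square mult_ac)
    also have "q = (q powr (1 / 2))\<^sup>2" using q1 by (simp add: power2_eq_square flip: powr_add)
    finally show "(P ^ (n - n div 2))\<^sup>2 \<le> (P * q powr (1 / 2))\<^sup>2" by (simp add: power_mult_distrib)
  qed (use P1 in auto)
  have harm: "(\<Sum>h\<in>{1..L}. 1 / real_of_int h) \<le> 1 + real n * ln P"
  proof -
    have "(\<Sum>h\<in>{1..L}. 1 / real_of_int h) \<le> 1 + ln (real_of_int L)" by (rule sum_inverse_le_ln[OF L1])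
    also have "ln (real_of_int L) \<le> ln q" using L1 Ly y_le_q by (subst ln_le_cancel_iff) auto
    also have "ln q = real n * ln P" using P1 by (simp add: q_eq ln_realpow)
    finally show ?thesis by simp
  qed
  have harm0: "(\<Sum>h\<in>{1..L}. 1 / real_of_int h) \<ge> 0" by (intro sum_nonneg) auto
  have "(\<Sum>(k1, k2, k3)\<in>{-L..L} \<times> {-L..L} \<times> {-L..L} - {(0, 0, 0)}. norm (char_sum n k1 k2 k3))
      \<le> 8 * real_of_int (p ^ n * p ^ (n - n div 2) * p * height * L) * (real n + 1) * (\<Sum>h\<in>{1..L}. 1 / real_of_int h)"
    using L1 Lm hL by (intro sum_norm_char_sum_near_le n) auto
  also have "\<dots> = (8 * q * P * H * (real n + 1)) * (P ^ (n - n div 2) * (real_of_int L * (\<Sum>h\<in>{1..L}. 1 / real_of_int h)))"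
    by (simp add: q_def P_def H_def mult_ac)
  also have "\<dots> \<le> (8 * q * P * H * (real n + 1)) * ((P * q powr (1 / 2)) * (y * (1 + real n * ln P)))"
    using half Ly harm harm0 L1 P1 q1 H1 y1 by (intro mult_left_mono mult_mono) (auto intro!: mult_nonneg_nonneg)
  also have "\<dots> = 8 * (P\<^sup>2 * H) * (q * (q powr (1 / 2) * y)) * ((real n + 1) * (1 + real n * ln P))"
    by (simp add: power2_eq_square mult_ac)
  also have "q powr (1 / 2) * y = q * q powr (- \<epsilon> / 2)"
  proof -
    have "q powr (1 / 2) * y = q powr (1 + - \<epsilon> / 2)" unfolding y_def powr_add[symmetric] by simp
    also have "\<dots> = q powr 1 * q powr (- \<epsilon> / 2)" by (rule powr_add)
    finally show ?thesis using q1 by simp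
  qed
  finally show ?thesis by (simp add: q_def P_def H_def power2_eq_square mult_ac)
qed

section \<open>The asymptotic formula with explicit error\<close>

lemma C_p_eq:
  assumes "n > 0"
  shows "real (card (sols n)) / real_of_int (p ^ n) ^ 3 = C_p p a1 a2 a3 / real_of_int (p ^ n)"
proof -
  obtain k where k: "n = Suc k" using assms by (cases n) auto
  have "real (card (sols n)) = real_of_int (int (card (sols n)))" by simp
  also have "\<dots> = real_of_int ((p - s_p p a1 a2 a3) * (p - 1)) * real_of_int p ^ (2 * k)"
    unfolding k card_sols by simp
  finally have c: "real (card (sols n)) = real_of_int ((p - s_p p a1 a2 a3) * (p - 1)) * real_of_int p ^ (2 * k)" .
  have "real_of_int p \<noteq> 0" using p by simp
  then show ?thesis unfolding c unfolding C_p_def k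
    by (simp add: field_simps power2_eq_square power3_eq_cube power_mult)
qed

text \<open>Three relative errors are collected into K: q^(-\<epsilon>/2) with a polynomial in n
  from the near frequencies, 1/q from the far ones, and 1/N from the Riemann sum. The last two are
  dominated by the first, so the bound is uniform in N.\<close>

lemma weighted_count_asymptotic:
  assumes \<epsilon>: "0 < \<epsilon>" "\<epsilon> \<le> 1 / 2" and \<Phi>: "schwartz \<Phi>" "\<And>x. \<Phi> x \<ge> 0"
  obtains K where "K \<ge> 0" "\<And>n N. n > 0 \<Longrightarrow> real_of_int (p ^ n) powr \<epsilon> > real_of_int (p * height) \<Longrightarrow>
     N \<ge> real_of_int (p ^ n) powr (1 / 2 + \<epsilon>) \<Longrightarrow>
     \<bar>weighted_count n (\<lambda>x. \<Phi> (real_of_int x / N)) - integral UNIV \<Phi> ^ 3 * C_p p a1 a2 a3 * N ^ 3 / real_of_int (p ^ n)\<bar>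
     \<le> K * (((real n + 1) * (1 + real n * ln (real_of_int p))) * real_of_int (p ^ n) powr (- \<epsilon> / 2)) * (N ^ 3 / real_of_int (p ^ n))"
proof -
  \<comment> \<open>Each difference gains q^(\<epsilon>/2) outside the box, so j of them gain q^5.
    The trivial far bound loses q^6/q^3 = q^3, which leaves N^3/q^2, a factor 1/q below the main
    term.\<close>
  define j where "j = nat \<lceil>10 / \<epsilon>\<rceil>"
  have j: "real j * (\<epsilon> / 2) \<ge> 5"
  proof -
    have "10 / \<epsilon> \<le> real j" unfolding j_def by linarith
    then show ?thesis using \<epsilon>(1) by (simp add: field_simps)
  qed
  define I where "I = integral UNIV \<Phi>"
  have I0: "I \<ge> 0" unfolding I_def using schwartz_pos_integral(1)[OF \<Phi>] \<Phi>(2) by (intro integral_nonneg) auto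
  obtain CR where CR: "CR \<ge> 0" "\<And>N. N \<ge> 1 \<Longrightarrow> \<bar>(\<Sum>\<^sub>\<infinity>x::int. \<Phi> (real_of_int x / N)) - N * I\<bar> \<le> CR"
    using riemann_sum_error[OF \<Phi>] unfolding I_def by blast
  obtain C0 where C0: "C0 \<ge> 0" "\<And>N. N \<ge> 1 \<Longrightarrow> (\<Sum>\<^sub>\<infinity>x. \<bar>(fdiff ^^ 0) (\<lambda>x. \<Phi> (real_of_int x / N)) x\<bar>) \<le> C0 * N / N ^ 0"
    "\<And>N. N \<ge> 1 \<Longrightarrow> (\<lambda>x. \<bar>(fdiff ^^ 0) (\<lambda>x. \<Phi> (real_of_int x / N)) x\<bar>) summable_on UNIV"
    using schwartz_fdiff_sum[OF \<Phi>(1)] by blast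
  obtain Cj where Cj: "Cj \<ge> 0" "\<And>N. N \<ge> 1 \<Longrightarrow> (\<Sum>\<^sub>\<infinity>x. \<bar>(fdiff ^^ j) (\<lambda>x. \<Phi> (real_of_int x / N)) x\<bar>) \<le> Cj * N / N ^ j"
    using schwartz_fdiff_sum[OF \<Phi>(1)] by metis
  define Cp where "Cp = C_p p a1 a2 a3"
  define P where "P = real_of_int p"
  define H where "H = real_of_int (p\<^sup>2 * height)"
  have P1: "P > 1" using p by (simp add: P_def)
  have H0: "H \<ge> 0" using height_ge_1 by (simp add: H_def)
  \<comment> \<open>\<open>M\<close> * N bounds both the sum \<open>A\<close> of the samples and N
    I, so A^2 + A N I + (N I)^2, the cofactor in the difference of cubes, is at most 3 M^2
    N^2.\<close>
  define M where "M = C0 + I"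
  have M0: "M \<ge> 0" using C0 I0 by (simp add: M_def)
  define K1 K2 K3 where "K1 = C0 ^ 3 * (8 * H)" and "K2 = C0\<^sup>2 * Cj" and "K3 = \<bar>Cp\<bar> * (CR * (3 * M\<^sup>2))"
  have K0: "K1 \<ge> 0" "K2 \<ge> 0" "K3 \<ge> 0" using C0 Cj CR H0 by (simp_all add: K1_def K2_def K3_def)
  have "\<bar>weighted_count n (\<lambda>x. \<Phi> (real_of_int x / N)) - I ^ 3 * Cp * N ^ 3 / real_of_int (p ^ n)\<bar>
     \<le> (K1 + K2 + K3) * (((real n + 1) * (1 + real n * ln P)) * real_of_int (p ^ n) powr (- \<epsilon> / 2)) * (N ^ 3 / real_of_int (p ^ n))"
    if n: "n > 0" and large: "real_of_int (p ^ n) powr \<epsilon> > real_of_int (p * height)"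
      and N: "N \<ge> real_of_int (p ^ n) powr (1 / 2 + \<epsilon>)" for n N
  proof -
    define q where "q = real_of_int (p ^ n)"
    define r where "r = q powr (- \<epsilon> / 2)"
    define G where "G = (real n + 1) * (1 + real n * ln P)"
    define L where "L = \<lfloor>q powr (1 / 2 - \<epsilon> / 2)\<rfloor>"
    define f where "f = (\<lambda>x::int. \<Phi> (real_of_int x / N))"
    define A where "A = (\<Sum>\<^sub>\<infinity>x. f x)"
    have q_eq: "q = P ^ n" by (simp add: q_def P_def)
    have q1: "q \<ge> 1" using P1 by (simp add: q_eq)
    have N_ge: "N \<ge> q powr (1 / 2 + \<epsilon>)" using N by (simp add: q_def)
    have N1: "N \<ge> 1" using N_ge ge_one_powr_ge_zero[OF q1, of "1 / 2 + \<epsilon>"] \<epsilon> by simp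
    have G1: "G \<ge> 1"
    proof -
      have "ln P \<ge> 0" using P1 by simp
      then have "1 * 1 \<le> (real n + 1) * (1 + real n * ln P)" by (intro mult_mono) auto
      then show ?thesis by (simp add: G_def)
    qed
    have r0: "r \<ge> 0" by (simp add: r_def)
    have r_ge: "q powr a \<le> r" if "a \<le> - \<epsilon> / 2" for a unfolding r_def using q1 that by (intro powr_mono)
    have sum_f: "f summable_on UNIV" using C0(3)[OF N1] \<Phi>(2) by (simp add: f_def)
    have abs_sum: "(\<Sum>\<^sub>\<infinity>x. \<bar>f x\<bar>) \<le> C0 * N" using C0(2)[OF N1] by (simp add: f_def)
    obtain h where h: "p ^ n = 2 * h + 1" "h \<ge> 0" by (rule odd_power_p)
    have pn0: "p ^ n > 0" using p_pos by simp
    have B0: "norm (fourier_mod (p ^ n) f k) \<le> C0 * N" for k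
      using norm_fourier_mod_le[OF sum_f, of "p ^ n" k] abs_sum by linarith
    have B1: "norm (fourier_mod (p ^ n) f k) \<le> Cj * N / q ^ 5" if k: "\<bar>k\<bar> \<le> h" "\<bar>k\<bar> > L" for k
    proof -
      \<comment> \<open>Outside the box N |k| / q \<ge> q^(\<epsilon>/2): the exponents 1/2 +
        \<epsilon> of N and 1/2 - \<epsilon>/2 of |k| exceed 1 by \<epsilon>/2 in total.\<close>
      define a where "a = real_of_int \<bar>k\<bar> / q"
      have "q powr (1 / 2 - \<epsilon> / 2) < real_of_int \<bar>k\<bar>" using k(2) unfolding L_def by linarith
      then have "q powr (1 / 2 + \<epsilon>) * q powr (1 / 2 - \<epsilon> / 2) \<le> N * real_of_int \<bar>k\<bar>"
        using N_ge N1 by (intro mult_mono) auto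
      then have "q powr (1 + \<epsilon> / 2) \<le> N * real_of_int \<bar>k\<bar>" by (simp flip: powr_add)
      then have "q * q powr (\<epsilon> / 2) \<le> N * real_of_int \<bar>k\<bar>" using q1 by (simp add: powr_add)
      then have Na: "q powr (\<epsilon> / 2) \<le> N * a" using q1 by (simp add: a_def field_simps)
      have "q ^ 5 = q powr 5" using q1 by (simp add: powr_realpow)
      also have "\<dots> \<le> q powr (real j * (\<epsilon> / 2))" using j q1 by (intro powr_mono)
      also have "\<dots> = (q powr (\<epsilon> / 2)) ^ j" using q1 by (simp add: powr_realpow[symmetric] powr_powr mult.commute)
      also have "\<dots> \<le> (N * a) ^ j" using Na by (intro power_mono) auto
      finally have qa: "q ^ 5 \<le> (N * a) ^ j" .
      have "a ^ j * norm (fourier_mod (p ^ n) f k) \<le> (\<Sum>\<^sub>\<infinity>x. \<bar>(fdiff ^^ j) f x\<bar>)"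
        using norm_fourier_mod_fdiff_le[OF sum_f pn0, of k j] k h by (simp add: a_def q_def)
      also have "\<dots> \<le> Cj * N / N ^ j" using Cj(2)[OF N1] by (simp add: f_def)
      finally have "N ^ j * (a ^ j * norm (fourier_mod (p ^ n) f k)) \<le> N ^ j * (Cj * N / N ^ j)"
        using N1 by (intro mult_left_mono) auto
      then have "(N * a) ^ j * norm (fourier_mod (p ^ n) f k) \<le> Cj * N"
        using N1 by (simp add: power_mult_distrib mult.assoc)
      moreover have "q ^ 5 * norm (fourier_mod (p ^ n) f k) \<le> (N * a) ^ j * norm (fourier_mod (p ^ n) f k)"
        using qa by (intro mult_right_mono) auto
      ultimately show ?thesis using q1 by (simp add: field_simps)
    qed
    have nonneg: "C0 * N \<ge> 0" "Cj * N / q ^ 5 \<ge> 0" using C0(1) Cj(1) N1 q1 by simp_all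
    have near: "(\<Sum>(k1, k2, k3)\<in>{-L..L} \<times> {-L..L} \<times> {-L..L} - {(0, 0, 0)}. norm (char_sum n k1 k2 k3))
      \<le> 8 * H * q ^ 2 * r * G"
      using near_sum_bound[OF n \<epsilon> large] unfolding L_def H_def r_def G_def q_def P_def .
    have "\<bar>weighted_count n f - real (card (sols n)) * A ^ 3 / q ^ 3\<bar>
        \<le> ((C0 * N) ^ 3 * (8 * H * q ^ 2 * r * G) + q ^ 6 * ((C0 * N)\<^sup>2 * (Cj * N / q ^ 5))) / q ^ 3"
      unfolding A_def q_def
      by (rule weighted_count_error[OF n h sum_f B0 nonneg(1) B1[unfolded q_def] nonneg(2)[unfolded q_def] near[unfolded q_def]])
    also have "\<dots> = (K1 * (G * r) + K2 * (1 / q)) * (N ^ 3 / q)"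
      using q1 by (simp add: K1_def K2_def field_simps power2_eq_square power3_eq_cube eval_nat_numeral)
    also have "\<dots> \<le> (K1 * (G * r) + K2 * (G * r)) * (N ^ 3 / q)"
    proof -
      have "1 / q = q powr (-1)" using q1 by (simp add: powr_minus_divide)
      also have "\<dots> \<le> 1 * r" using r_ge[of "-1"] \<epsilon> by simp
      also have "\<dots> \<le> G * r" using G1 r0 by (intro mult_right_mono)
      finally show ?thesis using K0 N1 q1 by (intro mult_right_mono add_left_mono mult_left_mono) auto
    qed
    finally have e1: "\<bar>weighted_count n f - real (card (sols n)) * A ^ 3 / q ^ 3\<bar> \<le> (K1 * (G * r) + K2 * (G * r)) * (N ^ 3 / q)" .
    have "\<bar>A ^ 3 - (N * I) ^ 3\<bar> \<le> CR * (3 * M\<^sup>2) * N\<^sup>2"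
    proof -
      have A0: "A \<ge> 0" unfolding A_def f_def by (intro infsum_nonneg \<Phi>)
      have "A \<le> (\<Sum>\<^sub>\<infinity>x. \<bar>f x\<bar>)" unfolding A_def f_def using \<Phi>(2) by simp
      then have "A \<le> C0 * N" using abs_sum by linarith
      moreover have "I * N \<ge> 0" using I0 N1 by simp
      ultimately have AM: "A \<le> M * N" unfolding M_def distrib_right by linarith
      have IM: "N * I \<le> M * N" using C0(1) N1 by (simp add: M_def mult.commute)
      have NI0: "N * I \<ge> 0" using I0 N1 by simp
      have "A * A \<le> (M * N) * (M * N)" "A * (N * I) \<le> (M * N) * (M * N)" "(N * I) * (N * I) \<le> (M * N) * (M * N)"
        using AM IM A0 NI0 by - (rule mult_mono; linarith)+
      then have "A * A + A * (N * I) + (N * I) * (N * I) \<le> 3 * M\<^sup>2 * N\<^sup>2"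
        by (simp add: power2_eq_square mult_ac)
      moreover have "\<bar>A - N * I\<bar> \<le> CR" using CR(2)[OF N1] by (simp add: A_def f_def)
      ultimately have "\<bar>A - N * I\<bar> * (A * A + A * (N * I) + (N * I) * (N * I)) \<le> CR * (3 * M\<^sup>2 * N\<^sup>2)"
        using A0 NI0 CR(1) by (intro mult_mono) auto
      moreover have "\<bar>A ^ 3 - (N * I) ^ 3\<bar> = \<bar>A - N * I\<bar> * (A * A + A * (N * I) + (N * I) * (N * I))"
      proof -
        have "A ^ 3 - (N * I) ^ 3 = (A - N * I) * (A * A + A * (N * I) + (N * I) * (N * I))"
          by (simp add: power3_eq_cube algebra_simps)
        moreover have "A * A + A * (N * I) + (N * I) * (N * I) \<ge> 0" using A0 NI0 by simp
        ultimately show ?thesis by (simp add: abs_mult)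
      qed
      ultimately show ?thesis by (simp add: mult.assoc)
    qed
    then have "\<bar>Cp\<bar> / q * \<bar>A ^ 3 - (N * I) ^ 3\<bar> \<le> \<bar>Cp\<bar> / q * (CR * (3 * M\<^sup>2) * N\<^sup>2)"
      using q1 by (intro mult_left_mono) auto
    moreover have "\<bar>real (card (sols n)) * A ^ 3 / q ^ 3 - I ^ 3 * Cp * N ^ 3 / q\<bar> = \<bar>Cp\<bar> / q * \<bar>A ^ 3 - (N * I) ^ 3\<bar>"
    proof -
      have "real (card (sols n)) * A ^ 3 / q ^ 3 = real (card (sols n)) / q ^ 3 * A ^ 3" by simp
      also have "\<dots> = Cp / q * A ^ 3" unfolding q_def Cp_def C_p_eq[OF n] ..
      finally have "real (card (sols n)) * A ^ 3 / q ^ 3 - I ^ 3 * Cp * N ^ 3 / q = Cp / q * (A ^ 3 - (N * I) ^ 3)"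
        by (simp add: power_mult_distrib right_diff_distrib)
      then show ?thesis using q1 by (simp add: abs_mult)
    qed
    moreover have "\<bar>Cp\<bar> / q * (CR * (3 * M\<^sup>2) * N\<^sup>2) = K3 * (1 / N) * (N ^ 3 / q)"
      using N1 by (simp add: K3_def power2_eq_square power3_eq_cube)
    moreover have "K3 * (1 / N) * (N ^ 3 / q) \<le> K3 * (G * r) * (N ^ 3 / q)"
    proof -
      have "1 / N \<le> 1 / q powr (1 / 2 + \<epsilon>)" using N_ge N1 q1 by (intro divide_left_mono mult_pos_pos) auto
      also have "\<dots> = q powr (- (1 / 2 + \<epsilon>))" by (simp only: powr_minus_divide)
      also have "\<dots> \<le> 1 * r" using r_ge[of "- (1 / 2 + \<epsilon>)"] \<epsilon> by simp
      also have "\<dots> \<le> G * r" using G1 r0 by (intro mult_right_mono)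
      finally show ?thesis using K0 N1 q1 by (intro mult_right_mono mult_left_mono) auto
    qed
    ultimately have e2: "\<bar>real (card (sols n)) * A ^ 3 / q ^ 3 - I ^ 3 * Cp * N ^ 3 / q\<bar> \<le> K3 * (G * r) * (N ^ 3 / q)"
      by linarith
    have "\<bar>weighted_count n f - I ^ 3 * Cp * N ^ 3 / q\<bar> \<le> (K1 * (G * r) + K2 * (G * r)) * (N ^ 3 / q) + K3 * (G * r) * (N ^ 3 / q)"
    proof -
      have "\<bar>a - c\<bar> \<le> u + v" if "\<bar>a - b\<bar> \<le> u" "\<bar>b - c\<bar> \<le> v" for a b c u v :: real
        using that by linarith
      from this[OF e1 e2] show ?thesis .
    qed
    also have "\<dots> = (K1 + K2 + K3) * (G * r) * (N ^ 3 / q)" by (simp only: distrib_right)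
    finally show ?thesis unfolding f_def q_def G_def r_def .
  qed
  then show ?thesis
    using that[of "K1 + K2 + K3"] K0 unfolding I_def Cp_def P_def by simp
qed

end

section \<open>Passage to the limit\<close>

lemma poly_exp_decay:
  fixes l c :: real
  assumes "l > 0" "c > 0"
  shows "(\<lambda>n. ((real n + 1) * (1 + real n * l)) * exp (- (real n * c))) \<longlonglongrightarrow> 0"
  using assms by real_asymp

lemma exp_linear_at_top: "(c::real) > 0 \<Longrightarrow> filterlim (\<lambda>n. exp (real n * c)) at_top sequentially"
  by real_asymp

text \<open>Uniform asymptotic equivalence is expressed as a relative error below \<eta>, with a
  threshold \<open>n0\<close> chosen before N. Multiplying out the ratio gives the inequality a
  meaning also for the zero function, where both sides vanish.\<close>

theorem theorem1p1:
  fixes \<epsilon> :: real and p a1 a2 a3 :: int and \<Phi> :: "real \<Rightarrow> real"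
  assumes "\<epsilon> > 0" and "prime p" and "p > 2"
    and "coprime a1 p" and "coprime a2 p" and "coprime a3 p"
    and "p > s_p p a1 a2 a3"
    and "schwartz \<Phi>" and "\<forall>x. \<Phi> x \<ge> 0"
  shows "\<forall>\<eta>>0. \<exists>n0::nat. \<forall>n\<ge>n0. \<forall>N::real.
           N \<ge> real_of_int (p ^ n) powr (1/2 + \<epsilon>) \<longrightarrow>
           \<bar>(\<Sum>\<^sub>\<infinity>(x1, x2, x3) \<in> {(x1 :: int, x2 :: int, x3 :: int).
                  coprime (x1 * x2 * x3) p \<and>
                  [a1 * x1 ^ 2 + a2 * x2 ^ 2 + a3 * x3 ^ 2 = 0] (mod (p ^ n))}.
                \<Phi> (real_of_int x1 / N) * \<Phi> (real_of_int x2 / N) * \<Phi> (real_of_int x3 / N))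
             - fourier_at_0 \<Phi> ^ 3 * C_p p a1 a2 a3 * N ^ 3 / real_of_int (p ^ n)\<bar>
           \<le> \<eta> * (fourier_at_0 \<Phi> ^ 3 * C_p p a1 a2 a3 * N ^ 3 / real_of_int (p ^ n))"
proof (cases "\<forall>x. \<Phi> x = 0")
  case True
  then have "\<Phi> = (\<lambda>_. 0)" by auto
  then show ?thesis by (simp add: fourier_at_0_def case_prod_unfold)
next
  case False
  then obtain x0 where x0: "\<Phi> x0 \<noteq> 0" by blast
  interpret odd_prime p by standard (use assms in auto)
  interpret ternary_form p a1 a2 a3
    by standard (use assms coprime_p_iff in auto)
  have pos: "\<And>x. \<Phi> x \<ge> 0" using assms(9) by blast
  \<comment> \<open>Lowering the exponent only enlarges the admissible range of N, so the bound for
    \<open>e\<close> covers every N allowed for \<epsilon>.\<close>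
  define e where "e = min \<epsilon> (1 / 2)"
  have e: "0 < e" "e \<le> 1 / 2" "e \<le> \<epsilon>" using assms(1) by (auto simp: e_def)
  define I where "I = integral UNIV \<Phi>"
  define Cp where "Cp = C_p p a1 a2 a3"
  define P where "P = real_of_int p"
  have P1: "P > 1" using p by (simp add: P_def)
  have lnP: "ln P > 0" using P1 by simp
  have I0: "I > 0" unfolding I_def using integral_pos_schwartz[OF assms(8) pos x0] .
  have Cp0: "Cp > 0"
  proof -
    have "(p - s_p p a1 a2 a3) * (p - 1) > 0" using assms(3,7) by simp
    then show ?thesis unfolding Cp_def C_p_def using p_pos by (intro divide_pos_pos) (simp_all only: of_int_0_less_iff zero_less_power)
  qed
  obtain K where K: "K \<ge> 0" "\<And>n N. n > 0 \<Longrightarrow> real_of_int (p ^ n) powr e > real_of_int (p * height) \<Longrightarrow>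
     N \<ge> real_of_int (p ^ n) powr (1 / 2 + e) \<Longrightarrow>
     \<bar>weighted_count n (\<lambda>x. \<Phi> (real_of_int x / N)) - I ^ 3 * Cp * N ^ 3 / real_of_int (p ^ n)\<bar>
     \<le> K * (((real n + 1) * (1 + real n * ln P)) * real_of_int (p ^ n) powr (- e / 2)) * (N ^ 3 / real_of_int (p ^ n))"
    using weighted_count_asymptotic[OF e(1,2) assms(8) pos] unfolding I_def Cp_def P_def by blast
  have powr_exp: "real_of_int (p ^ n) powr a = exp (real n * (a * ln P))" for n a
    using P1 by (simp add: powr_def ln_realpow flip: P_def)
  have lim1: "(\<lambda>n. K * (((real n + 1) * (1 + real n * ln P)) * real_of_int (p ^ n) powr (- e / 2))) \<longlonglongrightarrow> 0"
    using tendsto_mult_left[OF poly_exp_decay[OF lnP, of "e / 2 * ln P"], of K] e(1) lnP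
    unfolding powr_exp by simp
  have lim2: "filterlim (\<lambda>n. real_of_int (p ^ n) powr e) at_top sequentially"
  proof -
    have "e * ln P > 0" using e(1) lnP by simp
    then show ?thesis unfolding powr_exp by (rule exp_linear_at_top)
  qed
  show ?thesis
  proof (intro allI impI)
    fix \<eta> :: real assume \<eta>: "\<eta> > 0"
    \<comment> \<open>The relative tolerance measured in units of N^3/q. It is positive because I >
      0 by continuity of \<Phi> at a nonzero value and Cp > 0 by p > \<open>s_p\<close>.\<close>
    define \<delta> where "\<delta> = \<eta> * (I ^ 3 * Cp)"
    have \<delta>: "\<delta> > 0" using \<eta> I0 Cp0 by (simp add: \<delta>_def)
    have "eventually (\<lambda>n. n > 0 \<and> real_of_int (p ^ n) powr e > real_of_int (p * height) \<and>
       K * (((real n + 1) * (1 + real n * ln P)) * real_of_int (p ^ n) powr (- e / 2)) < \<delta>) sequentially"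
      using eventually_gt_at_top[of "0::nat"] order_tendstoD(2)[OF lim1 \<delta>]
        filterlim_at_top_dense[THEN iffD1, OF lim2, rule_format, of "real_of_int (p * height)"]
      by eventually_elim simp
    then obtain n0 where n0: "\<And>n. n \<ge> n0 \<Longrightarrow> n > 0 \<and> real_of_int (p ^ n) powr e > real_of_int (p * height) \<and>
       K * (((real n + 1) * (1 + real n * ln P)) * real_of_int (p ^ n) powr (- e / 2)) < \<delta>"
      unfolding eventually_sequentially by blast
    show "\<exists>n0. \<forall>n\<ge>n0. \<forall>N. N \<ge> real_of_int (p ^ n) powr (1/2 + \<epsilon>) \<longrightarrow>
           \<bar>(\<Sum>\<^sub>\<infinity>(x1, x2, x3) \<in> {(x1 :: int, x2 :: int, x3 :: int).
                  coprime (x1 * x2 * x3) p \<and>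
                  [a1 * x1 ^ 2 + a2 * x2 ^ 2 + a3 * x3 ^ 2 = 0] (mod (p ^ n))}.
                \<Phi> (real_of_int x1 / N) * \<Phi> (real_of_int x2 / N) * \<Phi> (real_of_int x3 / N))
             - fourier_at_0 \<Phi> ^ 3 * C_p p a1 a2 a3 * N ^ 3 / real_of_int (p ^ n)\<bar>
           \<le> \<eta> * (fourier_at_0 \<Phi> ^ 3 * C_p p a1 a2 a3 * N ^ 3 / real_of_int (p ^ n))"
    proof (intro exI[of _ n0] allI impI)
      fix n N assume n: "n \<ge> n0" and N: "real_of_int (p ^ n) powr (1/2 + \<epsilon>) \<le> N"
      have q1: "real_of_int (p ^ n) \<ge> 1" using P1 by (simp add: P_def)
      have "real_of_int (p ^ n) powr (1/2 + e) \<le> real_of_int (p ^ n) powr (1/2 + \<epsilon>)"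
        using q1 e(3) by (intro powr_mono) auto
      then have N': "real_of_int (p ^ n) powr (1/2 + e) \<le> N" using N by linarith
      have "N \<ge> 0" using N' by (meson order_trans powr_ge_zero)
      have "\<bar>weighted_count n (\<lambda>x. \<Phi> (real_of_int x / N)) - I ^ 3 * Cp * N ^ 3 / real_of_int (p ^ n)\<bar>
        \<le> K * (((real n + 1) * (1 + real n * ln P)) * real_of_int (p ^ n) powr (- e / 2)) * (N ^ 3 / real_of_int (p ^ n))"
        using n0[OF n] N' by (intro K(2)) auto
      also have "\<dots> \<le> \<delta> * (N ^ 3 / real_of_int (p ^ n))"
        using n0[OF n] q1 \<open>N \<ge> 0\<close> by (intro mult_right_mono divide_nonneg_nonneg) auto
      also have "\<dots> = \<eta> * (I ^ 3 * Cp * N ^ 3 / real_of_int (p ^ n))" by (simp add: \<delta>_def)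
      finally show "\<bar>(\<Sum>\<^sub>\<infinity>(x1, x2, x3) \<in> {(x1 :: int, x2 :: int, x3 :: int).
                  coprime (x1 * x2 * x3) p \<and>
                  [a1 * x1 ^ 2 + a2 * x2 ^ 2 + a3 * x3 ^ 2 = 0] (mod (p ^ n))}.
                \<Phi> (real_of_int x1 / N) * \<Phi> (real_of_int x2 / N) * \<Phi> (real_of_int x3 / N))
             - fourier_at_0 \<Phi> ^ 3 * C_p p a1 a2 a3 * N ^ 3 / real_of_int (p ^ n)\<bar>
           \<le> \<eta> * (fourier_at_0 \<Phi> ^ 3 * C_p p a1 a2 a3 * N ^ 3 / real_of_int (p ^ n))"
        unfolding weighted_count_def fourier_at_0_def I_def Cp_def .
    qed
  qed
qed

end
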